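(* With the prior distribution $\Pi$ satisfying conditions (P1$'$), (P2) and (P3) described in the context, we have $$\sup_{\nu^\star\in\mathcal M}\mathsf P^{(n)}_{\nu^\star*\Phi}\Big[\Pi\Big(\mathsf W_1(\nu,\nu^\star)\ge M\frac{\log\log n}{\log n}\,\Big|\,X_{1:n}\Big)\Big]=o(1)$$ for some universal constant $M>0$.
   Context: Notation. $\mathbb N=\{1,2,\dots\}$, $\Delta_k:=\{w\in[0,1]^k:\sum_{j=1}^k w_j=1\}$; $o(1)$ is as $n\to\infty$. Fix $L>0$. $\mathcal M_k$ is the set of distributions $\sum_{j=1}^k w_j\delta_{\theta_j}$ with $(w_1,\dots,w_k)\in\Delta_k$ and $\theta_1,\dots,\theta_k\in[-L,L]$ ($\delta_\theta$ is the Dirac measure at $\theta$), and $\mathcal M:=\bigcup_{k\in\mathbb N}\mathcal M_k$. $\Phi$ is the standard normal distribution and, for $\nu=\sum_j w_j\delta_{\theta_j}$, $\nu*\Phi=\sum_j w_j\mathrm N(\theta_j,1)$. $\mathsf P_G^{(n)}$ denotes probability or expectation when $X_1,\dots,X_n$ are i.i.d. from $G$, $p_G^{(n)}$ is the joint Lebesgue density, and $X_{1:n}=(X_1,\dots,X_n)$. For $\nu=\sum_{j=1}^kw_j\delta_{\theta_j}$ and $\nu'=\sum_{h=1}^{k'}w'_h\delta_{\theta'_h}$, $\mathsf W_1(\nu,\nu')$ is the infimum of $\sum_{j,h}p_{jh}|\theta_j-\theta'_h|$ over all $(p_{jh})\in[0,1]^{k\times k'}$ with $\sum_hp_{jh}=w_j$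 and $\sum_jp_{jh}=w'_h$. Prior and posterior. The prior $\Pi$ (which may depend on $n$) first samples $k\in\mathbb N$ from $\Pi(k)$ and then samples the atoms $\theta\in[-L,L]^k$ from $\Pi(\theta|k)$ and the weights $w\in\Delta_k$ from $\Pi(w|k)$, which induces a distribution on $\mathcal M$ through $\nu=\sum_{j=1}^kw_j\delta_{\theta_j}$. The posterior is $\Pi(\mathrm d\nu|X_{1:n}):=p^{(n)}_{\nu*\Phi}(X_{1:n})\Pi(\mathrm d\nu)\big/\int p^{(n)}_{\nu*\Phi}(X_{1:n})\Pi(\mathrm d\nu)$. Conditions on the prior. (P1$'$) There are constants $c_1>0$, $c_2>0$ and $b_0>0$ such that for any $n\in\mathbb N$ and $k^\circ\in\mathbb N$, $\Pi(k=k^\circ)\ge c_1e^{-(c_2\log^{b_0}n)k^\circ}$. (P2) For any $k\in\mathbb N$ and any $(w_1^0,\dots,w_k^0)\in\Delta_k$, there are positive constants $c_4$ and $c_5$ such that for any $\eta\in(0,1/k)$, $\Pi\big(\sum_{j=1}^k|w_j-w_j^0|\le\eta\,\big|\,k\big)\ge c_4\eta^{c_5k}$. (P3) For any $k\in\mathbb N$ and any $\theta^0\in[-L,L]^k$, there are positive constants $c_6$ and $c_7$ such that for any $\eta>0$, $\Pi\big(\max_{1\le j\le k}|\theta_j-\theta_j^0|\le\eta\,\big|\,k\big)\ge c_6\eta^{c_7k}$.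
   Formalization: The constants c4–c7 in (P2), (P3) are taken uniform in n, k and the centre (with constants depending on k the claim fails); (P1') is required only for n ≥ 2 and (P3) only for η in (0,1/k), since as printed both are unsatisfiable. *)

theory Defs
  imports "HOL-Probability.Probability"
begin

definition weight_simplex :: "nat \<Rightarrow> (nat \<Rightarrow> real) set" where
  "weight_simplex k = {w \<in> {1..k} \<rightarrow>\<^sub>E {0..1}. (\<Sum>j=1..k. w j) = 1}"

definition cube :: "real \<Rightarrow> nat \<Rightarrow> (nat \<Rightarrow> real) set" where
  "cube L k = {1..k} \<rightarrow>\<^sub>E {-L..L}"

definition simplex_space :: "nat \<Rightarrow> (nat \<Rightarrow> real) measure" where
  "simplex_space k = restrict_space (PiM {1..k} (\<lambda>_. borel)) (weight_simplex k)"

definition cube_space :: "real \<Rightarrow> nat \<Rightarrow> (nat \<Rightarrow> real) measure" where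
  "cube_space L k = restrict_space (PiM {1..k} (\<lambda>_. borel)) (cube L k)"

text \<open>The discrete distribution with mass \<open>w j\<close> at \<open>\<theta> j\<close>, as the image under \<open>\<theta>\<close> of the
  measure with weights \<open>w\<close> on the indices; see \<open>emeasure_mixing\<close>.\<close>

definition mixing :: "nat \<Rightarrow> (nat \<Rightarrow> real) \<Rightarrow> (nat \<Rightarrow> real) \<Rightarrow> real measure" where
  "mixing k w \<theta> = distr (point_measure {1..k} (\<lambda>j. ennreal (w j))) borel \<theta>"

lemma sets_mixing: "sets (mixing k w \<theta>) = sets borel"
  by (simp add: mixing_def)

lemma emeasure_mixing:
  assumes "A \<in> sets borel"
  shows "emeasure (mixing k w \<theta>) A = (\<Sum>j=1..k. ennreal (w j) * emeasure (return borel (\<theta> j)) A)"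
proof -
  have "emeasure (mixing k w \<theta>) A = (\<Sum>j\<in>\<theta> -` A \<inter> {1..k}. ennreal (w j))"
    unfolding mixing_def using assms
    by (subst emeasure_distr)
       (auto simp: space_point_measure measurable_def sets_point_measure emeasure_point_measure_finite)
  also have "\<dots> = (\<Sum>j=1..k. ennreal (w j) * indicator A (\<theta> j))"
    by (auto simp: sum.inter_restrict[symmetric] indicator_def if_distrib[of "\<lambda>x. _ * x"]
             intro!: sum.mono_neutral_cong_left)
  finally show ?thesis using assms by simp
qed

definition mixing_dists_k :: "real \<Rightarrow> nat \<Rightarrow> real measure set" where
  "mixing_dists_k L k = {mixing k w \<theta> | w \<theta>. w \<in> weight_simplex k \<and> \<theta> \<in> cube L k}"

definition mixing_dists :: "real \<Rightarrow> real measure set" where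
  "mixing_dists L = (\<Union>k\<in>{1..}. mixing_dists_k L k)"

text \<open>The \<open>\<sigma>\<close>-algebra on the set of mixing distributions is the one generated by the
  evaluations \<open>\<nu> \<mapsto> \<nu>(A)\<close> for Borel sets \<open>A\<close>.\<close>

definition mixing_space :: "real \<Rightarrow> real measure measure" where
  "mixing_space L = restrict_space (prob_algebra borel) (mixing_dists L)"

definition couplings ::
  "nat \<Rightarrow> (nat \<Rightarrow> real) \<Rightarrow> nat \<Rightarrow> (nat \<Rightarrow> real) \<Rightarrow> (nat \<Rightarrow> nat \<Rightarrow> real) set" where
  "couplings k w k' w' =
     {p. (\<forall>j\<in>{1..k}. \<forall>h\<in>{1..k'}. p j h \<in> {0..1}) \<and>
         (\<forall>j\<in>{1..k}. (\<Sum>h=1..k'. p j h) = w j) \<and>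
         (\<forall>h\<in>{1..k'}. (\<Sum>j=1..k. p j h) = w' h)}"

text \<open>Transport cost between finitely supported distributions. The infimum over the couplings
  does not depend on how the two distributions are written as mixtures of Dirac measures, so
  letting it run over all such representations as well makes it a function of \<open>\<nu>\<close> and \<open>\<nu>'\<close>
  without changing its value.\<close>

definition W1 :: "real measure \<Rightarrow> real measure \<Rightarrow> real" where
  "W1 \<nu> \<nu>' = Inf {(\<Sum>j=1..k. \<Sum>h=1..k'. p j h * \<bar>\<theta> j - \<theta>' h\<bar>) | k w \<theta> k' w' \<theta>' p.
      w \<in> weight_simplex k \<and> \<nu> = mixing k w \<theta> \<and>
      w' \<in> weight_simplex k' \<and> \<nu>' = mixing k' w' \<theta>' \<and> p \<in> couplings k w k' w'}"

definition std_normal :: "real measure" where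
  "std_normal = density lborel std_normal_density"

text \<open>The continuous version of the Lebesgue density of \<open>convolution \<nu> std_normal\<close>; see
  \<open>density_normal_mixture\<close>.\<close>

definition normal_mixture_density :: "real measure \<Rightarrow> real \<Rightarrow> real" where
  "normal_mixture_density \<nu> x = (\<integral>t. normal_density t 1 x \<partial>\<nu>)"

lemma density_normal_mixture:
  assumes "prob_space \<nu>" and [measurable_cong, simp]: "sets \<nu> = sets borel"
  shows "density lborel (\<lambda>x. ennreal (normal_mixture_density \<nu> x)) = convolution \<nu> std_normal"
proof (rule measure_eqI)
  interpret prob_space \<nu> by fact
  interpret N: prob_space std_normal
    unfolding std_normal_def by (rule prob_space_normal_density) simp
  interpret P: pair_sigma_finite \<nu> lborel by unfold_locales
  show "sets (density lborel (\<lambda>x. ennreal (normal_mixture_density \<nu> x))) = sets (convolution \<nu> std_normal)"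
    by simp
  have [measurable_cong, simp]: "sets std_normal = sets borel" by (simp add: std_normal_def)
  have nd[measurable]: "(\<lambda>(t, x). normal_density t 1 x) \<in> borel_measurable (borel \<Otimes>\<^sub>M borel)"
    unfolding normal_density_def by measurable
  have meas[measurable]: "normal_mixture_density \<nu> \<in> borel_measurable borel"
    unfolding normal_mixture_density_def by measurable
  have bd: "normal_density t 1 x \<le> 1 / sqrt (2 * pi)" for t x
    unfolding normal_density_def by (simp add: mult_left_le divide_le_cancel)
  have int: "integrable \<nu> (\<lambda>t. normal_density t 1 x)" for x
    using bd by (intro integrable_const_bound[where B = "1 / sqrt (2 * pi)"]) auto
  fix A assume "A \<in> sets (density lborel (\<lambda>x. ennreal (normal_mixture_density \<nu> x)))"
  then have A[measurable]: "A \<in> sets borel" by simp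
  have "emeasure (density lborel (\<lambda>x. ennreal (normal_mixture_density \<nu> x))) A =
      (\<integral>\<^sup>+x. (\<integral>\<^sup>+t. ennreal (normal_density t 1 x) * indicator A x \<partial>\<nu>) \<partial>lborel)"
    unfolding normal_mixture_density_def
    by (subst emeasure_density)
       (auto intro!: nn_integral_cong simp: nn_integral_eq_integral int nn_integral_multc
             meas[unfolded normal_mixture_density_def])
  also have "\<dots> = (\<integral>\<^sup>+t. (\<integral>\<^sup>+x. ennreal (normal_density t 1 x) * indicator A x \<partial>lborel) \<partial>\<nu>)"
    by (rule P.Fubini') measurable
  also have "\<dots> = (\<integral>\<^sup>+t. (\<integral>\<^sup>+y. ennreal (std_normal_density y) * indicator A (t + y) \<partial>lborel) \<partial>\<nu>)"
  proof (rule nn_integral_cong)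
    fix t
    show "(\<integral>\<^sup>+x. ennreal (normal_density t 1 x) * indicator A x \<partial>lborel) =
        (\<integral>\<^sup>+y. ennreal (std_normal_density y) * indicator A (t + y) \<partial>lborel)"
      by (subst lborel_distr_plus[symmetric, of t], subst nn_integral_distr)
         (auto simp: normal_density_def)
  qed
  also have "\<dots> = emeasure (convolution \<nu> std_normal) A"
    by (subst convolution_emeasure')
       (auto simp: std_normal_def nn_integral_density
          finite_measure_axioms N.finite_measure_axioms[unfolded std_normal_def])
  finally show "emeasure (density lborel (\<lambda>x. ennreal (normal_mixture_density \<nu> x))) A =
      emeasure (convolution \<nu> std_normal) A" .
qed

definition likelihood :: "nat \<Rightarrow> real measure \<Rightarrow> (nat \<Rightarrow> real) \<Rightarrow> real" where
  "likelihood n \<nu> x = (\<Prod>i=1..n. normal_mixture_density \<nu> (x i))"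

definition iid_sample :: "nat \<Rightarrow> real measure \<Rightarrow> (nat \<Rightarrow> real) measure" where
  "iid_sample n G = PiM {1..n} (\<lambda>_. G)"

definition posterior :: "nat \<Rightarrow> real measure measure \<Rightarrow> (nat \<Rightarrow> real) \<Rightarrow> real measure measure" where
  "posterior n Q x =
     density Q (\<lambda>\<nu>. ennreal (likelihood n \<nu> x / (\<integral>\<nu>'. likelihood n \<nu>' x \<partial>Q)))"

text \<open>A prior consists of the law \<open>K\<close> of the number of components and, for each number \<open>k\<close> of
  components, the conditional laws \<open>T k\<close> of the atoms and \<open>W k\<close> of the weights, which are
  independent of each other given \<open>k\<close>.\<close>

definition prior_spec ::
  "real \<Rightarrow> nat measure \<Rightarrow> (nat \<Rightarrow> (nat \<Rightarrow> real) measure) \<Rightarrow> (nat \<Rightarrow> (nat \<Rightarrow> real) measure) \<Rightarrow> bool"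
where
  "prior_spec L K T W \<longleftrightarrow>
     K \<in> space (prob_algebra (count_space {1..})) \<and>
     (\<forall>k\<ge>1. T k \<in> space (prob_algebra (cube_space L k))) \<and>
     (\<forall>k\<ge>1. W k \<in> space (prob_algebra (simplex_space k)))"

definition prior ::
  "real \<Rightarrow> nat measure \<Rightarrow> (nat \<Rightarrow> (nat \<Rightarrow> real) measure) \<Rightarrow> (nat \<Rightarrow> (nat \<Rightarrow> real) measure) \<Rightarrow>
   real measure measure"
where
  "prior L K T W = K \<bind> (\<lambda>k. distr (T k \<Otimes>\<^sub>M W k) (mixing_space L) (\<lambda>(\<theta>, w). mixing k w \<theta>))"

lemma prior_in_space:
  assumes "prior_spec L K T W"
  shows "prior L K T W \<in> space (prob_algebra (mixing_space L))"
proof -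
  have K: "sets K = Pow {1..}" "prob_space K"
    and T: "\<And>k. k \<ge> 1 \<Longrightarrow> sets (T k) = sets (cube_space L k)" "\<And>k. k \<ge> 1 \<Longrightarrow> prob_space (T k)"
    and W: "\<And>k. k \<ge> 1 \<Longrightarrow> sets (W k) = sets (simplex_space k)" "\<And>k. k \<ge> 1 \<Longrightarrow> prob_space (W k)"
    using assms by (auto simp: prior_spec_def space_prob_algebra)
  have *: "distr (T k \<Otimes>\<^sub>M W k) (mixing_space L) (\<lambda>(\<theta>, w). mixing k w \<theta>)
      \<in> space (prob_algebra (mixing_space L))" if k: "k \<ge> 1" for k
  proof -
    interpret T: prob_space "T k" by (rule T(2)[OF k])
    interpret W: prob_space "W k" by (rule W(2)[OF k])
    interpret TW: pair_prob_space "T k" "W k" ..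
    note [measurable_cong] = T(1)[OF k] W(1)[OF k]
    have sT: "space (T k) = cube L k"
      using sets_eq_imp_space_eq[OF T(1)[OF k]]
      by (auto simp: cube_space_def space_restrict_space space_PiM cube_def PiE_def)
    have sW: "space (W k) = weight_simplex k"
      using sets_eq_imp_space_eq[OF W(1)[OF k]]
      by (auto simp: simplex_space_def space_restrict_space space_PiM weight_simplex_def PiE_def)
    have mT[measurable]: "(\<lambda>\<theta>. \<theta> j) \<in> borel_measurable (T k)" if "j \<in> {1..k}" for j
    proof -
      have "(\<lambda>\<theta>. \<theta> j) \<in> borel_measurable (cube_space L k)"
        unfolding cube_space_def using that by (intro measurable_restrict_space1) measurable
      then show ?thesis by (simp add: measurable_cong_sets[OF T(1)[OF k] refl])
    qed
    have mW[measurable]: "(\<lambda>w. w j) \<in> borel_measurable (W k)" if "j \<in> {1..k}" for j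
    proof -
      have "(\<lambda>w. w j) \<in> borel_measurable (simplex_space k)"
        unfolding simplex_space_def using that by (intro measurable_restrict_space1) measurable
      then show ?thesis by (simp add: measurable_cong_sets[OF W(1)[OF k] refl])
    qed
    have prob: "prob_space (mixing k w \<theta>)" if "w \<in> weight_simplex k" for w \<theta>
    proof
      have "emeasure (mixing k w \<theta>) UNIV = (\<Sum>j=1..k. ennreal (w j))"
        by (simp add: emeasure_mixing)
      also have "\<dots> = ennreal (\<Sum>j=1..k. w j)"
        using that by (intro sum_ennreal) (auto simp: weight_simplex_def)
      also have "\<dots> = 1" using that by (simp add: weight_simplex_def)
      finally show "emeasure (mixing k w \<theta>) (space (mixing k w \<theta>)) = 1"
        by (simp add: mixing_def)
    qed
    have "(\<lambda>(\<theta>, w). mixing k w \<theta>) \<in> T k \<Otimes>\<^sub>M W k \<rightarrow>\<^sub>M prob_algebra borel"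
    proof (rule measurable_prob_algebraI)
      show "(\<lambda>(\<theta>, w). mixing k w \<theta>) \<in> T k \<Otimes>\<^sub>M W k \<rightarrow>\<^sub>M subprob_algebra borel"
      proof (rule measurable_subprob_algebra)
        fix A :: "real set" assume A[measurable]: "A \<in> sets borel"
        have "(\<lambda>x. \<Sum>j=1..k. ennreal (snd x j) * indicator A (fst x j)) \<in> borel_measurable (T k \<Otimes>\<^sub>M W k)"
        proof (intro borel_measurable_sum borel_measurable_times_ennreal)
          fix j assume j: "j \<in> {1..k}"
          note [measurable] = mT[OF j] mW[OF j]
          show "(\<lambda>x. ennreal (snd x j)) \<in> borel_measurable (T k \<Otimes>\<^sub>M W k)" by measurable
          show "(\<lambda>x. indicator A (fst x j) :: ennreal) \<in> borel_measurable (T k \<Otimes>\<^sub>M W k)"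
            by measurable
        qed
        then show "(\<lambda>x. emeasure (case x of (\<theta>, w) \<Rightarrow> mixing k w \<theta>) A) \<in> borel_measurable (T k \<Otimes>\<^sub>M W k)"
          by (simp add: case_prod_beta emeasure_mixing)
      qed (auto simp: space_pair_measure sW sets_mixing intro!: prob_space_imp_subprob_space prob)
    qed (auto simp: space_pair_measure sW prob)
    then have "(\<lambda>(\<theta>, w). mixing k w \<theta>) \<in> T k \<Otimes>\<^sub>M W k \<rightarrow>\<^sub>M mixing_space L"
      unfolding mixing_space_def using k
      by (intro measurable_restrict_space2)
         (auto simp: space_pair_measure sT sW mixing_dists_def mixing_dists_k_def)
    then show ?thesis
      by (auto simp: space_prob_algebra intro!: TW.prob_space_distr)
  qed
  have "K \<in> space (prob_algebra (count_space {1..}))"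
    using assms by (simp add: prior_spec_def)
  moreover have "(\<lambda>k. distr (T k \<Otimes>\<^sub>M W k) (mixing_space L) (\<lambda>(\<theta>, w). mixing k w \<theta>))
      \<in> count_space {1..} \<rightarrow>\<^sub>M prob_algebra (mixing_space L)"
    using * by (auto simp: measurable_def)
  ultimately show ?thesis
    unfolding prior_def by (subst space_prob_algebra) (simp add: prob_space_bind' sets_bind')
qed

text \<open>In the three conditions the prior is indexed by the sample size \<open>n\<close>, and the constants are
  uniform in \<open>n\<close>, \<open>k\<close> and the centre of the neighbourhood. For \<open>n = 1\<close> the bound in \<open>prior_P1\<close>
  would be the constant \<open>c\<^sub>1\<close> for every \<open>k\<close>, which no probability distribution on the
  positive integers satisfies; hence \<open>n \<ge> 2\<close>.\<close>

definition prior_P1 :: "(nat \<Rightarrow> nat measure) \<Rightarrow> bool" where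
  "prior_P1 K \<longleftrightarrow> (\<exists>c\<^sub>1>0. \<exists>c\<^sub>2>0. \<exists>b\<^sub>0>0. \<forall>n\<ge>2. \<forall>k\<ge>1.
     measure (K n) {k} \<ge> c\<^sub>1 * exp (- (c\<^sub>2 * ln (real n) powr b\<^sub>0) * real k))"

definition prior_P2 :: "(nat \<Rightarrow> nat \<Rightarrow> (nat \<Rightarrow> real) measure) \<Rightarrow> bool" where
  "prior_P2 W \<longleftrightarrow> (\<exists>c\<^sub>4>0. \<exists>c\<^sub>5>0. \<forall>n\<ge>1. \<forall>k\<ge>1. \<forall>w0\<in>weight_simplex k. \<forall>\<eta>\<in>{0<..<1 / real k}.
     measure (W n k) {w \<in> weight_simplex k. (\<Sum>j=1..k. \<bar>w j - w0 j\<bar>) \<le> \<eta>} \<ge> c\<^sub>4 * \<eta> powr (c\<^sub>5 * real k))"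

text \<open>A lower bound of the form \<open>c\<^sub>6 * \<eta> powr (c\<^sub>7 * k)\<close> on a probability cannot hold for
  arbitrarily large \<open>\<eta>\<close>; the radii are restricted to the same range as in \<open>prior_P2\<close>.\<close>

definition prior_P3 :: "real \<Rightarrow> (nat \<Rightarrow> nat \<Rightarrow> (nat \<Rightarrow> real) measure) \<Rightarrow> bool" where
  "prior_P3 L T \<longleftrightarrow> (\<exists>c\<^sub>6>0. \<exists>c\<^sub>7>0. \<forall>n\<ge>1. \<forall>k\<ge>1. \<forall>\<theta>0\<in>cube L k. \<forall>\<eta>\<in>{0<..<1 / real k}.
     measure (T n k) {\<theta> \<in> cube L k. (MAX j\<in>{1..k}. \<bar>\<theta> j - \<theta>0 j\<bar>) \<le> \<eta>} \<ge> c\<^sub>6 * \<eta> powr (c\<^sub>7 * real k))"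

end

theory Submission
  imports Defs "HOL-Real_Asymp.Real_Asymp"
begin

text \<open>
  Let \<open>l = ln n\<close>. A Lipschitz function on \<open>[-L, L]\<close> is approximated up to \<open>O(1/k)\<close> by a polynomial
  of degree less than \<open>k\<close> in \<open>k * sin (x / k)\<close>, that is, by a combination of \<open>cos (m x / k)\<close> and
  \<open>sin (m x / k)\<close> with \<open>|m| \<le> k\<close> and coefficients of order \<open>k\<^sup>k\<close>. Convolution with the standard
  normal distribution multiplies the characteristic function at \<open>m / k\<close> by at least
  \<open>e\<^sup>-\<^sup>1\<^sup>/\<^sup>2\<close>, so \<open>W\<^sub>1(\<nu>, \<nu>') \<le> C / k + (C k)\<^sup>k \<delta>\<close> as soon as the characteristic
  functions of the two normal mixtures are \<open>\<delta>\<close>-close at the points \<open>m / k\<close>. With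
  \<open>k = l / (8 ln l)\<close> and \<open>\<delta> = n\<^sup>-\<^sup>1\<^sup>/\<^sup>4\<close> the right-hand side is of order \<open>ln l / l\<close>, and by
  Hoeffding's inequality the empirical characteristic function yields tests with error of order
  \<open>exp (- \<surd>n / 2)\<close>.

  This leaves so much room that a crude bound on the evidence suffices. Any mixture is approximated
  by one with \<open>l\<^sup>2 + O(1)\<close> atoms such that on \<open>|x| \<le> l\<close> the densities have ratio
  \<open>1 + O(1 / n)\<close>, even after perturbing weights and atoms by \<open>exp (- l\<^sup>2)\<close>. These perturbations
  have prior mass at least \<open>exp (- polylog n)\<close>, and with high probability all observations
  satisfy \<open>|X\<^sub>i| \<le> l\<close>.
\<close>

section \<open>Discrete Jackson approximation\<close>

text \<open>The frequencies \<open>m / k\<close> stay in [-1, 1], so deconvolution costs only a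
  constant and the whole ill-posedness sits in the coefficients of order k^k. This fixes the rate:
  the bias is of order 1 / k, and k^k times a negative power of n is negligible only while k ln k is
  at most a small multiple of ln n. Sines and cosines of the data, unlike raw moments, are bounded,
  so Hoeffding's inequality applies directly. The obstacle is uniformity: the numbers of atoms of
  \<nu> and of the truth are unbounded and atoms may merge. The dual bound for \<open>W1\<close> and
  the moment comparison see the distributions only through integrals, hence not the number of atoms.
  Only 2 (2 k + 1) moments separate all alternatives, so neither a sieve nor a covering occurs. For
  the evidence, closeness of densities must survive a product of n ratios. On
  \<open>|x| \<le> l\<close> the mixture density divided by the standard normal one is at least exp
  (- l L - L^2 / 2), so a smaller additive error becomes a relative error of order 1 / n. Cutting
  the power series at l^2 leaves an error of order exp (- l^2), up to factors exp (O(l)), and this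
  beats every exp (- C l).\<close>

lemma sum_cis_roots:
  fixes l :: int and P :: nat
  assumes "\<not> int P dvd l" "P > 0"
  shows "(\<Sum>p<P. cis (of_int l * (t + 2 * pi * real p / real P))) = 0"
proof -
  define z where "z = cis (of_int l * (2 * pi / real P))"
  have zP: "z ^ P = 1"
  proof -
    have "real P * (of_int l * (2 * pi / real P)) = 2 * pi * of_int l"
      using assms by simp
    then have "z ^ P = cis (2 * pi * of_int l)"
      unfolding z_def Complex.DeMoivre by (rule arg_cong)
    then show ?thesis by (simp add: cis_multiple_2pi)
  qed
  have z1: "z \<noteq> 1"
  proof
    assume "z = 1"
    then have "cos (of_int l * (2 * pi / real P)) = 1"
      by (simp add: z_def complex_eq_iff)
    then obtain n :: int where "of_int l * (2 * pi / real P) = of_int n * 2 * pi"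
      by (auto simp: cos_one_2pi_int)
    then have "real_of_int l = of_int (n * int P)"
      using assms by (simp add: field_simps)
    then have "l = n * int P" by (simp only: of_int_eq_iff)
    with assms show False by simp
  qed
  have "(\<Sum>p<P. cis (of_int l * (t + 2 * pi * real p / real P))) = cis (of_int l * t) * (\<Sum>p<P. z ^ p)"
    unfolding z_def Complex.DeMoivre sum_distrib_left cis_mult
    by (intro sum.cong refl arg_cong[where f=cis]) (simp add: field_simps)
  also have "(\<Sum>p<P. z ^ p) = 0"
    using z1 zP by (simp add: geometric_sum)
  finally show ?thesis by simp
qed

lemma cmod_power2_trig_poly:
  fixes c :: "nat \<Rightarrow> real"
  shows "(cmod (\<Sum>j<n. c j * cis (real j * v)))\<^sup>2
    = (\<Sum>i<n. \<Sum>j<n. c i * c j * cos ((real i - real j) * v))"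
proof -
  have "complex_of_real ((cmod (\<Sum>j<n. c j * cis (real j * v)))\<^sup>2)
     = (\<Sum>i<n. \<Sum>j<n. (c i * c j) * cis ((real i - real j) * v))"
    unfolding complex_norm_square sum_product cnj_sum
    by (intro sum.cong refl) (simp add: cis_cnj cis_mult right_diff_distrib mult_ac)
  then have "Re (complex_of_real ((cmod (\<Sum>j<n. c j * cis (real j * v)))\<^sup>2))
     = Re (\<Sum>i<n. \<Sum>j<n. (c i * c j) * cis ((real i - real j) * v))"
    by (rule arg_cong)
  then show ?thesis by simp
qed

text \<open>For \<open>n \<le> P\<close> two distinct indices differ by less than \<open>P\<close>,
  so the off-diagonal terms vanish by \<open>sum_cis_roots\<close>. The value does not depend on the
  shift \<open>t\<close>, which later lets the grid be translated to any evaluation point.\<close>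

lemma discrete_parseval:
  fixes c :: "nat \<Rightarrow> real"
  assumes "n \<le> P" "P > 0"
  shows "(\<Sum>p<P. (cmod (\<Sum>j<n. c j * cis (real j * (t + 2 * pi * real p / real P))))\<^sup>2)
    = real P * (\<Sum>j<n. (c j)\<^sup>2)"
proof -
  let ?v = "\<lambda>p. t + 2 * pi * real p / real P"
  have *: "(\<Sum>p<P. cos ((real i - real j) * ?v p)) = (if i = j then real P else 0)"
    if "i < n" "j < n" for i j
  proof (cases "i = j")
    case False
    then have "\<bar>int i - int j\<bar> < int P" "int i - int j \<noteq> 0"
      using that assms by auto
    then have "\<not> int P dvd (int i - int j)"
      by (metis abs_of_nat dvd_imp_le_int not_less)
    from sum_cis_roots[OF this assms(2), of t]
    have "Re (\<Sum>p<P. cis ((real i - real j) * ?v p)) = 0" by simp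
    with False show ?thesis by simp
  qed simp
  have "(\<Sum>p<P. (cmod (\<Sum>j<n. c j * cis (real j * ?v p)))\<^sup>2)
    = (\<Sum>i<n. \<Sum>p<P. \<Sum>j<n. c i * c j * cos ((real i - real j) * ?v p))"
    unfolding cmod_power2_trig_poly by (rule sum.swap)
  also have "\<dots> = (\<Sum>i<n. \<Sum>j<n. \<Sum>p<P. c i * c j * cos ((real i - real j) * ?v p))"
    by (intro sum.cong refl sum.swap)
  also have "\<dots> = (\<Sum>i<n. \<Sum>j<n. c i * c j * (\<Sum>p<P. cos ((real i - real j) * ?v p)))"
    by (simp only: sum_distrib_left)
  also have "\<dots> = (\<Sum>i<n. \<Sum>j<n. c i * c j * (if i = j then real P else 0))"
    by (intro sum.cong refl) (simp add: *)
  also have "\<dots> = (\<Sum>i<n. c i * c i * real P)"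
    by (intro sum.cong refl) (simp add: if_distrib[of "\<lambda>x. _ * x"] sum.delta cong: if_cong)
  finally show ?thesis by (simp add: sum_distrib_left power2_eq_square mult_ac)
qed

lemma abs_sin_diff_le: "\<bar>sin x - sin y\<bar> \<le> \<bar>x - y\<bar>" for x y :: real
proof -
  have "\<bar>sin x - sin y\<bar> = 2 * (\<bar>sin ((x - y) / 2)\<bar> * \<bar>cos ((x + y) / 2)\<bar>)"
    by (simp add: sin_diff_sin abs_mult)
  also have "\<dots> \<le> 2 * (\<bar>(x - y) / 2\<bar> * 1)"
    by (intro mult_left_mono mult_mono abs_sin_x_le_abs_x) auto
  finally show ?thesis by simp
qed

lemma cmod_one_minus_cis: "(cmod (1 - cis v))\<^sup>2 = (2 * sin (v / 2))\<^sup>2"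
proof -
  have "(cmod (1 - cis v))\<^sup>2 = 2 - 2 * cos v"
    using sin_cos_squared_add[of v]
    unfolding cmod_power2 by (simp add: power2_eq_square algebra_simps)
  also have "\<dots> = (2 * sin (v / 2))\<^sup>2"
    using cos_double_sin[of "v / 2"] by (simp add: power_mult_distrib)
  finally show ?thesis .
qed

lemma sum_sin_square_half:
  assumes "N \<ge> (2::nat)"
  shows "(\<Sum>j<N. (sin (pi * real j / real N))\<^sup>2) = real N / 2"
proof (cases "N = 2")
  case True
  then show ?thesis by (simp add: numeral_2_eq_2)
next
  case False
  have "\<not> int N dvd 1" using assms by auto
  from sum_cis_roots[OF this, of 0]
  have "Re (\<Sum>p<N. cis (2 * pi * real p / real N)) = 0" using assms by simp
  then have *: "(\<Sum>p<N. cos (2 * pi * real p / real N)) = 0" by simp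
  have "(sin (pi * real j / real N))\<^sup>2 = 1/2 - cos (2 * pi * real j / real N) / 2" for j
    using cos_double_sin[of "pi * real j / real N"] by (simp add: mult.assoc field_simps)
  then have "(\<Sum>j<N. (sin (pi * real j / real N))\<^sup>2) = (\<Sum>j<N. 1/2 - cos (2 * pi * real j / real N) / 2)"
    by simp
  also have "\<dots> = real N / 2"
    by (simp add: sum_subtractf * flip: sum_divide_distrib)
  finally show ?thesis .
qed

text \<open>The Fejer-Korovkin kernel, not normalised. The sine weights vanish at
  \<open>j = 0\<close> and \<open>j = N\<close>, which makes the second moment small.\<close>

definition jackson_kernel :: "nat \<Rightarrow> real \<Rightarrow> real" where
  "jackson_kernel N v = (cmod (\<Sum>j<N. sin (pi * real j / real N) * cis (real j * v)))\<^sup>2"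

lemma jackson_kernel_mass:
  assumes "N \<ge> 2" "N \<le> P"
  shows "(\<Sum>p<P. jackson_kernel N (t + 2 * pi * real p / real P)) = real P * real N / 2"
  unfolding jackson_kernel_def
  using assms by (subst discrete_parseval) (auto simp: sum_sin_square_half)

text \<open>Multiplying by \<open>1 - e\<^sup>i\<^sup>v\<close> replaces the coefficients by their differences, which are of
  order \<open>1 / N\<close>.\<close>

lemma jackson_kernel_second_moment:
  assumes "N \<ge> 2" "N < P"
  shows "(\<Sum>p<P. jackson_kernel N (t + 2 * pi * real p / real P) *
      (2 * sin ((t + 2 * pi * real p / real P) / 2))\<^sup>2) \<le> real P * pi\<^sup>2 / real N"
proof -
  let ?a = "\<lambda>j. sin (pi * real j / real N)"
  define c where "c j = (if j = 0 then 0 else ?a j - ?a (j - 1))" for j :: nat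
  \<comment> \<open>The weights vanish at both ends, so the differences \<open>c j\<close> contain
    no boundary jump. They run up to index \<open>N\<close>, that is, over \<open>N + 1\<close>
    coefficients, and therefore Parseval needs \<open>N < P\<close>.\<close>
  have aN: "?a N = 0" using assms by simp
  have eq: "jackson_kernel N v * (2 * sin (v / 2))\<^sup>2 = (cmod (\<Sum>j<Suc N. c j * cis (real j * v)))\<^sup>2" for v
  proof -
    have "(1 - cis v) * (\<Sum>j<N. ?a j * cis (real j * v))
       = (\<Sum>j<N. ?a j * cis (real j * v)) - (\<Sum>j<N. ?a j * cis (real (Suc j) * v))"
      by (simp add: left_diff_distrib sum_distrib_left distrib_right cis_mult mult.left_commute[of "cis v"]
          sum_subtractf)
    also have "\<dots> = (\<Sum>j<Suc N. ?a j * cis (real j * v)) - (\<Sum>j<N. ?a j * cis (real (Suc j) * v))"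
      using aN by simp
    also have "\<dots> = (\<Sum>j<N. ?a (Suc j) * cis (real (Suc j) * v)) - (\<Sum>j<N. ?a j * cis (real (Suc j) * v))"
      by (subst sum.lessThan_Suc_shift) simp
    also have "\<dots> = (\<Sum>j<N. c (Suc j) * cis (real (Suc j) * v))"
      by (simp add: c_def sum_subtractf algebra_simps)
    also have "\<dots> = (\<Sum>j<Suc N. c j * cis (real j * v))"
      by (subst sum.lessThan_Suc_shift) (simp add: c_def)
    finally show ?thesis
      unfolding jackson_kernel_def cmod_one_minus_cis[symmetric] power_mult_distrib[symmetric]
          norm_mult[symmetric] by (simp only: mult.commute[of _ "1 - cis v"])
  qed
  have "(c j)\<^sup>2 \<le> (pi / real N)\<^sup>2" for j
  proof -
    have "\<bar>c j\<bar> \<le> pi / real N"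
    proof (cases j)
      case (Suc i)
      have "\<bar>c j\<bar> \<le> \<bar>pi * real (Suc i) / real N - pi * real i / real N\<bar>"
        unfolding c_def Suc using abs_sin_diff_le by (auto intro!: abs_sin_diff_le)
      also have "\<dots> = pi / real N" by (simp add: field_simps flip: diff_divide_distrib)
      finally show ?thesis .
    qed (simp add: c_def)
    then show ?thesis by (metis abs_ge_zero power2_abs power_mono)
  qed
  then have "(\<Sum>j<Suc N. (c j)\<^sup>2) \<le> (\<Sum>j<N. (pi / real N)\<^sup>2)"
    by (subst sum.lessThan_Suc_shift, subst c_def) (simp add: sum_mono del: sum_constant)
  also have "\<dots> = pi\<^sup>2 / real N" using assms by (simp add: power2_eq_square)
  finally have "real P * (\<Sum>j<Suc N. (c j)\<^sup>2) \<le> real P * (pi\<^sup>2 / real N)"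
    by (intro mult_left_mono) auto
  then show ?thesis unfolding eq
    using assms by (subst discrete_parseval) auto
qed

lemma pi_square_le: "pi\<^sup>2 \<le> 10"
proof -
  have "pi \<le> 3.15" using pi_approx by simp
  then have "pi\<^sup>2 \<le> 3.15\<^sup>2" by (intro power_mono) auto
  then show ?thesis by (simp add: power2_eq_square)
qed

text \<open>The approximant is a discrete convolution of \<open>q (cos t)\<close> with the kernel;
  its error is governed by the second moment of the kernel. Sampling at finitely many nodes replaces
  the integral and makes the coefficients finite averages of values of \<open>q\<close>, whence
  their bound by \<open>B\<close>.\<close>

lemma jackson:
  fixes q :: "real \<Rightarrow> real"
  assumes N: "N \<ge> 2"
    and B: "\<And>x. x \<in> {-1..1} \<Longrightarrow> \<bar>q x\<bar> \<le> B"
    and Lip: "\<And>x y. x \<in> {-1..1} \<Longrightarrow> y \<in> {-1..1} \<Longrightarrow> \<bar>q x - q y\<bar> \<le> \<Lambda> * \<bar>x - y\<bar>"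
  shows "\<exists>b :: nat \<Rightarrow> nat \<Rightarrow> real. (\<forall>i j. \<bar>b i j\<bar> \<le> 2 * B / N) \<and>
    (\<forall>t. \<bar>q (cos t) - (\<Sum>i<N. \<Sum>j<N. b i j * cos ((real i - real j) * t))\<bar> \<le> 11 * \<Lambda> / N)"
proof -
  \<comment> \<open>The fewest nodes for which \<open>jackson_kernel_second_moment\<close>
    applies.\<close>
  define P where "P = N + 1"
  define Z where "Z = real P * real N / 2"
  have P: "P > N" "P > 0" and Z: "Z > 0" using N by (auto simp: P_def Z_def)
  define u where "u p = - (2 * pi * real p / real P)" for p
  let ?K = "jackson_kernel N"
  let ?a = "\<lambda>j. sin (pi * real j / real N)"
  define H where "H t = (\<Sum>p<P. q (cos (u p)) * (?K (t - u p) / Z))" for t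
  have \<Lambda>: "\<Lambda> \<ge> 0"
    using Lip[of 0 1] by (simp add: abs_le_iff)
  have B0: "B \<ge> 0" using B[of 0] by simp
  have Kpos: "?K v \<ge> 0" for v by (simp add: jackson_kernel_def)
  have mass: "(\<Sum>p<P. ?K (t - u p) / Z) = 1" for t
  proof -
    have "(\<Sum>p<P. ?K (t - u p)) = Z"
      using jackson_kernel_mass[of N P t] N P by (simp add: Z_def u_def)
    then show ?thesis using Z by (simp flip: sum_divide_distrib)
  qed
  have err: "\<bar>q (cos t) - H t\<bar> \<le> 11 * \<Lambda> / N" for t
  proof -
    have bd: "\<bar>q (cos t) - q (cos (u p))\<bar>
        \<le> \<Lambda> * ((real N * (2 * sin ((t - u p) / 2))\<^sup>2 + 1 / real N) / 2)" for p
    proof -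
      let ?s = "2 * sin ((t - u p) / 2)"
      have "\<bar>cos t - cos (u p)\<bar> = \<bar>?s\<bar> * \<bar>sin ((t + u p) / 2)\<bar>"
        using sin_minus[of "(t - u p) / 2"]
        by (simp add: cos_diff_cos abs_mult minus_divide_left del: sin_minus)
      also have "\<dots> \<le> \<bar>?s\<bar> * 1" by (intro mult_left_mono) auto
      finally have 1: "\<bar>cos t - cos (u p)\<bar> \<le> \<bar>?s\<bar>" by simp
      \<comment> \<open>The inequality of arithmetic and geometric means trades the first moment for
        the second; the weight \<open>N\<close> balances a normalised second moment of order 1 / N^2
        against the constant 1.\<close>
      have "0 \<le> (real N * \<bar>?s\<bar> - 1)\<^sup>2 / real N" by simp
      also have "\<dots> = real N * ?s\<^sup>2 + 1 / real N - 2 * \<bar>?s\<bar>"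
        using N by (simp add: power2_eq_square field_simps flip: abs_mult)
      finally have 2: "\<bar>?s\<bar> \<le> (real N * ?s\<^sup>2 + 1 / real N) / 2" by simp
      have "\<bar>q (cos t) - q (cos (u p))\<bar> \<le> \<Lambda> * \<bar>cos t - cos (u p)\<bar>" by (intro Lip) auto
      also have "\<dots> \<le> \<Lambda> * ((real N * ?s\<^sup>2 + 1 / real N) / 2)"
        using 1 2 \<Lambda> by (intro mult_left_mono) auto
      finally show ?thesis .
    qed
    have "q (cos t) - H t = (\<Sum>p<P. (q (cos t) - q (cos (u p))) * (?K (t - u p) / Z))"
      unfolding H_def left_diff_distrib sum_subtractf
      by (simp only: sum_distrib_left[symmetric] mass mult_1_right)
    also have "\<bar>\<dots>\<bar> \<le> (\<Sum>p<P. \<Lambda> * ((real N * (2 * sin ((t - u p) / 2))\<^sup>2 + 1 / real N) / 2) * (?K (t - u p) / Z))"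
      using Z by (intro order_trans[OF sum_abs] sum_mono)
        (simp only: abs_mult, intro mult_mono bd, auto simp: Kpos \<Lambda>)
    also have "\<dots> = \<Lambda> / 2 * (real N / Z * (\<Sum>p<P. ?K (t - u p) * (2 * sin ((t - u p) / 2))\<^sup>2)
        + (\<Sum>p<P. ?K (t - u p) / Z) / real N)"
      unfolding sum_distrib_left sum_divide_distrib sum.distrib[symmetric]
      using N Z by (intro sum.cong refl) (simp add: field_simps)
    also have "\<dots> \<le> \<Lambda> / 2 * (real N / Z * (real P * pi\<^sup>2 / real N) + 1 / real N)"
      unfolding mass using jackson_kernel_second_moment[of N P t] N P \<Lambda> Z
      by (intro mult_left_mono add_mono) (auto simp: u_def)
    also have "\<dots> = \<Lambda> * (2 * pi\<^sup>2 + 1) / 2 / real N"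
      using N P by (simp add: Z_def field_simps)
    also have "\<dots> \<le> 11 * \<Lambda> / N"
      using \<Lambda> pi_square_le mult_left_mono[of "2 * pi\<^sup>2 + 1" 22 \<Lambda>] N by (intro divide_right_mono) auto
    finally show ?thesis .
  qed
  define b where "b i j = ?a i * ?a j * (\<Sum>p<P. q (cos (u p)) * cos ((real i - real j) * u p)) / Z" for i j
  \<comment> \<open>\<open>H\<close> need not be even, but \<open>q (cos t)\<close> is. Averaging
    \<open>H t\<close> and \<open>H (- t)\<close> removes the sines and keeps the error
    bound.\<close>
  have bH: "(\<Sum>i<N. \<Sum>j<N. b i j * cos ((real i - real j) * t)) = (H t + H (- t)) / 2" for t
  proof -
    have HH: "H t = (\<Sum>i<N. \<Sum>j<N. ?a i * ?a j / Z * (\<Sum>p<P. q (cos (u p)) * cos ((real i - real j) * (t - u p))))" for t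
    proof -
      have "H t = (\<Sum>p<P. \<Sum>i<N. \<Sum>j<N. ?a i * ?a j / Z * (q (cos (u p)) * cos ((real i - real j) * (t - u p))))"
        unfolding H_def jackson_kernel_def cmod_power2_trig_poly sum_divide_distrib sum_distrib_left
        by (intro sum.cong refl) (simp add: field_simps)
      also have "\<dots> = (\<Sum>i<N. \<Sum>p<P. \<Sum>j<N. ?a i * ?a j / Z * (q (cos (u p)) * cos ((real i - real j) * (t - u p))))"
        by (rule sum.swap)
      also have "\<dots> = (\<Sum>i<N. \<Sum>j<N. \<Sum>p<P. ?a i * ?a j / Z * (q (cos (u p)) * cos ((real i - real j) * (t - u p))))"
        by (intro sum.cong refl sum.swap)
      finally show ?thesis by (simp only: sum_distrib_left)
    qed
    have *: "cos (d * (t - v)) + cos (d * (- t - v)) = 2 * (cos (d * v) * cos (d * t))" for d v :: real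
      by (simp add: right_diff_distrib cos_diff)
    show ?thesis
      unfolding HH sum.distrib[symmetric] sum_divide_distrib distrib_left[symmetric] *
      by (simp only: b_def sum_distrib_left sum_distrib_right sum_divide_distrib, intro sum.cong refl)
        (simp add: field_simps)
  qed
  have "\<bar>b i j\<bar> \<le> 2 * B / N" for i j
  proof -
    have "\<bar>\<Sum>p<P. q (cos (u p)) * cos ((real i - real j) * u p)\<bar> \<le> (\<Sum>p<P. B * 1)"
      by (intro order_trans[OF sum_abs] sum_mono, unfold abs_mult, intro mult_mono B) (auto simp: B0)
    then have 1: "\<bar>\<Sum>p<P. q (cos (u p)) * cos ((real i - real j) * u p)\<bar> \<le> real P * B" by simp
    have 2: "\<bar>?a i * ?a j\<bar> \<le> 1" by (simp add: abs_mult mult_le_one)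
    have "\<bar>b i j\<bar> = \<bar>?a i * ?a j\<bar> * \<bar>\<Sum>p<P. q (cos (u p)) * cos ((real i - real j) * u p)\<bar> / Z"
      using Z by (simp add: b_def abs_mult)
    also have "\<dots> \<le> 1 * (real P * B) / Z"
      using Z 1 2 B0 by (intro divide_right_mono mult_mono) auto
    also have "\<dots> = 2 * B / N" using P N by (simp add: Z_def field_simps)
    finally show ?thesis .
  qed
  moreover have "\<bar>q (cos t) - (\<Sum>i<N. \<Sum>j<N. b i j * cos ((real i - real j) * t))\<bar> \<le> 11 * \<Lambda> / N" for t
  proof -
    have mid: "\<bar>a - (b + c) / 2\<bar> \<le> e" if "\<bar>a - b\<bar> \<le> e" "\<bar>a - c\<bar> \<le> e" for a b c e :: real
      using that by (simp add: abs_le_iff field_simps)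
    show ?thesis unfolding bH using err[of t] err[of "-t"] by (intro mid) simp_all
  qed
  ultimately show ?thesis by blast
qed

text \<open>Multiplying by \<open>sin (h x) / (h L)\<close> shifts the frequency by \<open>\<plusminus> h\<close>; with the three-term recursion
  of \<open>cos (l t)\<close> this propagates bounds from frequencies to Chebyshev polynomials.\<close>

lemma chebyshev_moment_bound:
  fixes v x :: "'i \<Rightarrow> real" and k :: nat
  assumes hL: "h > 0" "L > 0" "\<And>i. i \<in> I \<Longrightarrow> \<bar>sin (h * x i)\<bar> \<le> h * L"
    and cosb: "\<And>m::int. \<bar>m\<bar> \<le> int k \<Longrightarrow> \<bar>\<Sum>i\<in>I. v i * cos (m * (h * x i))\<bar> \<le> \<epsilon>"
    and sinb: "\<And>m::int. \<bar>m\<bar> \<le> int k \<Longrightarrow> \<bar>\<Sum>i\<in>I. v i * sin (m * (h * x i))\<bar> \<le> \<epsilon>"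
    and lm: "\<bar>m\<bar> + int l \<le> int k"
  defines "t \<equiv> \<lambda>i. arccos (sin (h * x i) / (h * L))"
  shows "\<bar>\<Sum>i\<in>I. v i * (cos (real l * t i) * cos (m * (h * x i)))\<bar> \<le> (2 / (h * L) + 1) ^ l * \<epsilon> \<and>
    \<bar>\<Sum>i\<in>I. v i * (cos (real l * t i) * sin (m * (h * x i)))\<bar> \<le> (2 / (h * L) + 1) ^ l * \<epsilon>"
  using lm
\<comment> \<open>Multiplication by a sine exchanges cosines and sines, so both bounds are carried
  together. Each step lowers \<open>l\<close> and moves \<open>m\<close> by at most one, so
  \<open>|m| + l\<close> stays within the budget \<open>k\<close>.\<close>
proof (induction l arbitrary: m rule: less_induct)
  case (less l)
  let ?A = "2 / (h * L) + 1"
  have hL0: "h * L > 0" using hL by simp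
  have A1: "?A \<ge> 1" using hL by simp
  have \<epsilon>: "\<epsilon> \<ge> 0" using order_trans[OF abs_ge_zero cosb[of 0]] by simp
  have cost: "cos (t i) = sin (h * x i) / (h * L)" if "i \<in> I" for i
    unfolding t_def using hL(3)[OF that] hL0 by (intro cos_arccos_abs) (simp add: divide_le_eq)
  have sc: "sin a * cos (real_of_int m * a) = (sin (real_of_int (m + 1) * a) - sin (real_of_int (m - 1) * a)) / 2" for a
    by (simp add: distrib_right left_diff_distrib sin_add sin_diff)
  have ss: "sin a * sin (real_of_int m * a) = (cos (real_of_int (m - 1) * a) - cos (real_of_int (m + 1) * a)) / 2" for a
    by (simp add: distrib_right left_diff_distrib cos_add cos_diff)
  have half: "1 / (2 * (h * L)) * (\<epsilon> + \<epsilon>) \<le> ?A * \<epsilon>"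
  proof -
    have "1 / (h * L) \<le> 2 / (h * L)" using hL0 by (intro divide_right_mono) auto
    then have "1 / (h * L) \<le> ?A" by (rule order_trans) simp
    then have "1 / (h * L) * \<epsilon> \<le> ?A * \<epsilon>" using \<epsilon> by (rule mult_right_mono)
    then show ?thesis by simp
  qed
  consider "l = 0" | "l = 1" | l' where "l = Suc (Suc l')" by (metis One_nat_def not0_implies_Suc)
  then show ?case
  proof cases
    case 1
    then show ?thesis using cosb[of m] sinb[of m] less.prems by simp
  next
    case 2
    have "(\<Sum>i\<in>I. v i * (cos (real l * t i) * cos (m * (h * x i)))) =
      1 / (2 * (h * L)) * ((\<Sum>i\<in>I. v i * sin ((m + 1) * (h * x i))) - (\<Sum>i\<in>I. v i * sin ((m - 1) * (h * x i))))"
      unfolding sum_subtractf[symmetric] sum_distrib_left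
    proof (intro sum.cong refl)
      fix i assume i: "i \<in> I"
      have "sin (h * x i) / (h * L) * cos (m * (h * x i)) = 1 / (2 * (h * L)) * (sin ((m + 1) * (h * x i)) - sin ((m - 1) * (h * x i)))"
        unfolding times_divide_eq_left sc by simp
      then show "v i * (cos (real l * t i) * cos (m * (h * x i))) =
         1 / (2 * (h * L)) * (v i * sin ((m + 1) * (h * x i)) - v i * sin ((m - 1) * (h * x i)))"
        unfolding 2 of_nat_1 mult_1 cost[OF i] by algebra
    qed
    also have "\<bar>\<dots>\<bar> \<le> 1 / (2 * (h * L)) * (\<epsilon> + \<epsilon>)"
    proof -
      have "\<bar>\<Sum>i\<in>I. v i * sin (real_of_int (m + 1) * (h * x i))\<bar> \<le> \<epsilon>"
           "\<bar>\<Sum>i\<in>I. v i * sin (real_of_int (m - 1) * (h * x i))\<bar> \<le> \<epsilon>"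
        by (rule sinb, use less.prems 2 in linarith)+
      then show ?thesis unfolding abs_mult using hL0
        by (intro mult_mono order_trans[OF abs_triangle_ineq4] add_mono) auto
    qed
    also have "\<dots> \<le> ?A * \<epsilon>" by (rule half)
    finally have c: "\<bar>\<Sum>i\<in>I. v i * (cos (real l * t i) * cos (m * (h * x i)))\<bar> \<le> ?A ^ l * \<epsilon>" by (simp add: 2)
    have "(\<Sum>i\<in>I. v i * (cos (real l * t i) * sin (m * (h * x i)))) =
      1 / (2 * (h * L)) * ((\<Sum>i\<in>I. v i * cos ((m - 1) * (h * x i))) - (\<Sum>i\<in>I. v i * cos ((m + 1) * (h * x i))))"
      unfolding sum_subtractf[symmetric] sum_distrib_left
    proof (intro sum.cong refl)
      fix i assume i: "i \<in> I"
      have "sin (h * x i) / (h * L) * sin (m * (h * x i)) = 1 / (2 * (h * L)) * (cos ((m - 1) * (h * x i)) - cos ((m + 1) * (h * x i)))"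
        unfolding times_divide_eq_left ss by simp
      then show "v i * (cos (real l * t i) * sin (m * (h * x i))) =
         1 / (2 * (h * L)) * (v i * cos ((m - 1) * (h * x i)) - v i * cos ((m + 1) * (h * x i)))"
        unfolding 2 of_nat_1 mult_1 cost[OF i] by algebra
    qed
    also have "\<bar>\<dots>\<bar> \<le> 1 / (2 * (h * L)) * (\<epsilon> + \<epsilon>)"
    proof -
      have "\<bar>\<Sum>i\<in>I. v i * cos (real_of_int (m - 1) * (h * x i))\<bar> \<le> \<epsilon>"
           "\<bar>\<Sum>i\<in>I. v i * cos (real_of_int (m + 1) * (h * x i))\<bar> \<le> \<epsilon>"
        by (rule cosb, use less.prems 2 in linarith)+
      then show ?thesis unfolding abs_mult using hL0
        by (intro mult_mono order_trans[OF abs_triangle_ineq4] add_mono) auto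
    qed
    also have "\<dots> \<le> ?A * \<epsilon>" by (rule half)
    finally show ?thesis using c by (simp add: 2)
  next
    case 3
    have rec: "cos (real l * t i) = 2 * (sin (h * x i) / (h * L)) * cos (real (Suc l') * t i) - cos (real l' * t i)"
      if "i \<in> I" for i
    proof -
      have "cos (real l * t i) + cos (real l' * t i) = 2 * cos (t i) * cos (real (Suc l') * t i)"
      proof -
        have e: "real l * t i = real (Suc l') * t i + t i" "real l' * t i = real (Suc l') * t i - t i"
          by (simp_all add: 3 algebra_simps)
        show ?thesis unfolding e cos_add cos_diff by simp
      qed
      then show ?thesis using cost[OF that] by simp
    qed
    have IH1: "\<bar>\<Sum>i\<in>I. v i * (cos (real (Suc l') * t i) * cos (m' * (h * x i)))\<bar> \<le> ?A ^ Suc l' * \<epsilon>"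
        "\<bar>\<Sum>i\<in>I. v i * (cos (real (Suc l') * t i) * sin (m' * (h * x i)))\<bar> \<le> ?A ^ Suc l' * \<epsilon>"
      if "m' = m + 1 \<or> m' = m - 1" for m' :: int
      using less.IH[of "Suc l'" m'] less.prems that 3 by auto
    have IH2: "\<bar>\<Sum>i\<in>I. v i * (cos (real l' * t i) * cos (m * (h * x i)))\<bar> \<le> ?A ^ l' * \<epsilon>"
        "\<bar>\<Sum>i\<in>I. v i * (cos (real l' * t i) * sin (m * (h * x i)))\<bar> \<le> ?A ^ l' * \<epsilon>"
      using less.IH[of l' m] less.prems 3 by auto
    have comb: "\<bar>1 / (h * L) * (a - b) - c\<bar> \<le> 1 / (h * L) * (E + E) + F"
      if "\<bar>a\<bar> \<le> E" "\<bar>b\<bar> \<le> E" "\<bar>c\<bar> \<le> F" for a b c E F :: real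
    proof -
      have "\<bar>1 / (h * L) * (a - b)\<bar> \<le> 1 / (h * L) * (E + E)"
        unfolding abs_mult using hL0 that by (intro mult_mono) auto
      with that show ?thesis by linarith
    qed
    \<comment> \<open>The base \<open>?A\<close> is chosen for this recursion: the two shifted sums
      contribute \<open>2 / (h * L)\<close>, and the term of index \<open>l'\<close>, raised to the
      power \<open>Suc l'\<close>, contributes the summand 1.\<close>
    have fin: "1 / (h * L) * (?A ^ Suc l' * \<epsilon> + ?A ^ Suc l' * \<epsilon>) + ?A ^ l' * \<epsilon> \<le> ?A ^ l * \<epsilon>"
    proof -
      have "?A ^ l' \<le> ?A ^ Suc l'" using A1 by (intro power_increasing) auto
      then have "?A ^ l' * \<epsilon> \<le> ?A ^ Suc l' * \<epsilon>" using \<epsilon> by (intro mult_right_mono)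
      then have "1 / (h * L) * (?A ^ Suc l' * \<epsilon> + ?A ^ Suc l' * \<epsilon>) + ?A ^ l' * \<epsilon>
        \<le> 1 / (h * L) * (?A ^ Suc l' * \<epsilon> + ?A ^ Suc l' * \<epsilon>) + ?A ^ Suc l' * \<epsilon>" by simp
      also have "\<dots> = ?A * (?A ^ Suc l' * \<epsilon>)" by (simp only: distrib_right) simp
      finally show ?thesis by (simp add: 3)
    qed
    have "(\<Sum>i\<in>I. v i * (cos (real l * t i) * cos (m * (h * x i)))) =
      1 / (h * L) * ((\<Sum>i\<in>I. v i * (cos (real (Suc l') * t i) * sin ((m + 1) * (h * x i))))
        - (\<Sum>i\<in>I. v i * (cos (real (Suc l') * t i) * sin ((m - 1) * (h * x i)))))
      - (\<Sum>i\<in>I. v i * (cos (real l' * t i) * cos (m * (h * x i))))"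
      unfolding sum_subtractf[symmetric] sum_distrib_left
    proof (intro sum.cong refl)
      fix i assume i: "i \<in> I"
      have "2 * (sin (h * x i) / (h * L)) * cos (m * (h * x i)) = 1 / (h * L) * (sin ((m + 1) * (h * x i)) - sin ((m - 1) * (h * x i)))"
        using sc[of "h * x i"] hL by (simp add: field_simps)
      then show "v i * (cos (real l * t i) * cos (m * (h * x i))) =
         1 / (h * L) * (v i * (cos (real (Suc l') * t i) * sin ((m + 1) * (h * x i))) -
           v i * (cos (real (Suc l') * t i) * sin ((m - 1) * (h * x i)))) - v i * (cos (real l' * t i) * cos (m * (h * x i)))"
        unfolding rec[OF i] by algebra
    qed
    also have "\<bar>\<dots>\<bar> \<le> 1 / (h * L) * (?A ^ Suc l' * \<epsilon> + ?A ^ Suc l' * \<epsilon>) + ?A ^ l' * \<epsilon>"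
      by (intro comb IH1(2) IH2(1)) simp_all
    also note fin
    finally have c: "\<bar>\<Sum>i\<in>I. v i * (cos (real l * t i) * cos (m * (h * x i)))\<bar> \<le> ?A ^ l * \<epsilon>" .
    have "(\<Sum>i\<in>I. v i * (cos (real l * t i) * sin (m * (h * x i)))) =
      1 / (h * L) * ((\<Sum>i\<in>I. v i * (cos (real (Suc l') * t i) * cos ((m - 1) * (h * x i))))
        - (\<Sum>i\<in>I. v i * (cos (real (Suc l') * t i) * cos ((m + 1) * (h * x i)))))
      - (\<Sum>i\<in>I. v i * (cos (real l' * t i) * sin (m * (h * x i))))"
      unfolding sum_subtractf[symmetric] sum_distrib_left
    proof (intro sum.cong refl)
      fix i assume i: "i \<in> I"
      have "2 * (sin (h * x i) / (h * L)) * sin (m * (h * x i)) = 1 / (h * L) * (cos ((m - 1) * (h * x i)) - cos ((m + 1) * (h * x i)))"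
        using ss[of "h * x i"] hL by (simp add: field_simps)
      then show "v i * (cos (real l * t i) * sin (m * (h * x i))) =
         1 / (h * L) * (v i * (cos (real (Suc l') * t i) * cos ((m - 1) * (h * x i))) -
           v i * (cos (real (Suc l') * t i) * cos ((m + 1) * (h * x i)))) - v i * (cos (real l' * t i) * sin (m * (h * x i)))"
        unfolding rec[OF i] by algebra
    qed
    also have "\<bar>\<dots>\<bar> \<le> 1 / (h * L) * (?A ^ Suc l' * \<epsilon> + ?A ^ Suc l' * \<epsilon>) + ?A ^ l' * \<epsilon>"
      by (intro comb IH1(1) IH2(2)) simp_all
    also note fin
    finally show ?thesis using c by blast
  qed
qed

section \<open>From Chebyshev moments to Lipschitz functions\<close>

lemma arcsin_lipschitz:
  assumes "\<bar>a\<bar> \<le> 1/2" "\<bar>b\<bar> \<le> 1/2"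
  shows "\<bar>arcsin a - arcsin b\<bar> \<le> 2 * \<bar>a - b\<bar>"
proof -
  have "norm (arcsin a - arcsin b) \<le> 2 * norm (a - b)"
  proof (rule field_differentiable_bound[where S = "{-1/2..1/2}"])
    fix z :: real assume z: "z \<in> {-1/2..1/2}"
    then have "(arcsin has_field_derivative inverse (sqrt (1 - z\<^sup>2))) (at z)"
      by (intro DERIV_arcsin) auto
    then show "(arcsin has_field_derivative inverse (sqrt (1 - z\<^sup>2))) (at z within {-1/2..1/2})"
      by (rule has_field_derivative_at_within)
    have "z\<^sup>2 \<le> (1/2)\<^sup>2" using z by (intro abs_le_square_iff[THEN iffD1]) auto
    then have "(1/2)\<^sup>2 \<le> 1 - z\<^sup>2" by (simp add: power2_eq_square)
    then have "1/2 \<le> sqrt (1 - z\<^sup>2)" by (rule real_le_rsqrt)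
    then have "inverse (sqrt (1 - z\<^sup>2)) \<le> inverse (1/2)" by (intro le_imp_inverse_le) auto
    moreover have "sqrt (1 - z\<^sup>2) \<ge> 0" using \<open>1/2 \<le> sqrt (1 - z\<^sup>2)\<close> by linarith
    ultimately show "norm (inverse (sqrt (1 - z\<^sup>2))) \<le> 2" by simp
  qed (use assms in auto)
  then show ?thesis by simp
qed

text \<open>The substitution y = sin (h x) / (h L) with h = 1 / k turns the cosine sums of
  \<open>jackson\<close> into Chebyshev polynomials in y, whose moments
  \<open>chebyshev_moment_bound\<close> controls. The first term is the Jackson error
  \<open>22 * L / k\<close> times the total variation 2; the second sums k^2 coefficients of size at
  most \<open>8 * L / k\<close>.\<close>

lemma lipschitz_difference_bound:
  fixes v x :: "'i \<Rightarrow> real" and k :: nat and L :: real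
  assumes "finite I" and L: "L > 0" and k: "k \<ge> 2" "real k \<ge> 2 * L"
    and x: "\<And>i. i \<in> I \<Longrightarrow> \<bar>x i\<bar> \<le> L" and v: "(\<Sum>i\<in>I. \<bar>v i\<bar>) \<le> 2"
    and f: "\<And>s t. \<bar>f s - f t\<bar> \<le> \<bar>s - t\<bar>" "\<And>s. \<bar>s\<bar> \<le> L \<Longrightarrow> \<bar>f s\<bar> \<le> 2 * L"
    and cosb: "\<And>m::int. \<bar>m\<bar> \<le> int k \<Longrightarrow> \<bar>\<Sum>i\<in>I. v i * cos (m / k * x i)\<bar> \<le> \<epsilon>"
    and sinb: "\<And>m::int. \<bar>m\<bar> \<le> int k \<Longrightarrow> \<bar>\<Sum>i\<in>I. v i * sin (m / k * x i)\<bar> \<le> \<epsilon>"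
  shows "\<bar>\<Sum>i\<in>I. v i * f (x i)\<bar> \<le> 44 * L / k + 8 * L * k * (2 * real k / L + 1) ^ k * \<epsilon>"
proof -
  define h where "h = 1 / real k"
  \<comment> \<open>The inverse of the substitution. The hypothesis
    \<open>real k \<ge> 2 * L\<close> keeps the argument of arcsin in [-1/2, 1/2], where it is
    Lipschitz with constant 2.\<close>
  define g where "g y = arcsin (h * L * y) / h" for y
  define q where "q y = f (g y)" for y
  have h: "h > 0" "h * L \<le> 1/2" "h * L > 0" using k L by (auto simp: h_def field_simps)
  have arg: "\<bar>h * L * y\<bar> \<le> 1/2" if "y \<in> {-1..1}" for y
  proof -
    have "\<bar>h * L * y\<bar> \<le> h * L * 1" unfolding abs_mult using h that L by (intro mult_mono) auto
    with h show ?thesis by linarith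
  qed
  have gdiff: "\<bar>g y - g z\<bar> \<le> 2 * L * \<bar>y - z\<bar>" if "y \<in> {-1..1}" "z \<in> {-1..1}" for y z
  proof -
    have "\<bar>g y - g z\<bar> = \<bar>arcsin (h * L * y) - arcsin (h * L * z)\<bar> / h"
      using h by (simp add: g_def abs_divide flip: diff_divide_distrib)
    also have "\<dots> \<le> (2 * \<bar>h * L * y - h * L * z\<bar>) / h"
      using h arg that by (intro divide_right_mono arcsin_lipschitz) auto
    also have "\<dots> = 2 * L * \<bar>y - z\<bar>"
      using h L by (simp add: abs_mult flip: right_diff_distrib)
    finally show ?thesis .
  qed
  have g0: "g 0 = 0" by (simp add: g_def)
  have f0: "\<bar>f 0\<bar> \<le> 2 * L" using f(2)[of 0] L by simp
  \<comment> \<open>\<open>g y\<close> may leave \<open>{-L..L}\<close>, where no direct bound on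
    \<open>f\<close> is given; the estimate therefore goes through \<open>f 0\<close> and the global
    Lipschitz property.\<close>
  have qB: "\<bar>q y\<bar> \<le> 4 * L" if "y \<in> {-1..1}" for y
  proof -
    have "\<bar>q y\<bar> \<le> \<bar>f 0\<bar> + \<bar>f (g y) - f 0\<bar>" unfolding q_def by linarith
    also have "\<bar>f (g y) - f 0\<bar> \<le> \<bar>g y - g 0\<bar>" using f(1)[of "g y" 0] by (simp add: g0)
    also have "\<dots> \<le> 2 * L * \<bar>y - 0\<bar>" using that by (intro gdiff) auto
    also have "\<dots> \<le> 2 * L * 1" using that L by (intro mult_left_mono) auto
    finally show ?thesis using f0 by simp
  qed
  have qL: "\<bar>q y - q z\<bar> \<le> 2 * L * \<bar>y - z\<bar>" if "y \<in> {-1..1}" "z \<in> {-1..1}" for y z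
    unfolding q_def using f(1) gdiff[OF that] by (rule order_trans)
  obtain b :: "nat \<Rightarrow> nat \<Rightarrow> real" where b: "\<And>i j. \<bar>b i j\<bar> \<le> 2 * (4 * L) / k"
    and G: "\<And>t. \<bar>q (cos t) - (\<Sum>i<k. \<Sum>j<k. b i j * cos ((real i - real j) * t))\<bar> \<le> 11 * (2 * L) / k"
    using jackson[OF k(1) qB qL] by blast
  define t where "t i = arccos (sin (h * x i) / (h * L))" for i
  have hx: "\<bar>h * x i\<bar> \<le> h * L" if "i \<in> I" for i
    using x[OF that] h by (simp add: abs_mult)
  have sinhx: "\<bar>sin (h * x i)\<bar> \<le> h * L" if "i \<in> I" for i
    using abs_sin_x_le_abs_x[of "h * x i"] hx[OF that] by linarith
  have qx: "q (cos (t i)) = f (x i)" if "i \<in> I" for i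
  proof -
    have "cos (t i) = sin (h * x i) / (h * L)"
      unfolding t_def using sinhx[OF that] h by (intro cos_arccos_abs) (simp add: divide_le_eq)
    then have "g (cos (t i)) = arcsin (sin (h * x i)) / h" using h L by (simp add: g_def)
    also have "arcsin (sin (h * x i)) = h * x i"
      using hx[OF that] h pi_gt3 by (intro arcsin_sin) auto
    finally show ?thesis using h by (simp add: q_def)
  qed
  have \<epsilon>: "\<epsilon> \<ge> 0" using order_trans[OF abs_ge_zero cosb[of 0]] by simp
  define A where "A = 2 * real k / L + 1"
  have A: "A \<ge> 1" "2 / (h * L) + 1 = A" using L k by (auto simp: A_def h_def)
  have ch: "\<bar>\<Sum>i\<in>I. v i * cos ((real a - real c) * t i)\<bar> \<le> A ^ k * \<epsilon>" if "a < k" "c < k" for a c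
  proof -
    define l where "l = nat \<bar>int a - int c\<bar>"
    have l: "l < k" using that by (auto simp: l_def)
    have ac: "\<bar>real a - real c\<bar> = real l" unfolding l_def by linarith
    have "cos ((real a - real c) * s) = cos (real l * s)" for s
      by (metis ac abs_if cos_minus minus_mult_left)
    then have "\<bar>\<Sum>i\<in>I. v i * cos ((real a - real c) * t i)\<bar>
      = \<bar>\<Sum>i\<in>I. v i * (cos (real l * t i) * cos (of_int 0 * (h * x i)))\<bar>" by simp
    also have "\<dots> \<le> A ^ l * \<epsilon>"
      unfolding t_def A(2)[symmetric]
      using h L sinhx cosb sinb l
      by (intro conjunct1[OF chebyshev_moment_bound[where k=k]]) (auto simp: h_def mult.commute)
    also have "\<dots> \<le> A ^ k * \<epsilon>" using A l \<epsilon> by (intro mult_right_mono power_increasing) auto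
    finally show ?thesis .
  qed
  let ?G = "\<lambda>s. \<Sum>a<k. \<Sum>c<k. b a c * cos ((real a - real c) * s)"
  have S0: "(\<Sum>i\<in>I. v i * f (x i)) = (\<Sum>i\<in>I. v i * (q (cos (t i)) - ?G (t i))) + (\<Sum>i\<in>I. v i * ?G (t i))"
    unfolding sum.distrib[symmetric] distrib_left[symmetric] by (intro sum.cong refl) (simp add: qx)
  have "\<bar>\<Sum>i\<in>I. v i * (q (cos (t i)) - ?G (t i))\<bar> \<le> (\<Sum>i\<in>I. \<bar>v i * (q (cos (t i)) - ?G (t i))\<bar>)"
    by (rule sum_abs)
  also have "\<dots> \<le> (\<Sum>i\<in>I. \<bar>v i\<bar> * (11 * (2 * L) / k))"
    unfolding abs_mult by (intro sum_mono mult_left_mono G abs_ge_zero)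
  also have "\<dots> \<le> 2 * (11 * (2 * L) / k)"
    unfolding sum_distrib_right[symmetric] using v L by (intro mult_right_mono) auto
  finally have S1: "\<bar>\<Sum>i\<in>I. v i * (q (cos (t i)) - ?G (t i))\<bar> \<le> 2 * (11 * (2 * L) / k)" .
  have "(\<Sum>i\<in>I. v i * ?G (t i)) = (\<Sum>i\<in>I. \<Sum>a<k. \<Sum>c<k. b a c * (v i * cos ((real a - real c) * t i)))"
    by (simp only: sum_distrib_left mult.left_commute[of "v _"])
  also have "\<dots> = (\<Sum>a<k. \<Sum>i\<in>I. \<Sum>c<k. b a c * (v i * cos ((real a - real c) * t i)))"
    by (rule sum.swap)
  also have "\<dots> = (\<Sum>a<k. \<Sum>c<k. \<Sum>i\<in>I. b a c * (v i * cos ((real a - real c) * t i)))"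
    by (rule sum.cong[OF refl sum.swap])
  also have "\<dots> = (\<Sum>a<k. \<Sum>c<k. b a c * (\<Sum>i\<in>I. v i * cos ((real a - real c) * t i)))"
    by (simp only: sum_distrib_left)
  finally have S2: "\<bar>\<Sum>i\<in>I. v i * ?G (t i)\<bar> = \<bar>\<Sum>a<k. \<Sum>c<k. b a c * (\<Sum>i\<in>I. v i * cos ((real a - real c) * t i))\<bar>"
    by simp
  have "\<bar>\<Sum>a<k. \<Sum>c<k. b a c * (\<Sum>i\<in>I. v i * cos ((real a - real c) * t i))\<bar>
      \<le> (\<Sum>a<k. \<bar>\<Sum>c<k. b a c * (\<Sum>i\<in>I. v i * cos ((real a - real c) * t i))\<bar>)"
    by (rule sum_abs)
  also have "\<dots> \<le> (\<Sum>a<k. \<Sum>c<k. \<bar>b a c * (\<Sum>i\<in>I. v i * cos ((real a - real c) * t i))\<bar>)"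
    by (rule sum_mono) (rule sum_abs)
  also have "\<dots> \<le> (\<Sum>a<k. \<Sum>c<k. 2 * (4 * L) / k * (A ^ k * \<epsilon>))"
  proof (intro sum_mono)
    fix a c assume "a \<in> {..<k}" "c \<in> {..<k}"
    then show "\<bar>b a c * (\<Sum>i\<in>I. v i * cos ((real a - real c) * t i))\<bar> \<le> 2 * (4 * L) / k * (A ^ k * \<epsilon>)"
      unfolding abs_mult using L by (intro mult_mono b ch) auto
  qed
  also have "\<dots> = 8 * L * k * A ^ k * \<epsilon>" using k by simp
  finally have S3: "\<bar>\<Sum>i\<in>I. v i * ?G (t i)\<bar> \<le> 8 * L * k * A ^ k * \<epsilon>" unfolding S2 .
  have "\<bar>\<Sum>i\<in>I. v i * f (x i)\<bar> \<le> 2 * (11 * (2 * L) / k) + 8 * L * k * A ^ k * \<epsilon>"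
    unfolding S0 by (rule order_trans[OF abs_triangle_ineq add_mono[OF S1 S3]])
  then show ?thesis by (simp add: A_def)
qed

section \<open>Quantile coupling\<close>

lemma mixing_cong:
  assumes "\<And>j. j \<in> {1..k} \<Longrightarrow> w j = w' j" "\<And>j. j \<in> {1..k} \<Longrightarrow> \<theta> j = \<theta>' j"
  shows "mixing k w \<theta> = mixing k w' \<theta>'"
  by (rule measure_eqI) (auto simp: sets_mixing emeasure_mixing assms intro!: sum.cong)

lemma mixing_permute:
  assumes "bij_betw \<pi> {1..k} {1..k}"
  shows "mixing k (\<lambda>j. w (\<pi> j)) (\<lambda>j. \<theta> (\<pi> j)) = mixing k w \<theta>"
proof (rule measure_eqI)
  fix A assume "A \<in> sets (mixing k (\<lambda>j. w (\<pi> j)) (\<lambda>j. \<theta> (\<pi> j)))"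
  then have "A \<in> sets borel" by (simp add: sets_mixing)
  then show "emeasure (mixing k (\<lambda>j. w (\<pi> j)) (\<lambda>j. \<theta> (\<pi> j))) A = emeasure (mixing k w \<theta>) A"
    using sum.reindex_bij_betw[OF assms, of "\<lambda>j. ennreal (w j) * emeasure (return borel (\<theta> j)) A"]
    by (simp only: emeasure_mixing)
qed (simp add: sets_mixing)

lemma ex_sorting_permutation:
  fixes \<theta> :: "nat \<Rightarrow> 'a :: linorder"
  shows "\<exists>\<pi>. bij_betw \<pi> {1..k} {1..k} \<and> (\<forall>i j. 1 \<le> i \<longrightarrow> i \<le> j \<longrightarrow> j \<le> k \<longrightarrow> \<theta> (\<pi> i) \<le> \<theta> (\<pi> j))"
proof -
  define xs where "xs = sort_key \<theta> [1..<Suc k]"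
  have xs: "length xs = k" "distinct xs" "set xs = {1..k}" "sorted (map \<theta> xs)"
    by (auto simp: xs_def)
  have "bij_betw (\<lambda>j. j - 1) {1..k} {..<k}"
    by (rule bij_betw_byWitness[where f' = Suc]) auto
  moreover have "bij_betw ((!) xs) {..<k} {1..k}"
    using xs by (intro bij_betw_nth) auto
  ultimately have "bij_betw ((!) xs \<circ> (\<lambda>j. j - 1)) {1..k} {1..k}"
    by (rule bij_betw_trans)
  moreover have "\<theta> (xs ! (i - 1)) \<le> \<theta> (xs ! (j - 1))" if "1 \<le> i" "i \<le> j" "j \<le> k" for i j
    using sorted_nth_mono[OF xs(4), of "i - 1" "j - 1"] that xs(1) by simp
  ultimately show ?thesis by (intro exI[of _ "(!) xs \<circ> (\<lambda>j. j - 1)"]) auto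
qed

lemma W1_le_coupling:
  assumes "w \<in> weight_simplex k" "w' \<in> weight_simplex k'" "p \<in> couplings k w k' w'"
  shows "W1 (mixing k w \<theta>) (mixing k' w' \<theta>') \<le> (\<Sum>j=1..k. \<Sum>h=1..k'. p j h * \<bar>\<theta> j - \<theta>' h\<bar>)"
  unfolding W1_def
proof (rule cInf_lower)
  show "bdd_below {(\<Sum>j=1..k. \<Sum>h=1..k'. p j h * \<bar>\<theta> j - \<theta>' h\<bar>) | k w \<theta> k' w' \<theta>' p.
      w \<in> weight_simplex k \<and> mixing k0 w0 \<theta>0 = mixing k w \<theta> \<and>
      w' \<in> weight_simplex k' \<and> mixing k0' w0' \<theta>0' = mixing k' w' \<theta>' \<and> p \<in> couplings k w k' w'}"
    for k0 w0 \<theta>0 k0' w0' \<theta>0'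
    by (rule bdd_belowI[of _ 0]) (auto simp: couplings_def intro!: sum_nonneg)
qed (use assms in blast)

text \<open>With \<open>X\<close> an interval of one partition of the unit interval and
  \<open>c\<close> the endpoints of the other, this gives the row and column sums of the quantile
  coupling.\<close>

lemma sum_interval_partition:
  fixes c :: "nat \<Rightarrow> real"
  assumes c: "\<And>m. m < n \<Longrightarrow> c m \<le> c (Suc m)" and X: "X \<in> sets borel"
  shows "(\<Sum>h=1..n. measure lborel (X \<inter> {c (h - 1)..<c h})) = measure lborel (X \<inter> {c 0..<c n})"
  using c
proof (induction n)
  case (Suc n)
  have mono: "c 0 \<le> c n" using Suc.prems by (induction n) (auto intro: order_trans)
  have le: "c n \<le> c (Suc n)" using Suc.prems by simp
  have fin: "X \<inter> {a..<b} \<in> fmeasurable lborel" for a b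
    by (rule fmeasurableI2[of "{a..b}"]) (use X in \<open>auto simp: fmeasurable_compact\<close>)
  have "X \<inter> {c 0..<c (Suc n)} = (X \<inter> {c 0..<c n}) \<union> (X \<inter> {c n..<c (Suc n)})"
    using mono le by auto
  then have "measure lborel (X \<inter> {c 0..<c (Suc n)}) =
      measure lborel (X \<inter> {c 0..<c n}) + measure lborel (X \<inter> {c n..<c (Suc n)})"
    by (simp only:, intro measure_Union) (use fin in \<open>auto simp: fmeasurable_def top.not_eq_extremum\<close>)
  with Suc show ?case by simp
qed simp

text \<open>The coupling is \<open>p j h = |J j \<inter> J' h|\<close>, where \<open>J j\<close> and \<open>J' h\<close> are the intervals on which the
  quantile functions take the values \<open>\<theta> j\<close> and \<open>\<theta>' h\<close>. The function \<open>f\<close> has slope \<open>1\<close> where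
  \<open>F < F'\<close> and \<open>-1\<close> elsewhere, so that \<open>f (\<theta> j) - f (\<theta>' h) = |\<theta> j - \<theta>' h|\<close> on the support of the
  coupling.\<close>

lemma W1_le_sorted:
  fixes L :: real
  assumes w: "w \<in> weight_simplex k" and w': "w' \<in> weight_simplex k'"
    and s: "\<And>i j. 1 \<le> i \<Longrightarrow> i \<le> j \<Longrightarrow> j \<le> k \<Longrightarrow> \<theta> i \<le> \<theta> j"
    and s': "\<And>i j. 1 \<le> i \<Longrightarrow> i \<le> j \<Longrightarrow> j \<le> k' \<Longrightarrow> \<theta>' i \<le> \<theta>' j"
    and \<theta>: "\<And>i. i \<in> {1..k} \<Longrightarrow> \<theta> i \<in> {-L..L}" and \<theta>': "\<And>i. i \<in> {1..k'} \<Longrightarrow> \<theta>' i \<in> {-L..L}"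
  shows "\<exists>f::real \<Rightarrow> real. (\<forall>s t. \<bar>f s - f t\<bar> \<le> \<bar>s - t\<bar>) \<and> (\<forall>s. \<bar>s\<bar> \<le> L \<longrightarrow> \<bar>f s\<bar> \<le> 2 * L) \<and>
    W1 (mixing k w \<theta>) (mixing k' w' \<theta>') \<le> (\<Sum>j=1..k. w j * f (\<theta> j)) - (\<Sum>h=1..k'. w' h * f (\<theta>' h))"
proof -
  define C where "C m = (\<Sum>i=1..m. w i)" for m
  define C' where "C' m = (\<Sum>i=1..m. w' i)" for m
  have w0: "w i \<ge> 0" if "i \<in> {1..k}" for i using w that by (auto simp: weight_simplex_def)
  have w'0: "w' i \<ge> 0" if "i \<in> {1..k'}" for i using w' that by (auto simp: weight_simplex_def)
  have C: "C 0 = 0" "C k = 1" "\<And>m. m < k \<Longrightarrow> C m \<le> C (Suc m)"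
    using w by (auto simp: C_def weight_simplex_def)
  have C': "C' 0 = 0" "C' k' = 1" "\<And>m. m < k' \<Longrightarrow> C' m \<le> C' (Suc m)"
    using w' by (auto simp: C'_def weight_simplex_def)
  define J where "J j = {C (j - 1)..<C j}" for j
  define J' where "J' h = {C' (h - 1)..<C' h}" for h
  have Jsub: "J j \<subseteq> {0..<1}" "C (j - 1) \<le> C j" "measure lborel (J j) = w j" if "j \<in> {1..k}" for j
  proof -
    have "C (j - 1) \<ge> 0" unfolding C_def using that w0 by (intro sum_nonneg) auto
    moreover have "C j \<le> C k" unfolding C_def using that w0 by (intro sum_mono2) auto
    ultimately show "J j \<subseteq> {0..<1}" by (auto simp: J_def C)
    have "C j = C (j - 1) + w j" using that unfolding C_def
      by (cases j) auto
    with w0[OF that] show "C (j - 1) \<le> C j" "measure lborel (J j) = w j" by (auto simp: J_def)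
  qed
  have J'sub: "J' j \<subseteq> {0..<1}" "measure lborel (J' j) = w' j" if "j \<in> {1..k'}" for j
  proof -
    have "C' (j - 1) \<ge> 0" unfolding C'_def using that w'0 by (intro sum_nonneg) auto
    moreover have "C' j \<le> C' k'" unfolding C'_def using that w'0 by (intro sum_mono2) auto
    ultimately show "J' j \<subseteq> {0..<1}" by (auto simp: J'_def C')
    have "C' j = C' (j - 1) + w' j" using that unfolding C'_def
      by (cases j) auto
    with w'0[OF that] show "measure lborel (J' j) = w' j" by (auto simp: J'_def)
  qed
  define p where "p j h = measure lborel (J j \<inter> J' h)" for j h
  have row: "(\<Sum>h=1..k'. p j h) = w j" if "j \<in> {1..k}" for j
  proof -
    have "(\<Sum>h=1..k'. p j h) = measure lborel (J j \<inter> {C' 0..<C' k'})"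
      unfolding p_def J'_def using C' by (intro sum_interval_partition) (auto simp: J_def)
    also have "J j \<inter> {C' 0..<C' k'} = J j" using Jsub[OF that] C' by auto
    finally show ?thesis using Jsub[OF that] by simp
  qed
  have col: "(\<Sum>j=1..k. p j h) = w' h" if "h \<in> {1..k'}" for h
  proof -
    have "(\<Sum>j=1..k. p j h) = measure lborel (J' h \<inter> {C 0..<C k})"
      unfolding p_def J_def Int_commute[of _ "J' h"]
      using C by (intro sum_interval_partition) (auto simp: J'_def)
    also have "J' h \<inter> {C 0..<C k} = J' h" using J'sub[OF that] C by auto
    finally show ?thesis using J'sub[OF that] by simp
  qed
  have p0: "p j h \<ge> 0" for j h by (simp add: p_def)
  have "p \<in> couplings k w k' w'"
  proof -
    have "p j h \<le> 1" if "j \<in> {1..k}" "h \<in> {1..k'}" for j h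
    proof -
      have "p j h \<le> (\<Sum>h=1..k'. p j h)" using that p0 by (intro member_le_sum) auto
      also have "\<dots> \<le> 1" using row[OF that(1)] w that(1) by (auto simp: weight_simplex_def)
      finally show ?thesis .
    qed
    then show ?thesis using row col p0 by (auto simp: couplings_def)
  qed
  note W = W1_le_coupling[OF w w' this, of \<theta> \<theta>']
  \<comment> \<open>\<open>F\<close> and \<open>F'\<close> are the distribution functions of the two
    mixtures.\<close>
  define F where "F y = (\<Sum>j=1..k. w j * indicator {\<theta> j..} y)" for y
  define F' where "F' y = (\<Sum>j=1..k'. w' j * indicator {\<theta>' j..} y)" for y
  define S where "S = {y. F y < F' y}"
  have [measurable]: "F \<in> borel_measurable borel" "F' \<in> borel_measurable borel"
    unfolding F_def F'_def by measurable
  have S[measurable]: "S \<in> sets borel" unfolding S_def by measurable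
  \<comment> \<open>Clipping at \<open>-L\<close> extends the potential as a constant to the left,
    so that it is Lipschitz on the whole line and \<open>G\<close> need only start at
    \<open>-L\<close>.\<close>
  define c where "c x = max x (-L)" for x
  define G where "G x = measure lborel (S \<inter> {-L..<x})" for x
  \<comment> \<open>The integral from \<open>-L\<close> to \<open>c x\<close> of the function equal
    to 1 on \<open>S\<close> and to -1 off \<open>S\<close>.\<close>
  define f where "f x = 2 * G (c x) - (c x + L)" for x
  have fin: "S \<inter> {a..<b} \<in> fmeasurable lborel" for a b
    by (rule fmeasurableI2[of "{a..b}"]) (auto simp: fmeasurable_compact)
  have G: "G t = G s + measure lborel (S \<inter> {s..<t})" if "-L \<le> s" "s \<le> t" for s t
  proof -
    have "S \<inter> {-L..<t} = (S \<inter> {-L..<s}) \<union> (S \<inter> {s..<t})" using that by auto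
    then show ?thesis unfolding G_def
      by (simp only:, intro measure_Union) (use fin in \<open>auto simp: fmeasurable_def top.not_eq_extremum\<close>)
  qed
  have inc: "measure lborel (S \<inter> {s..<t}) \<le> t - s" if "s \<le> t" for s t
    using measure_mono_fmeasurable[of "S \<inter> {s..<t}" "{s..<t}" lborel] that
    by (auto simp: fmeasurable_def)
  have flip1: "\<bar>f s - f t\<bar> \<le> \<bar>s - t\<bar>" if "s \<le> t" for s t
  proof -
    have cs: "-L \<le> c s" "c s \<le> c t" "c t - c s \<le> \<bar>s - t\<bar>" using that by (auto simp: c_def)
    show ?thesis using G[OF cs(1,2)] inc[OF cs(2)] cs that measure_nonneg[of lborel "S \<inter> {c s..<c t}"]
      unfolding f_def abs_le_iff[of "_ - _ - _"] by linarith
  qed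
  have flip: "\<bar>f s - f t\<bar> \<le> \<bar>s - t\<bar>" for s t
    using flip1[of s t] flip1[of t s] by (cases "s \<le> t") (auto simp: abs_minus_commute)
  have fb: "\<bar>f s\<bar> \<le> 2 * L" if "\<bar>s\<bar> \<le> L" for s
  proof -
    have "f (-L) = 0" by (simp add: f_def c_def G_def)
    with flip[of s "-L"] that show ?thesis by linarith
  qed
  \<comment> \<open>Complementary slackness. Positive mass provides a common level \<open>u\<close>
    of both intervals. If \<open>\<theta>' h \<le> y < \<theta> j\<close>, then
    \<open>F y \<le> C (j - 1) \<le> u < C' h \<le> F' y\<close>, so \<open>f\<close> has slope 1
    between the two atoms; in the other order the slope is -1.\<close>
  have slack: "p j h * \<bar>\<theta> j - \<theta>' h\<bar> = p j h * (f (\<theta> j) - f (\<theta>' h))"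
    if j: "j \<in> {1..k}" and h: "h \<in> {1..k'}" for j h
  proof (cases "p j h = 0")
    case False
    then have "J j \<inter> J' h \<noteq> {}" by (auto simp: p_def)
    then obtain u where "u \<in> J j \<inter> J' h" by blast
    then have u: "C (j - 1) \<le> u" "u < C j" "C' (h - 1) \<le> u" "u < C' h"
      by (auto simp: J_def J'_def)
    have cj: "c (\<theta> j) = \<theta> j" "-L \<le> \<theta> j" and ch: "c (\<theta>' h) = \<theta>' h" "-L \<le> \<theta>' h"
      using \<theta>[OF j] \<theta>'[OF h] by (auto simp: c_def)
    have Fle: "F y \<le> C (j - 1)" if "y < \<theta> j" for y
    proof -
      have "F y = (\<Sum>i=1..j-1. w i * indicator {\<theta> i..} y)"
        unfolding F_def
      proof (rule sum.mono_neutral_right)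
        show "\<forall>i\<in>{1..k} - {1..j - 1}. w i * indicator {\<theta> i..} y = 0"
        proof
          fix i assume "i \<in> {1..k} - {1..j - 1}"
          then have "\<theta> j \<le> \<theta> i" using j by (intro s) auto
          with that show "w i * indicator {\<theta> i..} y = 0" by (auto simp: indicator_def)
        qed
      qed (use j in auto)
      also have "\<dots> \<le> C (j - 1)"
        unfolding C_def using j w0 by (intro sum_mono) (auto simp: indicator_def)
      finally show ?thesis .
    qed
    have F'le: "F' y \<le> C' (h - 1)" if "y < \<theta>' h" for y
    proof -
      have "F' y = (\<Sum>i=1..h-1. w' i * indicator {\<theta>' i..} y)"
        unfolding F'_def
      proof (rule sum.mono_neutral_right)
        show "\<forall>i\<in>{1..k'} - {1..h - 1}. w' i * indicator {\<theta>' i..} y = 0"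
        proof
          fix i assume "i \<in> {1..k'} - {1..h - 1}"
          then have "\<theta>' h \<le> \<theta>' i" using h by (intro s') auto
          with that show "w' i * indicator {\<theta>' i..} y = 0" by (auto simp: indicator_def)
        qed
      qed (use h in auto)
      also have "\<dots> \<le> C' (h - 1)"
        unfolding C'_def using h w'0 by (intro sum_mono) (auto simp: indicator_def)
      finally show ?thesis .
    qed
    have Fge: "F y \<ge> C j" if "\<theta> j \<le> y" for y
    proof -
      have "C j = (\<Sum>i=1..j. w i * indicator {\<theta> i..} y)"
        unfolding C_def
      proof (rule sum.cong[OF refl])
        fix i assume "i \<in> {1..j}"
        then have "\<theta> i \<le> \<theta> j" using j by (intro s) auto
        with that show "w i = w i * indicator {\<theta> i..} y" by simp
      qed
      also have "\<dots> \<le> F y"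
        unfolding F_def using j w0 by (intro sum_mono2) auto
      finally show ?thesis .
    qed
    have F'ge: "F' y \<ge> C' h" if "\<theta>' h \<le> y" for y
    proof -
      have "C' h = (\<Sum>i=1..h. w' i * indicator {\<theta>' i..} y)"
        unfolding C'_def
      proof (rule sum.cong[OF refl])
        fix i assume "i \<in> {1..h}"
        then have "\<theta>' i \<le> \<theta>' h" using h by (intro s') auto
        with that show "w' i = w' i * indicator {\<theta>' i..} y" by simp
      qed
      also have "\<dots> \<le> F' y"
        unfolding F'_def using h w'0 by (intro sum_mono2) auto
      finally show ?thesis .
    qed
    show ?thesis
    proof (cases "\<theta>' h \<le> \<theta> j")
      case True
      have "S \<inter> {\<theta>' h..<\<theta> j} = {\<theta>' h..<\<theta> j}"
        using Fle F'ge u by (fastforce simp: S_def)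
      with G[OF ch(2) True] True show ?thesis by (simp add: f_def cj ch)
    next
      case False
      have "S \<inter> {\<theta> j..<\<theta>' h} = {}"
        using Fge F'le u by (fastforce simp: S_def)
      with G[OF cj(2), of "\<theta>' h"] False show ?thesis by (simp add: f_def cj ch)
    qed
  qed simp
  have "(\<Sum>j=1..k. \<Sum>h=1..k'. p j h * \<bar>\<theta> j - \<theta>' h\<bar>)
    = (\<Sum>j=1..k. \<Sum>h=1..k'. p j h * f (\<theta> j)) - (\<Sum>j=1..k. \<Sum>h=1..k'. p j h * f (\<theta>' h))"
    unfolding sum_subtractf[symmetric] by (intro sum.cong refl) (simp add: slack right_diff_distrib)
  also have "(\<Sum>j=1..k. \<Sum>h=1..k'. p j h * f (\<theta> j)) = (\<Sum>j=1..k. w j * f (\<theta> j))"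
    by (intro sum.cong refl) (simp only: sum_distrib_right[symmetric] row)
  also have "(\<Sum>j=1..k. \<Sum>h=1..k'. p j h * f (\<theta>' h)) = (\<Sum>h=1..k'. w' h * f (\<theta>' h))"
    by (subst sum.swap, intro sum.cong refl) (simp only: sum_distrib_right[symmetric] col)
  finally show ?thesis using W flip fb by (intro exI[of _ f]) auto
qed

text \<open>The nontrivial half of Kantorovich-Rubinstein duality. Permuting the components does not
  change the mixture, so both lists of atoms can be sorted first.\<close>

lemma W1_le_lipschitz_difference:
  fixes L :: real
  assumes w: "w \<in> weight_simplex k" and w': "w' \<in> weight_simplex k'"
    and \<theta>: "\<theta> \<in> cube L k" and \<theta>': "\<theta>' \<in> cube L k'"
  shows "\<exists>f::real \<Rightarrow> real. (\<forall>s t. \<bar>f s - f t\<bar> \<le> \<bar>s - t\<bar>) \<and> (\<forall>s. \<bar>s\<bar> \<le> L \<longrightarrow> \<bar>f s\<bar> \<le> 2 * L) \<and>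
    W1 (mixing k w \<theta>) (mixing k' w' \<theta>') \<le> (\<Sum>j=1..k. w j * f (\<theta> j)) - (\<Sum>h=1..k'. w' h * f (\<theta>' h))"
proof -
  obtain \<pi> where \<pi>: "bij_betw \<pi> {1..k} {1..k}"
      "\<And>i j. 1 \<le> i \<Longrightarrow> i \<le> j \<Longrightarrow> j \<le> k \<Longrightarrow> \<theta> (\<pi> i) \<le> \<theta> (\<pi> j)"
    using ex_sorting_permutation[of k \<theta>] by blast
  obtain \<pi>' where \<pi>': "bij_betw \<pi>' {1..k'} {1..k'}"
      "\<And>i j. 1 \<le> i \<Longrightarrow> i \<le> j \<Longrightarrow> j \<le> k' \<Longrightarrow> \<theta>' (\<pi>' i) \<le> \<theta>' (\<pi>' j)"
    using ex_sorting_permutation[of k' \<theta>'] by blast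
  \<comment> \<open>\<open>weight_simplex\<close> consists of extensional functions, so the permuted
    weights must be undefined outside the index range.\<close>
  define v where "v = restrict (\<lambda>j. w (\<pi> j)) {1..k}"
  define v' where "v' = restrict (\<lambda>j. w' (\<pi>' j)) {1..k'}"
  have in\<pi>: "\<pi> j \<in> {1..k}" if "j \<in> {1..k}" for j using bij_betw_apply[OF \<pi>(1) that] .
  have in\<pi>': "\<pi>' j \<in> {1..k'}" if "j \<in> {1..k'}" for j using bij_betw_apply[OF \<pi>'(1) that] .
  have v: "v \<in> weight_simplex k"
    using w in\<pi> sum.reindex_bij_betw[OF \<pi>(1), of w]
    by (auto simp: weight_simplex_def v_def PiE_iff)
  have v': "v' \<in> weight_simplex k'"
    using w' in\<pi>' sum.reindex_bij_betw[OF \<pi>'(1), of w']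
    by (auto simp: weight_simplex_def v'_def PiE_iff)
  have m: "mixing k v (\<lambda>j. \<theta> (\<pi> j)) = mixing k w \<theta>"
    using mixing_permute[OF \<pi>(1), of w \<theta>] mixing_cong[of k v "\<lambda>j. w (\<pi> j)"] by (simp add: v_def)
  have m': "mixing k' v' (\<lambda>j. \<theta>' (\<pi>' j)) = mixing k' w' \<theta>'"
    using mixing_permute[OF \<pi>'(1), of w' \<theta>'] mixing_cong[of k' v' "\<lambda>j. w' (\<pi>' j)"] by (simp add: v'_def)
  have sv: "(\<Sum>j=1..k. v j * f (\<theta> (\<pi> j))) = (\<Sum>j=1..k. w j * f (\<theta> j))" for f :: "real \<Rightarrow> real"
    using sum.reindex_bij_betw[OF \<pi>(1), of "\<lambda>j. w j * f (\<theta> j)"] by (simp add: v_def)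
  have sv': "(\<Sum>j=1..k'. v' j * f (\<theta>' (\<pi>' j))) = (\<Sum>j=1..k'. w' j * f (\<theta>' j))" for f :: "real \<Rightarrow> real"
    using sum.reindex_bij_betw[OF \<pi>'(1), of "\<lambda>j. w' j * f (\<theta>' j)"] by (simp add: v'_def)
  have "\<theta> (\<pi> i) \<in> {-L..L}" if "i \<in> {1..k}" for i using \<theta> in\<pi>[OF that] by (auto simp: cube_def)
  moreover have "\<theta>' (\<pi>' i) \<in> {-L..L}" if "i \<in> {1..k'}" for i using \<theta>' in\<pi>'[OF that] by (auto simp: cube_def)
  ultimately show ?thesis
    using W1_le_sorted[OF v v', where \<theta> = "\<lambda>j. \<theta> (\<pi> j)" and \<theta>' = "\<lambda>j. \<theta>' (\<pi>' j)" and L = L] \<pi>(2) \<pi>'(2)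
    unfolding m m' sv sv' by blast
qed

section \<open>Normal mixtures and i.i.d. samples\<close>

lemma mixing_distsE:
  assumes "\<nu> \<in> mixing_dists L"
  obtains k w \<theta> where "k \<ge> 1" "w \<in> weight_simplex k" "\<theta> \<in> cube L k" "\<nu> = mixing k w \<theta>"
  using assms by (auto simp: mixing_dists_def mixing_dists_k_def)

lemma prob_space_mixing:
  assumes "w \<in> weight_simplex k"
  shows "prob_space (mixing k w \<theta>)"
proof
  have "emeasure (mixing k w \<theta>) UNIV = (\<Sum>j=1..k. ennreal (w j))"
    by (simp add: emeasure_mixing)
  also have "\<dots> = ennreal (\<Sum>j=1..k. w j)"
    using assms by (intro sum_ennreal) (auto simp: weight_simplex_def)
  also have "\<dots> = 1" using assms by (simp add: weight_simplex_def)
  finally show "emeasure (mixing k w \<theta>) (space (mixing k w \<theta>)) = 1"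
    by (simp add: mixing_def)
qed

lemma mixing_dists_prob_space:
  assumes "\<nu> \<in> mixing_dists L"
  shows "prob_space \<nu>" "sets \<nu> = sets borel"
  using assms by (auto elim!: mixing_distsE simp: sets_mixing intro: prob_space_mixing)

lemma integral_mixing:
  fixes f :: "real \<Rightarrow> real"
  assumes w: "w \<in> weight_simplex k" and [measurable]: "f \<in> borel_measurable borel"
  shows "(\<integral>t. f t \<partial>mixing k w \<theta>) = (\<Sum>j=1..k. w j * f (\<theta> j))"
proof -
  have [measurable]: "\<theta> \<in> point_measure {1..k} (\<lambda>j. ennreal (w j)) \<rightarrow>\<^sub>M borel"
    by (simp add: measurable_point_measure_eq1)
  have "(\<integral>t. f t \<partial>mixing k w \<theta>) = (\<integral>j. f (\<theta> j) \<partial>point_measure {1..k} (\<lambda>j. ennreal (w j)))"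
    unfolding mixing_def by (rule integral_distr) measurable
  also have "\<dots> = (\<Sum>j=1..k. w j *\<^sub>R f (\<theta> j))"
    using w by (intro lebesgue_integral_point_measure_finite) (auto simp: weight_simplex_def)
  finally show ?thesis by simp
qed

lemma normal_density_measurable_mean: "(\<lambda>t. normal_density t 1 x) \<in> borel_measurable borel"
  unfolding normal_density_def by measurable

lemma normal_mixture_density_mixing:
  assumes "w \<in> weight_simplex k"
  shows "normal_mixture_density (mixing k w \<theta>) x = (\<Sum>j=1..k. w j * normal_density (\<theta> j) 1 x)"
  unfolding normal_mixture_density_def
  by (rule integral_mixing[OF assms normal_density_measurable_mean])

lemma normal_mixture_density_measurable_mixing:
  assumes "w \<in> weight_simplex k"
  shows "normal_mixture_density (mixing k w \<theta>) \<in> borel_measurable borel"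
  unfolding normal_mixture_density_mixing[OF assms, abs_def] by measurable

lemma ex_pos_weight:
  assumes "w \<in> weight_simplex k"
  shows "\<exists>j\<in>{1..k}. w j > 0"
proof (rule ccontr)
  assume "\<not> ?thesis"
  then have "(\<Sum>j=1..k. w j) \<le> 0" by (intro sum_nonpos) force
  with assms show False by (simp add: weight_simplex_def)
qed

lemma normal_mixture_density_pos:
  assumes "\<nu> \<in> mixing_dists L"
  shows "normal_mixture_density \<nu> x > 0"
proof -
  obtain k w \<theta> where *: "w \<in> weight_simplex k" "\<nu> = mixing k w \<theta>"
    using assms by (auto elim: mixing_distsE)
  obtain j where "j \<in> {1..k}" "w j > 0" using ex_pos_weight[OF *(1)] by blast
  then show ?thesis
    unfolding *(2) normal_mixture_density_mixing[OF *(1)] using *(1)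
    by (intro sum_pos2[where i=j]) (auto simp: weight_simplex_def intro!: normal_density_pos mult_pos_pos mult_nonneg_nonneg)
qed

lemma normal_density_le_1: "normal_density t 1 x \<le> 1"
proof -
  have "1 \<le> sqrt (2 * pi)" using pi_gt3 by (intro real_le_rsqrt) auto
  then have "1 / sqrt (2 * pi * 1\<^sup>2) \<le> 1" by simp
  moreover have "exp (- (x - t)\<^sup>2 / (2 * 1\<^sup>2)) \<le> 1" by simp
  ultimately show ?thesis unfolding normal_density_def by (intro mult_le_one) auto
qed

lemma normal_mixture_density_le_1:
  assumes "\<nu> \<in> mixing_dists L"
  shows "normal_mixture_density \<nu> x \<le> 1"
proof -
  obtain k w \<theta> where *: "w \<in> weight_simplex k" "\<nu> = mixing k w \<theta>"
    using assms by (auto elim: mixing_distsE)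
  have "(\<Sum>j=1..k. w j * normal_density (\<theta> j) 1 x) \<le> (\<Sum>j=1..k. w j * 1)"
    using *(1) by (intro sum_mono mult_left_mono normal_density_le_1) (auto simp: weight_simplex_def)
  also have "\<dots> = 1" using *(1) by (simp add: weight_simplex_def)
  finally show ?thesis unfolding *(2) normal_mixture_density_mixing[OF *(1)] .
qed

text \<open>Positivity allows division by the likelihood of the truth; the bound by 1 makes the
  likelihood integrable under every prior.\<close>

lemma likelihood_bounds:
  assumes "\<nu> \<in> mixing_dists L"
  shows "likelihood n \<nu> x > 0" "likelihood n \<nu> x \<le> 1"
proof -
  show "likelihood n \<nu> x > 0"
    unfolding likelihood_def using normal_mixture_density_pos[OF assms] by (intro prod_pos) auto
  show "likelihood n \<nu> x \<le> 1"
    unfolding likelihood_def using normal_mixture_density_le_1[OF assms] normal_mixture_density_pos[OF assms]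
    by (intro prod_le_1) (auto intro: less_imp_le)
qed

lemma convolution_eq_density:
  assumes "\<nu> \<in> mixing_dists L"
  shows "convolution \<nu> std_normal = density lborel (\<lambda>x. ennreal (normal_mixture_density \<nu> x))"
  using density_normal_mixture[OF mixing_dists_prob_space[OF assms]] by simp

lemma nn_integral_normal_density: "(\<integral>\<^sup>+x. ennreal (normal_density t 1 x) \<partial>lborel) = 1"
  by (subst nn_integral_eq_integral) (simp_all add: integrable_normal_density integral_normal_density)

lemma prob_space_normal_mixture:
  assumes "\<nu> \<in> mixing_dists L"
  shows "prob_space (convolution \<nu> std_normal)"
proof -
  obtain k w \<theta> where *: "w \<in> weight_simplex k" "\<nu> = mixing k w \<theta>"
    using assms by (auto elim: mixing_distsE)
  have w0: "\<And>j. j \<in> {1..k} \<Longrightarrow> w j \<ge> 0" using *(1) by (auto simp: weight_simplex_def)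
  have "(\<integral>\<^sup>+x. ennreal (normal_mixture_density \<nu> x) \<partial>lborel)
     = (\<integral>\<^sup>+x. (\<Sum>j=1..k. ennreal (w j) * ennreal (normal_density (\<theta> j) 1 x)) \<partial>lborel)"
    unfolding *(2) normal_mixture_density_mixing[OF *(1)]
    using w0 by (intro nn_integral_cong)
      (subst sum_ennreal[symmetric], auto simp: ennreal_mult intro!: mult_nonneg_nonneg)
  also have "\<dots> = (\<Sum>j=1..k. ennreal (w j))"
    by (subst nn_integral_sum) (auto simp: nn_integral_cmult nn_integral_normal_density intro!: sum.cong)
  also have "\<dots> = 1"
    using *(1) w0 by (subst sum_ennreal) (auto simp: weight_simplex_def)
  finally have "emeasure (density lborel (\<lambda>x. ennreal (normal_mixture_density \<nu> x))) UNIV = 1"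
    using normal_mixture_density_measurable_mixing[OF *(1), of \<theta>] by (simp add: emeasure_density *(2))
  then show ?thesis unfolding convolution_eq_density[OF assms] by (auto intro!: prob_spaceI)
qed

lemma integral_normal_mixture:
  fixes g :: "real \<Rightarrow> real"
  assumes w: "w \<in> weight_simplex k" and \<theta>: "\<theta> \<in> cube L k" and k: "k \<ge> 1"
    and [measurable]: "g \<in> borel_measurable borel"
    and B: "\<And>x. \<bar>g x\<bar> \<le> B"
  shows "(\<integral>x. g x \<partial>convolution (mixing k w \<theta>) std_normal) = (\<Sum>j=1..k. w j * (\<integral>x. normal_density (\<theta> j) 1 x * g x \<partial>lborel))"
proof -
  have \<nu>: "mixing k w \<theta> \<in> mixing_dists L" using w \<theta> k by (auto simp: mixing_dists_def mixing_dists_k_def)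
  have int: "integrable lborel (\<lambda>x. normal_density t 1 x * g x)" for t
    by (rule Bochner_Integration.integrable_bound[where f = "\<lambda>x. B * normal_density t 1 x"])
       (use B in \<open>auto simp: abs_mult mult.commute[of B] intro!: mult_left_mono order_trans[OF B] integrable_normal_density\<close>)
  note [measurable] = normal_mixture_density_measurable_mixing[OF w, of \<theta>]
  have "(\<integral>x. g x \<partial>convolution (mixing k w \<theta>) std_normal) =
      (\<integral>x. normal_mixture_density (mixing k w \<theta>) x * g x \<partial>lborel)"
    unfolding convolution_eq_density[OF \<nu>]
    using normal_mixture_density_pos[OF \<nu>] by (subst integral_density) (auto intro!: less_imp_le)
  also have "\<dots> = (\<integral>x. (\<Sum>j=1..k. w j * (normal_density (\<theta> j) 1 x * g x)) \<partial>lborel)"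
    by (simp only: normal_mixture_density_mixing[OF w] sum_distrib_right mult.assoc)
  also have "\<dots> = (\<Sum>j=1..k. w j * (\<integral>x. normal_density (\<theta> j) 1 x * g x \<partial>lborel))"
    by (subst Bochner_Integration.integral_sum) (auto intro: int)
  finally show ?thesis .
qed

section \<open>Characteristic functions of normal mixtures\<close>

lemma integral_std_normal_cos_sin:
  "(\<integral>x. std_normal_density x * cos (s * x) \<partial>lborel) = exp (- s\<^sup>2 / 2)"
  "(\<integral>x. std_normal_density x * sin (s * x) \<partial>lborel) = 0"
proof -
  have c: "(\<integral>x. iexp (s * x) \<partial>density lborel std_normal_density) = complex_of_real (exp (- s\<^sup>2 / 2))"
    using fun_cong[OF char_std_normal_distribution, of s] by (simp add: char_def)
  interpret N: prob_space "density lborel std_normal_density"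
    by (rule prob_space_normal_density) simp
  have int: "complex_integrable (density lborel std_normal_density) (\<lambda>x. iexp (s * x))"
    by (intro N.integrable_const_bound[where B=1]) auto
  have "(\<integral>x. Re (iexp (s * x)) \<partial>density lborel std_normal_density) = exp (- s\<^sup>2 / 2)"
    using integral_Re[OF int] c by simp
  then show "(\<integral>x. std_normal_density x * cos (s * x) \<partial>lborel) = exp (- s\<^sup>2 / 2)"
    by (subst (asm) integral_density) (auto simp: Re_exp)
  have "(\<integral>x. Im (iexp (s * x)) \<partial>density lborel std_normal_density) = 0"
    using integral_Im[OF int] c by simp
  then show "(\<integral>x. std_normal_density x * sin (s * x) \<partial>lborel) = 0"
    by (subst (asm) integral_density) (auto simp: Im_exp)
qed

lemma integral_normal_cos_sin:
  "(\<integral>x. normal_density t 1 x * cos (s * x) \<partial>lborel) = exp (- s\<^sup>2 / 2) * cos (s * t)"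
  "(\<integral>x. normal_density t 1 x * sin (s * x) \<partial>lborel) = exp (- s\<^sup>2 / 2) * sin (s * t)"
proof -
  have shift: "(\<integral>x. normal_density t 1 x * g x \<partial>lborel) = (\<integral>x. std_normal_density x * g (t + x) \<partial>lborel)" for g :: "real \<Rightarrow> real"
    by (subst lborel_integral_real_affine[where c=1 and t=t]) (auto simp: normal_density_def)
  have int: "integrable lborel (\<lambda>x. std_normal_density x * g x)" if "g \<in> borel_measurable borel" "\<And>x. \<bar>g x\<bar> \<le> 1" for g :: "real \<Rightarrow> real"
    by (rule Bochner_Integration.integrable_bound[where f = "std_normal_density"])
       (use that in \<open>auto simp: abs_mult intro!: mult_left_le\<close>)
  have i: "integrable lborel (\<lambda>x. std_normal_density x * cos (s * x))" "integrable lborel (\<lambda>x. std_normal_density x * sin (s * x))"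
    by (auto intro!: int)
  have "(\<integral>x. normal_density t 1 x * cos (s * x) \<partial>lborel) =
    (\<integral>x. cos (s * t) * (std_normal_density x * cos (s * x)) - sin (s * t) * (std_normal_density x * sin (s * x)) \<partial>lborel)"
    unfolding shift by (intro Bochner_Integration.integral_cong) (auto simp: distrib_left cos_add algebra_simps)
  then show "(\<integral>x. normal_density t 1 x * cos (s * x) \<partial>lborel) = exp (- s\<^sup>2 / 2) * cos (s * t)"
    using i by (simp add: integral_std_normal_cos_sin)
  have "(\<integral>x. normal_density t 1 x * sin (s * x) \<partial>lborel) =
    (\<integral>x. sin (s * t) * (std_normal_density x * cos (s * x)) + cos (s * t) * (std_normal_density x * sin (s * x)) \<partial>lborel)"
    unfolding shift by (intro Bochner_Integration.integral_cong) (auto simp: distrib_left sin_add algebra_simps)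
  then show "(\<integral>x. normal_density t 1 x * sin (s * x) \<partial>lborel) = exp (- s\<^sup>2 / 2) * sin (s * t)"
    using i by (simp add: integral_std_normal_cos_sin)
qed

lemma integral_normal_mixture_cos_sin:
  assumes "\<nu> \<in> mixing_dists L"
  shows "(\<integral>x. cos (s * x) \<partial>convolution \<nu> std_normal) = exp (- s\<^sup>2 / 2) * (\<integral>t. cos (s * t) \<partial>\<nu>)"
    "(\<integral>x. sin (s * x) \<partial>convolution \<nu> std_normal) = exp (- s\<^sup>2 / 2) * (\<integral>t. sin (s * t) \<partial>\<nu>)"
proof -
  obtain k w \<theta> where *: "k \<ge> 1" "w \<in> weight_simplex k" "\<theta> \<in> cube L k" and \<nu>: "\<nu> = mixing k w \<theta>"
    using assms by (auto elim: mixing_distsE)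
  show "(\<integral>x. cos (s * x) \<partial>convolution \<nu> std_normal) = exp (- s\<^sup>2 / 2) * (\<integral>t. cos (s * t) \<partial>\<nu>)"
    unfolding \<nu> by (subst integral_normal_mixture[OF *(2,3,1), where B=1])
      (auto simp: integral_normal_cos_sin integral_mixing[OF *(2)] sum_distrib_left mult.left_commute)
  show "(\<integral>x. sin (s * x) \<partial>convolution \<nu> std_normal) = exp (- s\<^sup>2 / 2) * (\<integral>t. sin (s * t) \<partial>\<nu>)"
    unfolding \<nu> by (subst integral_normal_mixture[OF *(2,3,1), where B=1])
      (auto simp: integral_normal_cos_sin integral_mixing[OF *(2)] sum_distrib_left mult.left_commute)
qed

section \<open>Product densities and concentration of i.i.d. samples\<close>

lemma iid_sample_eq_density:
  assumes \<nu>: "\<nu> \<in> mixing_dists L"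
  shows "iid_sample n (convolution \<nu> std_normal) =
    density (PiM {1..n} (\<lambda>_. lborel)) (\<lambda>x. ennreal (likelihood n \<nu> x))"
proof -
  let ?p = "normal_mixture_density \<nu>"
  interpret C: prob_space "convolution \<nu> std_normal" by (rule prob_space_normal_mixture[OF \<nu>])
  interpret P: product_sigma_finite "\<lambda>_::nat. convolution \<nu> std_normal" by unfold_locales
  interpret B: product_sigma_finite "\<lambda>_::nat. lborel :: real measure" by unfold_locales
  obtain k w \<theta> where *: "w \<in> weight_simplex k" "\<nu> = mixing k w \<theta>"
    using \<nu> by (auto elim: mixing_distsE)
  have [measurable]: "?p \<in> borel_measurable borel"
    unfolding *(2) by (rule normal_mixture_density_measurable_mixing[OF *(1)])
  have p0: "?p x \<ge> 0" for x using normal_mixture_density_pos[OF \<nu>] by (simp add: less_imp_le)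
  have [measurable]: "likelihood n \<nu> \<in> borel_measurable (PiM {1..n} (\<lambda>_. lborel))"
    unfolding likelihood_def[abs_def] by measurable
  show ?thesis
    unfolding iid_sample_def
  proof (rule P.PiM_eqI[symmetric])
    show "sets (density (PiM {1..n} (\<lambda>_. lborel)) (\<lambda>x. ennreal (likelihood n \<nu> x))) =
        sets (PiM {1..n} (\<lambda>_. convolution \<nu> std_normal))"
      by (simp cong: sets_PiM_cong)
    fix A :: "nat \<Rightarrow> real set" assume A: "\<And>i. i \<in> {1..n} \<Longrightarrow> A i \<in> sets (convolution \<nu> std_normal)"
    then have [measurable]: "\<And>i. i \<in> {1..n} \<Longrightarrow> A i \<in> sets borel" by simp
    have "Pi\<^sub>E {1..n} A \<in> sets (PiM {1..n} (\<lambda>_. lborel :: real measure))"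
      using A by (intro sets_PiM_I_finite) auto
    then have "emeasure (density (PiM {1..n} (\<lambda>_. lborel)) (\<lambda>x. ennreal (likelihood n \<nu> x))) (Pi\<^sub>E {1..n} A) =
        (\<integral>\<^sup>+x. ennreal (likelihood n \<nu> x) * indicator (Pi\<^sub>E {1..n} A) x \<partial>PiM {1..n} (\<lambda>_. lborel))"
      by (intro emeasure_density) measurable
    also have "\<dots> = (\<integral>\<^sup>+x. (\<Prod>i=1..n. ennreal (?p (x i)) * indicator (A i) (x i)) \<partial>PiM {1..n} (\<lambda>_. lborel))"
    proof (rule nn_integral_cong)
      fix x :: "nat \<Rightarrow> real" assume "x \<in> space (PiM {1..n} (\<lambda>_. lborel))"
      then have "indicator (Pi\<^sub>E {1..n} A) x = (\<Prod>i=1..n. indicator (A i) (x i) :: ennreal)"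
        by (auto simp: indicator_def space_PiM PiE_iff prod.neutral)
      then show "ennreal (likelihood n \<nu> x) * indicator (Pi\<^sub>E {1..n} A) x = (\<Prod>i=1..n. ennreal (?p (x i)) * indicator (A i) (x i))"
        by (simp add: likelihood_def prod.distrib prod_ennreal p0)
    qed
    also have "\<dots> = (\<Prod>i=1..n. \<integral>\<^sup>+y. ennreal (?p y) * indicator (A i) y \<partial>lborel)"
      by (rule B.product_nn_integral_prod) auto
    also have "\<dots> = (\<Prod>i=1..n. emeasure (convolution \<nu> std_normal) (A i))"
      unfolding convolution_eq_density[OF \<nu>] by (intro prod.cong refl emeasure_density[symmetric]) auto
    finally show "emeasure (density (PiM {1..n} (\<lambda>_. lborel)) (\<lambda>x. ennreal (likelihood n \<nu> x))) (Pi\<^sub>E {1..n} A) =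
        (\<Prod>i=1..n. emeasure (convolution \<nu> std_normal) (A i))" .
  qed simp
qed

lemma iid_sample_Hoeffding:
  fixes g :: "real \<Rightarrow> real"
  assumes G: "prob_space G" "sets G = sets borel" and n: "n \<ge> 1" and \<delta>: "\<delta> \<ge> 0"
    and g: "g \<in> borel_measurable borel" "\<And>x. \<bar>g x\<bar> \<le> 1"
  shows "measure (iid_sample n G) {x \<in> space (iid_sample n G). \<bar>(\<Sum>i=1..n. g (x i)) / n - (\<integral>y. g y \<partial>G)\<bar> \<ge> \<delta>}
    \<le> 2 * exp (- real n * \<delta>\<^sup>2 / 2)"
proof -
  note [measurable_cong] = G(2)
  note [measurable] = g(1)
  interpret G: prob_space G by fact
  let ?M = "iid_sample n G"
  interpret product_prob_space "\<lambda>_::nat. G" "{1..n}" by unfold_locales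
  interpret M: prob_space ?M unfolding iid_sample_def by unfold_locales
  have comp: "distr ?M G (\<lambda>x. x i) = G" if "i \<in> {1..n}" for i
    unfolding iid_sample_def using that by (intro distr_PiM_component) (auto simp: G.prob_space_axioms)
  have m[measurable]: "(\<lambda>x. x i) \<in> ?M \<rightarrow>\<^sub>M G" if "i \<in> {1..n}" for i
    unfolding iid_sample_def using that by measurable
  have "M.indep_vars (\<lambda>_. G) (\<lambda>i x. x i) {1..n}"
  proof (subst M.indep_vars_iff_distr_eq_PiM')
    show "distr ?M (PiM {1..n} (\<lambda>_. G)) (\<lambda>x. \<lambda>i\<in>{1..n}. x i) = PiM {1..n} (\<lambda>i. distr ?M G (\<lambda>x. x i))"
    proof -
      have "distr ?M (PiM {1..n} (\<lambda>_. G)) (\<lambda>x. \<lambda>i\<in>{1..n}. x i) = distr ?M (PiM {1..n} (\<lambda>_. G)) (\<lambda>x. x)"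
        by (intro distr_cong) (auto simp: iid_sample_def space_PiM PiE_iff extensional_def restrict_def)
      also have "\<dots> = ?M" unfolding iid_sample_def by (rule distr_id)
      also have "\<dots> = PiM {1..n} (\<lambda>i. distr ?M G (\<lambda>x. x i))"
        unfolding iid_sample_def[of n G] by (rule PiM_cong) (simp_all add: comp[unfolded iid_sample_def] del: One_nat_def)
      finally show ?thesis .
    qed
  qed (use n m in auto)
  then have indep: "M.indep_vars (\<lambda>_. borel) (\<lambda>i x. g (x i)) {1..n}"
    by (rule M.indep_vars_compose2) auto
  interpret H: Hoeffding_ineq ?M "{1..n}" "\<lambda>i x. g (x i)" "\<lambda>_. -1" "\<lambda>_. 1" "\<Sum>i=1..n. M.expectation (\<lambda>x. g (x i))"
    by unfold_locales (use indep g(2) in \<open>auto simp: abs_le_iff minus_le_iff\<close>)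
  have E: "M.expectation (\<lambda>x. g (x i)) = (\<integral>y. g y \<partial>G)" if "i \<in> {1..n}" for i
  proof -
    have "(\<integral>y. g y \<partial>G) = (\<integral>y. g y \<partial>distr ?M G (\<lambda>x. x i))" using comp[OF that] by simp
    also have "\<dots> = M.expectation (\<lambda>x. g (x i))" using m[OF that] by (intro integral_distr) auto
    finally show ?thesis by simp
  qed
  have S: "(\<Sum>i=1..n. M.expectation (\<lambda>x. g (x i))) = n * (\<integral>y. g y \<partial>G)"
    using E by simp
  have "\<bar>(\<Sum>i=1..n. g (x i)) / n - (\<integral>y. g y \<partial>G)\<bar> \<ge> \<delta> \<longleftrightarrow>
     \<bar>(\<Sum>i=1..n. g (x i)) - (\<Sum>i=1..n. M.expectation (\<lambda>x. g (x i)))\<bar> \<ge> n * \<delta>" for x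
  proof -
    have "(\<Sum>i=1..n. g (x i)) - (\<Sum>i=1..n. M.expectation (\<lambda>x. g (x i))) = n * ((\<Sum>i=1..n. g (x i)) / n - (\<integral>y. g y \<partial>G))"
      unfolding S using n by (simp add: field_simps)
    then show ?thesis using n by (simp add: abs_mult)
  qed
  then have "measure ?M {x \<in> space ?M. \<bar>(\<Sum>i=1..n. g (x i)) / n - (\<integral>y. g y \<partial>G)\<bar> \<ge> \<delta>} \<le>
     2 * exp (- 2 * (n * \<delta>)\<^sup>2 / (\<Sum>i\<in>{1..n}. (1 - (-1))\<^sup>2))"
    using H.Hoeffding_ineq_abs_ge[of "n * \<delta>"] n \<delta> by simp
  also have "- 2 * (n * \<delta>)\<^sup>2 / (\<Sum>i\<in>{1..n}. (1 - (-1))\<^sup>2) = - real n * \<delta>\<^sup>2 / 2"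
    using n by (simp add: power2_eq_square field_simps)
  finally show ?thesis .
qed

section \<open>Posterior bound from a test and an evidence lower bound\<close>

lemma space_mixing_space: "space (mixing_space L) = mixing_dists L"
  using mixing_dists_prob_space
  by (auto simp: mixing_space_def space_restrict_space space_prob_algebra)

lemma measurable_id_mixing_space: "(\<lambda>\<nu>. \<nu>) \<in> mixing_space L \<rightarrow>\<^sub>M subprob_algebra borel"
  unfolding mixing_space_def
  by (intro measurable_restrict_space1 measurable_prob_algebraD measurable_ident_sets refl)

lemma measurable_integral_mixing_space:
  fixes f :: "real \<Rightarrow> real"
  assumes "f \<in> borel_measurable borel"
  shows "(\<lambda>\<nu>. \<integral>t. f t \<partial>\<nu>) \<in> borel_measurable (mixing_space L)"
  by (rule measurable_compose[OF measurable_id_mixing_space integral_measurable_subprob_algebra[OF assms]])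

lemma measurable_normal_mixture_density:
  "(\<lambda>(\<nu>, x). normal_mixture_density \<nu> x) \<in> borel_measurable (mixing_space L \<Otimes>\<^sub>M borel)"
proof -
  have [measurable]: "(\<lambda>z :: real measure \<times> real. fst z) \<in> mixing_space L \<Otimes>\<^sub>M borel \<rightarrow>\<^sub>M subprob_algebra borel"
    by (rule measurable_compose[OF measurable_fst measurable_id_mixing_space])
  have "(\<lambda>(z :: real measure \<times> real, t). ennreal (normal_density t 1 (snd z))) \<in> borel_measurable ((mixing_space L \<Otimes>\<^sub>M borel) \<Otimes>\<^sub>M borel)"
    unfolding normal_density_def by measurable
  then have "(\<lambda>z :: real measure \<times> real. \<integral>\<^sup>+t. ennreal (normal_density t 1 (snd z)) \<partial>fst z) \<in> borel_measurable (mixing_space L \<Otimes>\<^sub>M borel)"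
    by (rule nn_integral_measurable_subprob_algebra2) measurable
  then have "(\<lambda>z :: real measure \<times> real. enn2real (\<integral>\<^sup>+t. ennreal (normal_density t 1 (snd z)) \<partial>fst z)) \<in> borel_measurable (mixing_space L \<Otimes>\<^sub>M borel)"
    by measurable
  also have "?this \<longleftrightarrow> ?thesis"
  proof (rule measurable_cong)
    fix z :: "real measure \<times> real" assume "z \<in> space (mixing_space L \<Otimes>\<^sub>M borel)"
    then have "sets (fst z) = sets borel"
      by (auto simp: space_pair_measure space_mixing_space mixing_dists_prob_space)
    then have "(\<lambda>t. normal_density t 1 (snd z)) \<in> borel_measurable (fst z)"
      using normal_density_measurable_mean by (simp cong: measurable_cong_sets)
    then show "enn2real (\<integral>\<^sup>+t. ennreal (normal_density t 1 (snd z)) \<partial>fst z) = (case z of (\<nu>, x) \<Rightarrow> normal_mixture_density \<nu> x)"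
      by (cases z) (simp add: normal_mixture_density_def integral_eq_nn_integral)
  qed
  finally show ?thesis .
qed

lemma measurable_likelihood:
  "(\<lambda>(\<nu>, x). likelihood n \<nu> x) \<in> borel_measurable (mixing_space L \<Otimes>\<^sub>M PiM {1..n} (\<lambda>_. lborel))"
proof -
  have "(\<lambda>z. normal_mixture_density (fst z) (snd z i)) \<in> borel_measurable (mixing_space L \<Otimes>\<^sub>M PiM {1..n} (\<lambda>_. lborel))"
    if "i \<in> {1..n}" for i
  proof -
    have "(\<lambda>z. (fst z, snd z i)) \<in> mixing_space L \<Otimes>\<^sub>M PiM {1..n} (\<lambda>_. lborel) \<rightarrow>\<^sub>M mixing_space L \<Otimes>\<^sub>M borel"
      using that by measurable
    from measurable_compose[OF this measurable_normal_mixture_density] show ?thesis by simp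
  qed
  then show ?thesis
    unfolding likelihood_def case_prod_beta by (intro borel_measurable_prod)
qed

lemma ennreal_measure_le_emeasure: "ennreal (measure M A) \<le> emeasure M A"
  by (cases "emeasure M A = \<top>") (simp_all add: measure_def less_top)

text \<open>Outside \<open>A\<close> and \<open>G\<close> the posterior mass is bounded by 1. On
  their intersection the denominator is at least \<open>c\<close> times the likelihood of \<nu>0;
  integrating the resulting likelihood ratio under \<nu>0 and exchanging integrals leaves the
  average of the error probabilities of \<open>A\<close> over \<open>V\<close>. The event
  \<open>V'\<close> enters only through the measurable \<open>V\<close>, since the set defined by
  \<open>W1\<close> is not shown to be measurable.\<close>

lemma posterior_bound:
  assumes \<nu>0: "\<nu>0 \<in> mixing_dists L"
    and Q: "prob_space Q" "sets Q = sets (mixing_space L)"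
    and A: "A \<in> sets (PiM {1..n} (\<lambda>_. lborel))" and G: "G \<in> sets (PiM {1..n} (\<lambda>_. lborel))"
    and c: "c > 0" and evid: "\<And>x. x \<in> G \<Longrightarrow> c * likelihood n \<nu>0 x \<le> (\<integral>\<nu>. likelihood n \<nu> x \<partial>Q)"
    and V: "V \<in> sets (mixing_space L)"
    and test: "\<And>\<nu>. \<nu> \<in> V \<Longrightarrow> measure (iid_sample n (convolution \<nu> std_normal)) A \<le> \<beta>"
    and V': "V' \<subseteq> V" and \<beta>: "\<beta> \<ge> 0"
  shows "(\<integral>x. measure (posterior n Q x) V' \<partial>iid_sample n (convolution \<nu>0 std_normal))
    \<le> measure (iid_sample n (convolution \<nu>0 std_normal)) (space (PiM {1..n} (\<lambda>_. lborel)) - A)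
      + measure (iid_sample n (convolution \<nu>0 std_normal)) (space (PiM {1..n} (\<lambda>_. lborel)) - G) + \<beta> / c"
    (is "_ \<le> ?a + ?g + _")
proof -
  let ?\<Lambda> = "PiM {1..n} (\<lambda>_. lborel :: real measure)"
  let ?P = "\<lambda>\<nu>. iid_sample n (convolution \<nu> std_normal)"
  interpret Q: prob_space Q by fact
  interpret B: product_sigma_finite "\<lambda>_::nat. lborel :: real measure" by unfold_locales
  interpret \<Lambda>: sigma_finite_measure ?\<Lambda> by (rule B.sigma_finite) simp
  interpret Q\<Lambda>: pair_sigma_finite Q ?\<Lambda> by unfold_locales
  have spQ: "space Q = mixing_dists L" using sets_eq_imp_space_eq[OF Q(2)] by (simp add: space_mixing_space)
  note [measurable_cong] = Q(2)
  note [measurable] = A G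
  have [measurable]: "V \<in> sets Q" using V Q(2) by simp
  note lm = measurable_likelihood[of n L]
  have [measurable]: "(\<lambda>z. likelihood n (fst z) (snd z)) \<in> borel_measurable (Q \<Otimes>\<^sub>M ?\<Lambda>)"
    using lm by (simp add: case_prod_beta)
  have likx[measurable]: "(\<lambda>\<nu>. likelihood n \<nu> x) \<in> borel_measurable Q" if "x \<in> space ?\<Lambda>" for x
    using measurable_compose[OF measurable_Pair2'[OF that] lm] by (simp cong: measurable_cong_sets add: Q(2))
  have lik\<nu>[measurable]: "likelihood n \<nu> \<in> borel_measurable ?\<Lambda>" if "\<nu> \<in> mixing_dists L" for \<nu>
    using measurable_compose[OF measurable_Pair1' lm, of \<nu>] that by (simp add: space_mixing_space)
  have spP: "space (?P \<nu>) = space ?\<Lambda>" "sets (?P \<nu>) = sets ?\<Lambda>" if "\<nu> \<in> mixing_dists L" for \<nu>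
    using that by (simp_all add: iid_sample_eq_density)
  have probP: "prob_space (?P \<nu>)" if "\<nu> \<in> mixing_dists L" for \<nu>
    unfolding iid_sample_def by (intro prob_space_PiM prob_space_normal_mixture[OF that])
  interpret P0: prob_space "?P \<nu>0" by (rule probP[OF \<nu>0])
  define r where "r x = (\<integral>\<^sup>+\<nu>. ennreal (likelihood n \<nu> x) * indicator V \<nu> \<partial>Q)" for x
  have [measurable]: "r \<in> borel_measurable ?\<Lambda>"
  proof -
    have "(\<lambda>(x, \<nu>). ennreal (likelihood n \<nu> x) * indicator V \<nu>) \<in> borel_measurable (?\<Lambda> \<Otimes>\<^sub>M Q)"
      using lm by (subst measurable_pair_swap_iff) (simp add: case_prod_beta, measurable)
    then show ?thesis unfolding r_def by (rule Q.borel_measurable_nn_integral)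
  qed
  have intlik: "integrable Q (\<lambda>\<nu>. likelihood n \<nu> x)" if "x \<in> space ?\<Lambda>" for x
  proof (rule Q.integrable_const_bound[where B=1])
    show "AE \<nu> in Q. norm (likelihood n \<nu> x) \<le> 1"
    proof (rule AE_I2)
      fix \<nu> assume "\<nu> \<in> space Q"
      then show "norm (likelihood n \<nu> x) \<le> 1"
        using likelihood_bounds[of \<nu> L n x] by (simp add: spQ)
    qed
  qed (rule likx[OF that])
  have lik0: "0 \<le> likelihood n \<nu> x" if "\<nu> \<in> space Q" for \<nu> x
    using likelihood_bounds(1)[of \<nu> L n x] that by (simp add: spQ)
  note [measurable] = lik\<nu>[OF \<nu>0]
  \<comment> \<open>Only an inequality is claimed: the total mass is \<open>?Z / ?Z\<close>, which
    would be 0 for \<open>?Z = 0\<close>, and this bound is needed at points where no evidence bound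
    is available.\<close>
  have post1: "measure (posterior n Q x) S \<le> 1" if x: "x \<in> space ?\<Lambda>" for x S
  proof -
    let ?Z = "\<integral>\<nu>'. likelihood n \<nu>' x \<partial>Q"
    have "emeasure (posterior n Q x) S \<le> emeasure (posterior n Q x) (space (posterior n Q x))"
      by (rule emeasure_space)
    also have "\<dots> = (\<integral>\<^sup>+\<nu>. ennreal (likelihood n \<nu> x / ?Z) \<partial>Q)"
      unfolding posterior_def using likx[OF x]
      by (simp add: emeasure_density cong: nn_integral_cong)
    also have "\<dots> = ennreal (\<integral>\<nu>. likelihood n \<nu> x / ?Z \<partial>Q)"
      using intlik[OF x] lik0
      by (intro nn_integral_eq_integral) (auto intro!: AE_I2 divide_nonneg_nonneg integral_nonneg_AE)
    also have "\<dots> \<le> ennreal 1" by (rule ennreal_leI) simp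
    finally have "emeasure (posterior n Q x) S \<le> 1" by simp
    then show ?thesis unfolding measure_def by (metis enn2real_1 enn2real_mono ennreal_one_less_top)
  qed
  have pt: "ennreal (measure (posterior n Q x) V') \<le>
      indicator (space ?\<Lambda> - A) x + indicator (space ?\<Lambda> - G) x + indicator A x * (ennreal (1 / (c * likelihood n \<nu>0 x)) * r x)"
    if x: "x \<in> space ?\<Lambda>" for x
  proof (cases "x \<in> A \<and> x \<in> G")
    case False
    have "ennreal (measure (posterior n Q x) V') \<le> 1"
      using post1[OF x, of V'] by simp
    also have "\<dots> \<le> indicator (space ?\<Lambda> - A) x + indicator (space ?\<Lambda> - G) x"
      using False x by (auto simp: indicator_def)
    finally show ?thesis by (rule order_trans) simp
  next
    case True
    let ?Z = "\<integral>\<nu>'. likelihood n \<nu>' x \<partial>Q"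
    have l0: "c * likelihood n \<nu>0 x > 0" using c likelihood_bounds[OF \<nu>0] by simp
    have Z: "c * likelihood n \<nu>0 x \<le> ?Z" using True by (intro evid) auto
    have "ennreal (measure (posterior n Q x) V') \<le> emeasure (posterior n Q x) V'"
      by (rule ennreal_measure_le_emeasure)
    also have "\<dots> \<le> emeasure (posterior n Q x) V"
      using V' by (intro emeasure_mono) (auto simp: posterior_def)
    also have "\<dots> = (\<integral>\<^sup>+\<nu>. ennreal (likelihood n \<nu> x / ?Z) * indicator V \<nu> \<partial>Q)"
      unfolding posterior_def using likx[OF x] by (intro emeasure_density) auto
    also have "\<dots> \<le> (\<integral>\<^sup>+\<nu>. ennreal (1 / (c * likelihood n \<nu>0 x)) * (ennreal (likelihood n \<nu> x) * indicator V \<nu>) \<partial>Q)"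
    proof (rule nn_integral_mono)
      fix \<nu> assume "\<nu> \<in> space Q"
      then have "likelihood n \<nu> x > 0" by (intro likelihood_bounds) (simp add: spQ)
      then have "ennreal (likelihood n \<nu> x / ?Z) \<le> ennreal (1 / (c * likelihood n \<nu>0 x)) * ennreal (likelihood n \<nu> x)"
        using l0 Z by (subst ennreal_mult[symmetric]) (auto intro!: ennreal_leI divide_left_mono mult_pos_pos)
      then show "ennreal (likelihood n \<nu> x / ?Z) * indicator V \<nu> \<le> ennreal (1 / (c * likelihood n \<nu>0 x)) * (ennreal (likelihood n \<nu> x) * indicator V \<nu>)"
        unfolding mult.assoc[symmetric] by (rule mult_right_mono) simp
    qed
    also have "\<dots> = ennreal (1 / (c * likelihood n \<nu>0 x)) * r x"
      unfolding r_def using likx[OF x] by (intro nn_integral_cmult) auto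
    finally show ?thesis using True x by (simp add: indicator_def)
  qed
  \<comment> \<open>The likelihood of \<nu>0, as the density of the sampling law, cancels the one in
    the denominator, leaving a double integral to which Tonelli's theorem applies.\<close>
  have third: "(\<integral>\<^sup>+x. indicator A x * (ennreal (1 / (c * likelihood n \<nu>0 x)) * r x) \<partial>?P \<nu>0) \<le> ennreal (\<beta> / c)"
  proof -
    have "(\<integral>\<^sup>+x. indicator A x * (ennreal (1 / (c * likelihood n \<nu>0 x)) * r x) \<partial>?P \<nu>0)
      = (\<integral>\<^sup>+x. ennreal (likelihood n \<nu>0 x) * (indicator A x * (ennreal (1 / (c * likelihood n \<nu>0 x)) * r x)) \<partial>?\<Lambda>)"
      unfolding iid_sample_eq_density[OF \<nu>0] by (intro nn_integral_density) measurable
    also have "\<dots> = (\<integral>\<^sup>+x. \<integral>\<^sup>+\<nu>. ennreal (1 / c) * (indicator V \<nu> * (ennreal (likelihood n \<nu> x) * indicator A x)) \<partial>Q \<partial>?\<Lambda>)"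
    proof (rule nn_integral_cong)
      fix x assume x: "x \<in> space ?\<Lambda>"
      have l0: "likelihood n \<nu>0 x > 0" by (rule likelihood_bounds[OF \<nu>0])
      have "ennreal (likelihood n \<nu>0 x) * ennreal (1 / (c * likelihood n \<nu>0 x)) = ennreal (1 / c)"
        using l0 c by (subst ennreal_mult[symmetric]) auto
      then have "ennreal (likelihood n \<nu>0 x) * (indicator A x * (ennreal (1 / (c * likelihood n \<nu>0 x)) * r x))
        = (ennreal (1 / c) * indicator A x) * r x"
        by (metis (no_types, opaque_lifting) mult.assoc mult.left_commute)
      also have "\<dots> = (\<integral>\<^sup>+\<nu>. (ennreal (1 / c) * indicator A x) * (ennreal (likelihood n \<nu> x) * indicator V \<nu>) \<partial>Q)"
        unfolding r_def using likx[OF x] by (intro nn_integral_cmult[symmetric]) auto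
      finally show "ennreal (likelihood n \<nu>0 x) * (indicator A x * (ennreal (1 / (c * likelihood n \<nu>0 x)) * r x)) =
        (\<integral>\<^sup>+\<nu>. ennreal (1 / c) * (indicator V \<nu> * (ennreal (likelihood n \<nu> x) * indicator A x)) \<partial>Q)"
        by (simp add: mult_ac)
    qed
    also have "\<dots> = (\<integral>\<^sup>+\<nu>. \<integral>\<^sup>+x. ennreal (1 / c) * (indicator V \<nu> * (ennreal (likelihood n \<nu> x) * indicator A x)) \<partial>?\<Lambda> \<partial>Q)"
      by (rule Q\<Lambda>.Fubini', unfold case_prod_beta) measurable
    also have "\<dots> \<le> (\<integral>\<^sup>+\<nu>. ennreal (\<beta> / c) \<partial>Q)"
    proof (rule nn_integral_mono)
      fix \<nu> assume "\<nu> \<in> space Q"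
      then have \<nu>: "\<nu> \<in> mixing_dists L" by (simp add: spQ)
      note [measurable] = lik\<nu>[OF \<nu>]
      interpret P: prob_space "?P \<nu>" by (rule probP[OF \<nu>])
      have "(\<integral>\<^sup>+x. ennreal (1 / c) * (indicator V \<nu> * (ennreal (likelihood n \<nu> x) * indicator A x)) \<partial>?\<Lambda>)
        = ennreal (1 / c) * (indicator V \<nu> * (\<integral>\<^sup>+x. ennreal (likelihood n \<nu> x) * indicator A x \<partial>?\<Lambda>))"
        by (simp add: nn_integral_cmult del: One_nat_def)
      also have "(\<integral>\<^sup>+x. ennreal (likelihood n \<nu> x) * indicator A x \<partial>?\<Lambda>) = emeasure (?P \<nu>) A"
        unfolding iid_sample_eq_density[OF \<nu>] by (intro emeasure_density[symmetric]) measurable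
      also have "\<dots> = ennreal (measure (?P \<nu>) A)" by (rule P.emeasure_eq_measure)
      also have "ennreal (1 / c) * (indicator V \<nu> * ennreal (measure (?P \<nu>) A)) \<le> ennreal (1 / c) * ennreal \<beta>"
        using test[of \<nu>] by (intro mult_left_mono) (auto simp: indicator_def intro!: ennreal_leI)
      also have "ennreal (1 / c) * ennreal \<beta> = ennreal (\<beta> / c)"
        using c \<beta> by (subst ennreal_mult[symmetric]) auto
      finally show "(\<integral>\<^sup>+x. ennreal (1 / c) * (indicator V \<nu> * (ennreal (likelihood n \<nu> x) * indicator A x)) \<partial>?\<Lambda>) \<le> ennreal (\<beta> / c)"
        by (simp add: mult_left_mono)
    qed
    also have "\<dots> = ennreal (\<beta> / c)" by (simp add: Q.emeasure_space_1)
    finally show ?thesis .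
  qed
  have "(\<integral>\<^sup>+x. ennreal (measure (posterior n Q x) V') \<partial>?P \<nu>0) \<le>
    (\<integral>\<^sup>+x. indicator (space ?\<Lambda> - A) x + indicator (space ?\<Lambda> - G) x + indicator A x * (ennreal (1 / (c * likelihood n \<nu>0 x)) * r x) \<partial>?P \<nu>0)"
    by (rule nn_integral_mono) (use pt spP[OF \<nu>0] in auto)
  also have "\<dots> = emeasure (?P \<nu>0) (space ?\<Lambda> - A) + emeasure (?P \<nu>0) (space ?\<Lambda> - G)
     + (\<integral>\<^sup>+x. indicator A x * (ennreal (1 / (c * likelihood n \<nu>0 x)) * r x) \<partial>?P \<nu>0)"
  proof -
    have m: "(\<lambda>x. indicator A x * (ennreal (1 / (c * likelihood n \<nu>0 x)) * r x)) \<in> borel_measurable (?P \<nu>0)"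
      unfolding measurable_cong_sets[OF spP(2)[OF \<nu>0] refl] by measurable
    have "space ?\<Lambda> - A \<in> sets (?P \<nu>0)" "space ?\<Lambda> - G \<in> sets (?P \<nu>0)"
      unfolding spP(2)[OF \<nu>0] by measurable
    then show ?thesis using m by (simp add: nn_integral_add del: One_nat_def)
  qed
  also have "\<dots> \<le> ennreal ?a + ennreal ?g + ennreal (\<beta> / c)"
    unfolding P0.emeasure_eq_measure by (intro add_mono order_refl third)
  also have "\<dots> = ennreal (?a + ?g + \<beta> / c)"
    using \<beta> c by simp
  \<comment> \<open>The posterior mass of \<open>V'\<close> is not shown to be measurable in
    \<open>x\<close>. \<open>integral_real_bounded\<close> also covers the nonintegrable case, in
    which the Bochner integral is 0.\<close>
  finally show ?thesis
    using \<beta> c by (intro integral_real_bounded) auto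
qed

section \<open>Approximating a mixing distribution by one with few atoms\<close>

text \<open>A homogeneous linear system with more unknowns than equations, solved by elimination: an
  element \<open>s0\<close> with nonzero coefficient in the last equation expresses the unknown at
  \<open>s0\<close> by the others.\<close>

lemma ex_null_combination:
  fixes f :: "nat \<Rightarrow> 'a \<Rightarrow> real"
  assumes "finite S" "m < card S"
  shows "\<exists>v. (\<exists>s\<in>S. v s \<noteq> 0) \<and> (\<forall>i<m. (\<Sum>s\<in>S. v s * f i s) = 0)"
  using assms
proof (induction m arbitrary: S f)
  case 0
  then show ?case by (intro exI[of _ "\<lambda>_. 1"]) (auto simp: card_gt_0_iff)
next
  case (Suc m)
  show ?case
  proof (cases "\<forall>s\<in>S. f m s = 0")
    case True
    from Suc.IH[of S f] Suc.prems obtain v where v: "\<exists>s\<in>S. v s \<noteq> 0" "\<forall>i<m. (\<Sum>s\<in>S. v s * f i s) = 0"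
      by auto
    moreover have "(\<Sum>s\<in>S. v s * f m s) = 0" using True by simp
    ultimately show ?thesis by (auto simp: less_Suc_eq)
  next
    case False
    then obtain s0 where s0: "s0 \<in> S" "f m s0 \<noteq> 0" by blast
    define S' where "S' = S - {s0}"
    have S': "finite S'" "m < card S'" "S = insert s0 S'" "s0 \<notin> S'"
      using Suc.prems s0 by (auto simp: S'_def card_Diff_singleton)
    \<comment> \<open>Equation \<open>i\<close> after eliminating the unknown at \<open>s0\<close>
      by means of equation \<open>m\<close>.\<close>
    define g where "g i s = f i s - f m s * f i s0 / f m s0" for i s
    from Suc.IH[OF S'(1,2), of g] obtain v where v: "\<exists>s\<in>S'. v s \<noteq> 0" "\<And>i. i < m \<Longrightarrow> (\<Sum>s\<in>S'. v s * g i s) = 0"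
      by auto
    define u where "u = v (s0 := - (\<Sum>s\<in>S'. v s * f m s) / f m s0)"
    have uS: "(\<Sum>s\<in>S. u s * f i s) = (\<Sum>s\<in>S'. v s * f i s) - (\<Sum>s\<in>S'. v s * f m s) * f i s0 / f m s0" for i
    proof -
      have "(\<Sum>s\<in>S'. u s * f i s) = (\<Sum>s\<in>S'. v s * f i s)"
        using S'(4) by (intro sum.cong) (auto simp: u_def)
      then show ?thesis using S' by (simp add: u_def)
    qed
    have "(\<Sum>s\<in>S. u s * f i s) = 0" if "i < Suc m" for i
    proof (cases "i = m")
      case True
      then show ?thesis unfolding uS using s0 by simp
    next
      case False
      with that have "(\<Sum>s\<in>S'. v s * g i s) = 0" by (intro v) simp
      also have "(\<Sum>s\<in>S'. v s * g i s) = (\<Sum>s\<in>S'. v s * f i s) - (\<Sum>s\<in>S'. v s * f m s * f i s0 / f m s0)"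
        by (simp add: g_def right_diff_distrib sum_subtractf mult.assoc)
      finally show ?thesis unfolding uS by (simp only: sum_distrib_right sum_divide_distrib)
    qed
    moreover have "\<exists>s\<in>S. u s \<noteq> 0" using v(1) S' by (auto simp: u_def)
    ultimately show ?thesis by blast
  qed
qed

text \<open>Caratheodory's reduction: while the support has more than \<open>m\<close> elements,
  moving along a null direction preserves all \<open>m\<close> sums, and stopping when the first
  weight reaches 0 shrinks the support.\<close>

lemma caratheodory_weights:
  fixes f :: "nat \<Rightarrow> 'a \<Rightarrow> real" and w :: "'a \<Rightarrow> real"
  assumes "finite S" "\<And>s. s \<in> S \<Longrightarrow> w s \<ge> 0"
  shows "\<exists>w'. (\<forall>s\<in>S. w' s \<ge> 0) \<and> card {s\<in>S. w' s \<noteq> 0} \<le> m \<and>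
    (\<forall>i<m. (\<Sum>s\<in>S. w' s * f i s) = (\<Sum>s\<in>S. w s * f i s))"
  using assms(2)
proof (induction "card {s\<in>S. w s \<noteq> 0}" arbitrary: w rule: less_induct)
  case less
  define P where "P = {s\<in>S. w s \<noteq> 0}"
  have P: "finite P" "P \<subseteq> S" "\<And>s. s \<in> P \<Longrightarrow> w s > 0" "\<And>s. s \<in> S - P \<Longrightarrow> w s = 0"
    using assms(1) less.prems by (auto simp: P_def order_less_le)
  show ?case
  proof (cases "card P \<le> m")
    case True
    then show ?thesis using less.prems by (intro exI[of _ w]) (auto simp: P_def)
  next
    case False
    then obtain v0 where v0: "\<exists>s\<in>P. v0 s \<noteq> 0" "\<And>i. i < m \<Longrightarrow> (\<Sum>s\<in>P. v0 s * f i s) = 0"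
      using ex_null_combination[OF P(1), of m f] by auto
    \<comment> \<open>A null direction may be negated; one with a positive entry makes some weight
      decrease.\<close>
    have "\<exists>v. (\<exists>s\<in>P. v s > 0) \<and> (\<forall>i<m. (\<Sum>s\<in>P. v s * f i s) = 0)"
    proof (cases "\<exists>s\<in>P. v0 s > 0")
      case False
      with v0 show ?thesis
        by (intro exI[of _ "\<lambda>s. - v0 s"]) (auto simp: sum_negf not_less order_le_less)
    qed (use v0 in blast)
    then obtain v where v: "\<exists>s\<in>P. v s > 0" "\<And>i. i < m \<Longrightarrow> (\<Sum>s\<in>P. v s * f i s) = 0" by blast
    define T where "T = {s\<in>P. v s > 0}"
    have T: "finite T" "T \<noteq> {}" using P v by (auto simp: T_def)
    \<comment> \<open>The weight that vanishes first; its ratio is the largest step that keeps all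
      weights nonnegative.\<close>
    define s1 where "s1 = arg_min_on (\<lambda>s. w s / v s) T"
    have s1: "s1 \<in> T" "\<And>s. s \<in> T \<Longrightarrow> w s1 / v s1 \<le> w s / v s"
      unfolding s1_def by (auto intro: arg_min_if_finite(1)[OF T] arg_min_least[OF T])
    define t where "t = w s1 / v s1"
    have t: "t \<ge> 0" using s1(1) P by (auto simp: t_def T_def intro!: divide_nonneg_pos less_imp_le)
    define u where "u s = (if s \<in> P then w s - t * v s else 0)" for s
    have u0: "u s \<ge> 0" if "s \<in> S" for s
    proof (cases "s \<in> P \<and> v s > 0")
      case True
      then have "t \<le> w s / v s" using s1(2)[of s] by (auto simp: t_def T_def)
      then show ?thesis using True by (auto simp: u_def field_simps)
    next
      case False
      then show ?thesis using t P(3)[of s] mult_nonneg_nonpos[of t "v s"] by (auto simp: u_def)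
    qed
    have "u s1 = 0" using s1(1) by (auto simp: u_def t_def T_def)
    have "{s\<in>S. u s \<noteq> 0} \<subseteq> P - {s1}" using \<open>u s1 = 0\<close> by (auto simp: u_def)
    moreover have "card (P - {s1}) < card P"
      using s1(1) P(1) by (intro psubset_card_mono) (auto simp: T_def)
    ultimately have "card {s\<in>S. u s \<noteq> 0} < card P"
      using P(1) by (meson card_mono finite_Diff order_le_less_trans)
    then have "card {s\<in>S. u s \<noteq> 0} < card {s\<in>S. w s \<noteq> 0}" by (simp add: P_def)
    from less.hyps[OF this u0] obtain w' where w': "\<forall>s\<in>S. w' s \<ge> 0" "card {s\<in>S. w' s \<noteq> 0} \<le> m"
      "\<forall>i<m. (\<Sum>s\<in>S. w' s * f i s) = (\<Sum>s\<in>S. u s * f i s)" by blast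
    have "(\<Sum>s\<in>S. u s * f i s) = (\<Sum>s\<in>S. w s * f i s)" if "i < m" for i
    proof -
      have "(\<Sum>s\<in>S. u s * f i s) = (\<Sum>s\<in>P. u s * f i s)"
        using assms(1) P(2) by (intro sum.mono_neutral_right) (auto simp: u_def)
      also have "\<dots> = (\<Sum>s\<in>P. w s * f i s) - t * (\<Sum>s\<in>P. v s * f i s)"
        by (simp add: u_def left_diff_distrib sum_subtractf sum_distrib_left mult.assoc)
      also have "\<dots> = (\<Sum>s\<in>P. w s * f i s)" using v(2)[OF that] by simp
      also have "\<dots> = (\<Sum>s\<in>S. w s * f i s)"
        using assms(1) P(2,4) by (intro sum.mono_neutral_left) auto
      finally show ?thesis .
    qed
    with w' show ?thesis by auto
  qed
qed

text \<open>Total mass is one more linear constraint besides the \<open>m\<close> integrals, hence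
  \<open>Suc m\<close> atoms. The number of atoms is made exactly \<open>Suc m\<close> so that a
  single value of \<open>k\<close> can be used in the prior.\<close>

lemma moment_matching:
  fixes g :: "nat \<Rightarrow> real \<Rightarrow> real"
  assumes w: "w \<in> weight_simplex k" and \<theta>: "\<theta> \<in> cube L k" and L: "L \<ge> 0"
  shows "\<exists>w'\<in>weight_simplex (Suc m). \<exists>\<theta>'\<in>cube L (Suc m).
    \<forall>l<m. (\<Sum>j=1..Suc m. w' j * g l (\<theta>' j)) = (\<Sum>j=1..k. w j * g l (\<theta> j))"
proof -
  \<comment> \<open>Index 0 encodes the total mass; the prescribed functions are shifted by
    one.\<close>
  define f where "f i j = (case i of 0 \<Rightarrow> 1 | Suc l \<Rightarrow> g l (\<theta> j))" for i j
  have w0: "w j \<ge> 0" if "j \<in> {1..k}" for j using w that by (auto simp: weight_simplex_def)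
  have "\<exists>v. (\<forall>j\<in>{1..k}. v j \<ge> 0) \<and> card {j\<in>{1..k}. v j \<noteq> 0} \<le> Suc m \<and>
      (\<forall>i<Suc m. (\<Sum>j=1..k. v j * f i j) = (\<Sum>j=1..k. w j * f i j))"
    by (rule caratheodory_weights) (use w0 in auto)
  then obtain v where v': "\<forall>j\<in>{1..k}. v j \<ge> 0" "card {j\<in>{1..k}. v j \<noteq> 0} \<le> Suc m"
      "\<forall>i<Suc m. (\<Sum>j=1..k. v j * f i j) = (\<Sum>j=1..k. w j * f i j)"
    by (elim exE conjE) (rule that)
  note v = bspec[OF v'(1)] v'(2) v'(3)[rule_format]
  define P where "P = {j\<in>{1..k}. v j \<noteq> 0}"
  define c where "c = card P"
  have "finite P" by (simp add: P_def)
  then obtain e where e: "bij_betw e {1..c} P"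
    using ex_bij_betw_nat_finite_1 unfolding c_def by blast
  have c: "c \<le> Suc m" using v(2) by (simp add: c_def P_def)
  have eP: "e j \<in> {1..k}" if "j \<in> {1..c}" for j
    using bij_betw_apply[OF e that] by (auto simp: P_def)
  \<comment> \<open>Missing components get weight 0 and, in \<open>\<theta>'\<close>, the position
    0, which lies in the cube by \<open>L \<ge> 0\<close>; \<open>undefined\<close> outside the
    index range gives extensionality.\<close>
  define w' where "w' j = (if j \<in> {1..Suc m} then (if j \<le> c then v (e j) else 0) else undefined)" for j
  define \<theta>' where "\<theta>' j = (if j \<in> {1..Suc m} then (if j \<le> c then \<theta> (e j) else 0) else undefined)" for j
  have key: "(\<Sum>j=1..Suc m. w' j * h (\<theta>' j)) = (\<Sum>j=1..k. v j * h (\<theta> j))" for h :: "real \<Rightarrow> real"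
  proof -
    have "(\<Sum>j=1..Suc m. w' j * h (\<theta>' j)) = (\<Sum>j=1..c. w' j * h (\<theta>' j))"
      using c by (intro sum.mono_neutral_right) (auto simp: w'_def)
    also have "\<dots> = (\<Sum>j\<in>{1..c}. v (e j) * h (\<theta> (e j)))"
      using c by (intro sum.cong) (auto simp: w'_def \<theta>'_def)
    also have "\<dots> = (\<Sum>j\<in>P. v j * h (\<theta> j))" by (rule sum.reindex_bij_betw[OF e])
    also have "\<dots> = (\<Sum>j=1..k. v j * h (\<theta> j))"
      by (intro sum.mono_neutral_left) (auto simp: P_def)
    finally show ?thesis .
  qed
  have w'0: "w' j \<ge> 0" if "j \<in> {1..Suc m}" for j
    using that v(1) eP by (auto simp: w'_def)
  have s1: "(\<Sum>j=1..Suc m. w' j) = 1"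
    using key[of "\<lambda>_. 1"] v(3)[of 0] w by (simp add: f_def weight_simplex_def del: sum.cl_ivl_Suc)
  have "w' j \<le> 1" if "j \<in> {1..Suc m}" for j
    unfolding s1[symmetric] using that w'0 by (intro member_le_sum) auto
  then have "w' \<in> weight_simplex (Suc m)"
    using s1 w'0 by (auto simp: weight_simplex_def w'_def PiE_iff extensional_def simp del: sum.cl_ivl_Suc)
  moreover have "\<theta>' \<in> cube L (Suc m)"
  proof -
    have "\<theta> (e j) \<in> {-L..L}" if "j \<in> {1..c}" for j
      using \<theta> eP[OF that] by (auto simp: cube_def)
    then show ?thesis using L by (auto simp: cube_def \<theta>'_def PiE_iff extensional_def)
  qed
  moreover have "(\<Sum>j=1..Suc m. w' j * g l (\<theta>' j)) = (\<Sum>j=1..k. w j * g l (\<theta> j))" if "l < m" for l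
    unfolding key using v(3)[of "Suc l"] that by (simp add: f_def)
  ultimately show ?thesis by blast
qed

section \<open>Normal mixtures relative to the standard normal density\<close>

lemma normal_density_eq: "normal_density t 1 x = std_normal_density x * exp (x * t - t\<^sup>2 / 2)"
proof -
  have "- (x - t)\<^sup>2 / 2 = - x\<^sup>2 / 2 + (x * t - t\<^sup>2 / 2)"
    by (simp add: power2_eq_square field_simps)
  then have "exp (- (x - t)\<^sup>2 / 2) = exp (- x\<^sup>2 / 2) * exp (x * t - t\<^sup>2 / 2)"
    by (simp only: exp_add)
  then show ?thesis by (simp add: normal_density_def)
qed

lemma abs_mult_le_of_abs_le:
  fixes x t :: real
  assumes "\<bar>x\<bar> \<le> R" "\<bar>t\<bar> \<le> L"
  shows "\<bar>x * t\<bar> \<le> R * L"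
  unfolding abs_mult using assms by (intro mult_mono) auto

lemma exp_taylor_remainder:
  fixes z :: real
  assumes "\<bar>z\<bar> \<le> B"
  shows "\<bar>exp z - (\<Sum>l<m. z ^ l / fact l)\<bar> \<le> exp B * B ^ m / fact m"
proof -
  obtain t where t: "\<bar>t\<bar> \<le> \<bar>z\<bar>" "exp z = (\<Sum>l<m. z ^ l / fact l) + (exp t / fact m) * z ^ m"
    using Maclaurin_exp_le[of z m] by blast
  have "\<bar>exp z - (\<Sum>l<m. z ^ l / fact l)\<bar> = exp t * \<bar>z\<bar> ^ m / fact m"
    using t(2) by (simp add: abs_mult power_abs)
  also have "\<dots> \<le> exp B * B ^ m / fact m"
    using t(1) assms by (intro divide_right_mono mult_mono power_mono) auto
  finally show ?thesis .
qed

lemma cube_abs_le: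
  assumes "\<theta> \<in> cube L k" "j \<in> {1..k}"
  shows "\<bar>\<theta> j\<bar> \<le> L"
proof -
  have "\<theta> j \<in> {-L..L}" using assms by (auto simp: cube_def)
  then show ?thesis by (auto simp: abs_real_def)
qed

text \<open>By \<open>normal_density_eq\<close>, a normal mixture density is \<open>std_normal_density x\<close> times a power series in
  \<open>x\<close> whose coefficients are the integrals of \<open>t\<^sup>l * exp (- t\<^sup>2 / 2) / l!\<close>; these are the
  functions to be matched.\<close>

lemma matched_mixture_error:
  assumes w: "w \<in> weight_simplex k" and \<theta>: "\<theta> \<in> cube L k"
    and w': "w' \<in> weight_simplex k'" and \<theta>': "\<theta>' \<in> cube L k'"
    and x: "\<bar>x\<bar> \<le> R"
    and match: "\<And>l. l < m \<Longrightarrow> (\<Sum>j=1..k'. w' j * (\<theta>' j ^ l * exp (- (\<theta>' j)\<^sup>2 / 2)))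
      = (\<Sum>j=1..k. w j * (\<theta> j ^ l * exp (- (\<theta> j)\<^sup>2 / 2)))"
  shows "\<bar>(\<Sum>j=1..k'. w' j * exp (x * \<theta>' j - (\<theta>' j)\<^sup>2 / 2)) - (\<Sum>j=1..k. w j * exp (x * \<theta> j - (\<theta> j)\<^sup>2 / 2))\<bar>
    \<le> 2 * (exp (R * L) * (R * L) ^ m / fact m)"
proof -
  let ?E = "exp (R * L) * (R * L) ^ m / fact m"
  \<comment> \<open>The truncated series depends on the mixture only through the matched integrals.
    Both mixtures are compared with it, which gives the factor 2.\<close>
  have *: "\<bar>(\<Sum>j=1..k. w j * exp (x * \<theta> j - (\<theta> j)\<^sup>2 / 2)) -
      (\<Sum>l<m. x ^ l / fact l * (\<Sum>j=1..k. w j * (\<theta> j ^ l * exp (- (\<theta> j)\<^sup>2 / 2))))\<bar> \<le> ?E"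
    if w: "w \<in> weight_simplex k" and \<theta>: "\<theta> \<in> cube L k" for k w \<theta>
  proof -
    have "(\<Sum>l<m. x ^ l / fact l * (\<Sum>j=1..k. w j * (\<theta> j ^ l * exp (- (\<theta> j)\<^sup>2 / 2))))
      = (\<Sum>l<m. \<Sum>j=1..k. w j * exp (- (\<theta> j)\<^sup>2 / 2) * ((x * \<theta> j) ^ l / fact l))"
      by (simp only: sum_distrib_left, intro sum.cong refl) (simp add: power_mult_distrib)
    also have "\<dots> = (\<Sum>j=1..k. w j * exp (- (\<theta> j)\<^sup>2 / 2) * (\<Sum>l<m. (x * \<theta> j) ^ l / fact l))"
      by (subst sum.swap) (simp only: sum_distrib_left)
    finally have eq: "(\<Sum>j=1..k. w j * exp (x * \<theta> j - (\<theta> j)\<^sup>2 / 2)) -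
      (\<Sum>l<m. x ^ l / fact l * (\<Sum>j=1..k. w j * (\<theta> j ^ l * exp (- (\<theta> j)\<^sup>2 / 2))))
      = (\<Sum>j=1..k. w j * (exp (- (\<theta> j)\<^sup>2 / 2) * (exp (x * \<theta> j) - (\<Sum>l<m. (x * \<theta> j) ^ l / fact l))))"
      by (simp add: sum_subtractf right_diff_distrib mult.assoc flip: exp_add)
    have "\<bar>\<Sum>j=1..k. w j * (exp (- (\<theta> j)\<^sup>2 / 2) * (exp (x * \<theta> j) - (\<Sum>l<m. (x * \<theta> j) ^ l / fact l)))\<bar>
       \<le> (\<Sum>j=1..k. w j * ?E)"
    proof (intro order_trans[OF sum_abs] sum_mono)
      fix j assume j: "j \<in> {1..k}"
      have w0: "w j \<ge> 0" using w j by (auto simp: weight_simplex_def)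
      have "\<bar>\<theta> j\<bar> \<le> L" by (rule cube_abs_le[OF \<theta> j])
      then have "\<bar>x * \<theta> j\<bar> \<le> R * L" using x by (intro abs_mult_le_of_abs_le)
      note r = exp_taylor_remainder[OF this, of m]
      have "\<bar>exp (- (\<theta> j)\<^sup>2 / 2) * (exp (x * \<theta> j) - (\<Sum>l<m. (x * \<theta> j) ^ l / fact l))\<bar> \<le> 1 * ?E"
        unfolding abs_mult by (intro mult_mono r) auto
      then show "\<bar>w j * (exp (- (\<theta> j)\<^sup>2 / 2) * (exp (x * \<theta> j) - (\<Sum>l<m. (x * \<theta> j) ^ l / fact l)))\<bar> \<le> w j * ?E"
        unfolding abs_mult[of "w j"] using w0 by (intro mult_mono) auto
    qed
    also have "\<dots> = ?E" unfolding sum_distrib_right[symmetric] using w by (simp add: weight_simplex_def)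
    finally show ?thesis unfolding eq .
  qed
  have "(\<Sum>l<m. x ^ l / fact l * (\<Sum>j=1..k'. w' j * (\<theta>' j ^ l * exp (- (\<theta>' j)\<^sup>2 / 2))))
    = (\<Sum>l<m. x ^ l / fact l * (\<Sum>j=1..k. w j * (\<theta> j ^ l * exp (- (\<theta> j)\<^sup>2 / 2))))"
    by (intro sum.cong refl arg_cong2[where f = "(*)"] match) simp
  with *[OF w \<theta>] *[OF w' \<theta>'] show ?thesis by linarith
qed

text \<open>On \<open>|t| \<le> L\<close> the kernel exp (x t - t^2 / 2) is bounded by
  \<open>exp (R * L)\<close> and Lipschitz in \<open>t\<close> with constant
  \<open>(R + L) * exp (R * L)\<close>. The summand 1 accounts for the weights and
  \<open>R + L\<close> for the atoms.\<close>

lemma perturbed_mixture_error: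
  assumes w: "w \<in> weight_simplex k" and \<theta>: "\<theta> \<in> cube L k"
    and w': "w' \<in> weight_simplex k" and \<theta>': "\<theta>' \<in> cube L k"
    and x: "\<bar>x\<bar> \<le> R"
    and dw: "(\<Sum>j=1..k. \<bar>w j - w' j\<bar>) \<le> \<eta>" and d\<theta>: "\<And>j. j \<in> {1..k} \<Longrightarrow> \<bar>\<theta> j - \<theta>' j\<bar> \<le> \<eta>"
  shows "\<bar>(\<Sum>j=1..k. w j * exp (x * \<theta> j - (\<theta> j)\<^sup>2 / 2)) - (\<Sum>j=1..k. w' j * exp (x * \<theta>' j - (\<theta>' j)\<^sup>2 / 2))\<bar>
    \<le> \<eta> * (1 + R + L) * exp (R * L)"
proof -
  let ?e = "\<lambda>t. exp (x * t - t\<^sup>2 / 2)"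
  have le: "x * t - t\<^sup>2 / 2 \<le> R * L" if "\<bar>t\<bar> \<le> L" for t
    using abs_mult_le_of_abs_le[OF x that] zero_le_power2[of t] by linarith
  have e1: "\<bar>?e t\<bar> \<le> exp (R * L)" if "\<bar>t\<bar> \<le> L" for t using le[OF that] by simp
  have lip: "\<bar>?e t - ?e s\<bar> \<le> (\<eta> * (R + L)) * exp (R * L)" if t: "\<bar>t\<bar> \<le> L" "\<bar>s\<bar> \<le> L" "\<bar>t - s\<bar> \<le> \<eta>" for s t
  proof -
    have ab: "\<bar>exp a - exp b\<bar> \<le> \<bar>a - b\<bar> * exp c" if "a \<le> c" "b \<le> c" for a b c :: real
    proof -
      have *: "exp a - exp b \<le> (a - b) * exp a" for a b :: real
        using exp_ge_add_one_self[of "b - a"] by (simp add: exp_diff field_simps)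
      have "exp a - exp b \<le> \<bar>a - b\<bar> * exp c"
        using *[of a b] that by (intro order_trans[OF *] mult_mono) auto
      moreover have "exp b - exp a \<le> \<bar>a - b\<bar> * exp c"
        using that by (intro order_trans[OF *] mult_mono) auto
      ultimately show ?thesis by linarith
    qed
    have "(x * t - t\<^sup>2 / 2) - (x * s - s\<^sup>2 / 2) = (t - s) * (x - (t + s) / 2)"
      by (simp add: power2_eq_square field_simps)
    then have "\<bar>(x * t - t\<^sup>2 / 2) - (x * s - s\<^sup>2 / 2)\<bar> = \<bar>t - s\<bar> * \<bar>x - (t + s) / 2\<bar>" by (simp add: abs_mult)
    also have "\<dots> \<le> \<eta> * (R + L)" using t x by (intro mult_mono) (auto simp: abs_le_iff field_simps)
    finally have "\<bar>(x * t - t\<^sup>2 / 2) - (x * s - s\<^sup>2 / 2)\<bar> \<le> \<eta> * (R + L)" .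
    then show ?thesis using ab[OF le[OF t(1)] le[OF t(2)]]
      by (meson exp_ge_zero mult_right_mono order_trans)
  qed
  have \<theta>L: "\<bar>\<theta> j\<bar> \<le> L" "\<bar>\<theta>' j\<bar> \<le> L" if "j \<in> {1..k}" for j
    using that by (auto intro: cube_abs_le[OF \<theta>] cube_abs_le[OF \<theta>'])
  have w'0: "w' j \<ge> 0" if "j \<in> {1..k}" for j using w' that by (auto simp: weight_simplex_def)
  have eq: "(\<Sum>j=1..k. w j * ?e (\<theta> j)) - (\<Sum>j=1..k. w' j * ?e (\<theta>' j))
     = (\<Sum>j=1..k. (w j - w' j) * ?e (\<theta> j) + w' j * (?e (\<theta> j) - ?e (\<theta>' j)))"
    by (simp add: sum_subtractf[symmetric] algebra_simps)
  have "\<bar>\<Sum>j=1..k. (w j - w' j) * ?e (\<theta> j) + w' j * (?e (\<theta> j) - ?e (\<theta>' j))\<bar>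
     \<le> (\<Sum>j=1..k. \<bar>w j - w' j\<bar> * exp (R * L) + w' j * ((\<eta> * (R + L)) * exp (R * L)))"
  proof (intro order_trans[OF sum_abs] sum_mono)
    fix j assume j: "j \<in> {1..k}"
    have "\<bar>(w j - w' j) * ?e (\<theta> j)\<bar> \<le> \<bar>w j - w' j\<bar> * exp (R * L)"
      unfolding abs_mult by (intro mult_left_mono e1 \<theta>L(1)[OF j]) auto
    moreover have "\<bar>w' j * (?e (\<theta> j) - ?e (\<theta>' j))\<bar> \<le> w' j * ((\<eta> * (R + L)) * exp (R * L))"
      unfolding abs_mult abs_of_nonneg[OF w'0[OF j]] by (intro mult_left_mono lip \<theta>L[OF j] d\<theta>[OF j] w'0[OF j])
    ultimately show "\<bar>(w j - w' j) * ?e (\<theta> j) + w' j * (?e (\<theta> j) - ?e (\<theta>' j))\<bar>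
       \<le> \<bar>w j - w' j\<bar> * exp (R * L) + w' j * ((\<eta> * (R + L)) * exp (R * L))" by linarith
  qed
  also have "\<dots> = (\<Sum>j=1..k. \<bar>w j - w' j\<bar>) * exp (R * L) + (\<eta> * (R + L)) * exp (R * L)"
    using w' by (simp add: sum.distrib weight_simplex_def flip: sum_distrib_right)
  also have "\<dots> \<le> \<eta> * exp (R * L) + (\<eta> * (R + L)) * exp (R * L)"
    using dw by simp
  also have "\<dots> = \<eta> * (1 + R + L) * exp (R * L)" by (simp add: algebra_simps)
  finally show ?thesis unfolding eq .
qed

text \<open>The common factor \<open>std_normal_density\<close> cancels, and the remaining factor of
  the \<nu>0 density is at least \<open>exp (- (R * L) - L\<^sup>2 / 2)\<close> on the truncated
  range. The additive error is thus a relative error of at most 1 / (2 n) per observation.\<close>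

lemma likelihood_lower_bound:
  assumes w0: "w0 \<in> weight_simplex k0" and \<theta>0: "\<theta>0 \<in> cube L k0" and k0: "k0 \<ge> 1"
    and w: "w \<in> weight_simplex k" and \<theta>: "\<theta> \<in> cube L k" and k: "k \<ge> 1"
    and n: "n \<ge> 1" and x: "\<And>i. i \<in> {1..n} \<Longrightarrow> \<bar>x i\<bar> \<le> R"
    and err: "\<And>y. \<bar>y\<bar> \<le> R \<Longrightarrow> \<bar>(\<Sum>j=1..k. w j * exp (y * \<theta> j - (\<theta> j)\<^sup>2 / 2)) - (\<Sum>j=1..k0. w0 j * exp (y * \<theta>0 j - (\<theta>0 j)\<^sup>2 / 2))\<bar> \<le> \<epsilon>"
    and \<epsilon>: "\<epsilon> \<le> exp (- (R * L) - L\<^sup>2 / 2) / (2 * n)"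
  shows "likelihood n (mixing k w \<theta>) x \<ge> likelihood n (mixing k0 w0 \<theta>0) x / 2"
proof -
  let ?q = "\<lambda>y. \<Sum>j=1..k. w j * exp (y * \<theta> j - (\<theta> j)\<^sup>2 / 2)"
  let ?r = "\<lambda>y. \<Sum>j=1..k0. w0 j * exp (y * \<theta>0 j - (\<theta>0 j)\<^sup>2 / 2)"
  let ?a = "1 - 1 / (2 * real n)"
  have a: "?a \<ge> 0" using n by (simp add: field_simps)
  have \<nu>0: "mixing k0 w0 \<theta>0 \<in> mixing_dists L"
    using w0 \<theta>0 k0 by (auto simp: mixing_dists_def mixing_dists_k_def)
  have p: "normal_mixture_density (mixing k w \<theta>) y = std_normal_density y * ?q y"
    "normal_mixture_density (mixing k0 w0 \<theta>0) y = std_normal_density y * ?r y" for y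
    unfolding normal_mixture_density_mixing[OF w] normal_mixture_density_mixing[OF w0] sum_distrib_left
    by (intro sum.cong refl, subst normal_density_eq, simp)+
  have pw: "?a * normal_mixture_density (mixing k0 w0 \<theta>0) y \<le> normal_mixture_density (mixing k w \<theta>) y" if y: "\<bar>y\<bar> \<le> R" for y
  proof -
    have "exp (- (R * L) - L\<^sup>2 / 2) = (\<Sum>j=1..k0. w0 j * exp (- (R * L) - L\<^sup>2 / 2))"
      unfolding sum_distrib_right[symmetric] using w0 by (simp add: weight_simplex_def)
    also have "\<dots> \<le> ?r y"
    proof (intro sum_mono mult_left_mono)
      fix j assume j: "j \<in> {1..k0}"
      show "w0 j \<ge> 0" using w0 j by (auto simp: weight_simplex_def)
      have tL: "\<bar>\<theta>0 j\<bar> \<le> L" by (rule cube_abs_le[OF \<theta>0 j])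
      then have "(\<theta>0 j)\<^sup>2 \<le> L\<^sup>2" by (metis abs_ge_zero power2_abs power_mono)
      then show "exp (- (R * L) - L\<^sup>2 / 2) \<le> exp (y * \<theta>0 j - (\<theta>0 j)\<^sup>2 / 2)"
        using abs_mult_le_of_abs_le[OF y tL] by simp
    qed
    finally have "\<epsilon> \<le> ?r y / (2 * n)"
      using \<epsilon> n by (intro order_trans[OF \<epsilon>] divide_right_mono) auto
    then have "?a * ?r y \<le> ?q y" using err[OF y] by (simp add: left_diff_distrib)
    then have "std_normal_density y * (?a * ?r y) \<le> std_normal_density y * ?q y"
      by (intro mult_left_mono) auto
    then show ?thesis unfolding p mult.left_commute[of ?a] .
  qed
  \<comment> \<open>Bernoulli's inequality: n relative errors of 1 / (2 n) cost at most a factor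
    2.\<close>
  have "1 / 2 \<le> 1 + real n * (- (1 / (2 * real n)))" using n by simp
  also have "\<dots> \<le> (1 + - (1 / (2 * real n))) ^ n" using n by (intro Bernoulli_inequality) (simp add: field_simps)
  finally have "1 / 2 \<le> ?a ^ n" by simp
  then have "1 / 2 * likelihood n (mixing k0 w0 \<theta>0) x \<le> ?a ^ n * likelihood n (mixing k0 w0 \<theta>0) x"
    using likelihood_bounds(1)[OF \<nu>0, of n x] by (intro mult_right_mono) auto
  also have "\<dots> = (\<Prod>i=1..n. ?a * normal_mixture_density (mixing k0 w0 \<theta>0) (x i))"
    by (simp add: likelihood_def prod.distrib)
  also have "\<dots> \<le> likelihood n (mixing k w \<theta>) x"
    unfolding likelihood_def using a normal_mixture_density_pos[OF \<nu>0] x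
    by (intro prod_mono conjI pw mult_nonneg_nonneg) (auto intro: less_imp_le)
  finally show ?thesis by simp
qed

section \<open>Prior mass and tails\<close>

lemma prior_specD:
  assumes "prior_spec L K T W"
  shows "sets K = Pow {1..}" "space K = {1..}" "prob_space K"
    and "\<And>k. k \<ge> 1 \<Longrightarrow> sets (T k) = sets (cube_space L k)" "\<And>k. k \<ge> 1 \<Longrightarrow> space (T k) = cube L k"
      "\<And>k. k \<ge> 1 \<Longrightarrow> prob_space (T k)"
    and "\<And>k. k \<ge> 1 \<Longrightarrow> sets (W k) = sets (simplex_space k)" "\<And>k. k \<ge> 1 \<Longrightarrow> space (W k) = weight_simplex k"
      "\<And>k. k \<ge> 1 \<Longrightarrow> prob_space (W k)"
proof -
  show "sets K = Pow {1..}" "prob_space K"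
    and T: "\<And>k. k \<ge> 1 \<Longrightarrow> sets (T k) = sets (cube_space L k)" "\<And>k. k \<ge> 1 \<Longrightarrow> prob_space (T k)"
    and W: "\<And>k. k \<ge> 1 \<Longrightarrow> sets (W k) = sets (simplex_space k)" "\<And>k. k \<ge> 1 \<Longrightarrow> prob_space (W k)"
    using assms by (auto simp: prior_spec_def space_prob_algebra)
  then show "space K = {1..}" using sets_eq_imp_space_eq[of K "count_space {1..}"] by simp
  fix k :: nat assume k: "k \<ge> 1"
  show "space (T k) = cube L k"
    using sets_eq_imp_space_eq[OF T(1)[OF k]]
    by (auto simp: cube_space_def space_restrict_space space_PiM cube_def PiE_def)
  show "space (W k) = weight_simplex k"
    using sets_eq_imp_space_eq[OF W(1)[OF k]]
    by (auto simp: simplex_space_def space_restrict_space space_PiM weight_simplex_def PiE_def)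
qed

lemma measurable_mixing:
  assumes spec: "prior_spec L K T W" and k: "k \<ge> 1"
  shows "(\<lambda>(\<theta>, w). mixing k w \<theta>) \<in> T k \<Otimes>\<^sub>M W k \<rightarrow>\<^sub>M mixing_space L"
proof -
  note P = prior_specD[OF spec]
  have mT[measurable]: "(\<lambda>\<theta>. \<theta> j) \<in> borel_measurable (T k)" if "j \<in> {1..k}" for j
    unfolding measurable_cong_sets[OF P(4)[OF k] refl] cube_space_def
    using that by (intro measurable_restrict_space1) measurable
  have mW[measurable]: "(\<lambda>w. w j) \<in> borel_measurable (W k)" if "j \<in> {1..k}" for j
    unfolding measurable_cong_sets[OF P(7)[OF k] refl] simplex_space_def
    using that by (intro measurable_restrict_space1) measurable
  have "(\<lambda>(\<theta>, w). mixing k w \<theta>) \<in> T k \<Otimes>\<^sub>M W k \<rightarrow>\<^sub>M prob_algebra borel"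
  proof (rule measurable_prob_algebraI)
    show "(\<lambda>(\<theta>, w). mixing k w \<theta>) \<in> T k \<Otimes>\<^sub>M W k \<rightarrow>\<^sub>M subprob_algebra borel"
    proof (rule measurable_subprob_algebra)
      fix A :: "real set" assume [measurable]: "A \<in> sets borel"
      have "(\<lambda>x. \<Sum>j=1..k. ennreal (snd x j) * indicator A (fst x j)) \<in> borel_measurable (T k \<Otimes>\<^sub>M W k)"
      proof (rule borel_measurable_sum)
        fix j assume "j \<in> {1..k}"
        note [measurable] = mT[OF this] mW[OF this]
        show "(\<lambda>x. ennreal (snd x j) * indicator A (fst x j)) \<in> borel_measurable (T k \<Otimes>\<^sub>M W k)"
          by measurable
      qed
      then show "(\<lambda>x. emeasure (case x of (\<theta>, w) \<Rightarrow> mixing k w \<theta>) A) \<in> borel_measurable (T k \<Otimes>\<^sub>M W k)"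
        by (simp add: case_prod_beta emeasure_mixing)
    qed (auto simp: space_pair_measure P(8)[OF k] sets_mixing intro!: prob_space_imp_subprob_space prob_space_mixing)
  qed (auto simp: space_pair_measure P(8)[OF k] prob_space_mixing)
  then show ?thesis
    unfolding mixing_space_def using k
    by (intro measurable_restrict_space2)
       (auto simp: space_pair_measure P(5,8)[OF k] mixing_dists_def mixing_dists_k_def)
qed

lemma nn_integral_prior:
  assumes spec: "prior_spec L K T W" and f: "f \<in> borel_measurable (mixing_space L)"
  shows "(\<integral>\<^sup>+\<nu>. f \<nu> \<partial>prior L K T W) =
    (\<integral>\<^sup>+k. \<integral>\<^sup>+z. f (mixing k (snd z) (fst z)) \<partial>(T k \<Otimes>\<^sub>M W k) \<partial>K)"
proof -
  note P = prior_specD[OF spec]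
  let ?N = "\<lambda>k. distr (T k \<Otimes>\<^sub>M W k) (mixing_space L) (\<lambda>(\<theta>, w). mixing k w \<theta>)"
  have "?N k \<in> space (subprob_algebra (mixing_space L))" if k: "k \<ge> 1" for k
  proof -
    interpret T: prob_space "T k" by (rule P(6)[OF k])
    interpret W: prob_space "W k" by (rule P(9)[OF k])
    interpret TW: pair_prob_space "T k" "W k" ..
    show ?thesis
      unfolding space_subprob_algebra using TW.prob_space_distr[OF measurable_mixing[OF spec k]]
      by (auto intro: prob_space_imp_subprob_space)
  qed
  then have "?N \<in> K \<rightarrow>\<^sub>M subprob_algebra (mixing_space L)"
    using P(1,2) by (auto simp: measurable_def)
  then have "(\<integral>\<^sup>+\<nu>. f \<nu> \<partial>prior L K T W) = (\<integral>\<^sup>+k. \<integral>\<^sup>+\<nu>. f \<nu> \<partial>?N k \<partial>K)"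
    unfolding prior_def by (rule nn_integral_bind[OF f])
  also have "\<dots> = (\<integral>\<^sup>+k. \<integral>\<^sup>+z. f (mixing k (snd z) (fst z)) \<partial>(T k \<Otimes>\<^sub>M W k) \<partial>K)"
  proof (rule nn_integral_cong)
    fix k assume "k \<in> space K"
    then have k: "k \<ge> 1" by (simp add: P(2))
    show "(\<integral>\<^sup>+\<nu>. f \<nu> \<partial>?N k) = (\<integral>\<^sup>+z. f (mixing k (snd z) (fst z)) \<partial>(T k \<Otimes>\<^sub>M W k))"
      using nn_integral_distr[OF measurable_mixing[OF spec k], of f] f by (simp add: case_prod_beta)
  qed
  finally show ?thesis .
qed

lemma measurable_likelihood_mixing_space:
  "(\<lambda>\<nu>. likelihood n \<nu> x) \<in> borel_measurable (mixing_space L)"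
  unfolding likelihood_def normal_mixture_density_def
  by (intro borel_measurable_prod measurable_integral_mixing_space normal_density_measurable_mean)

text \<open>The prior is restricted to one number of components and to a rectangle; conditional
  independence of atoms and weights makes the mass of the rectangle a product.\<close>

lemma evidence_lower_bound:
  assumes spec: "prior_spec L K T W" and k: "k \<ge> 1" and c: "c \<ge> 0"
    and lower: "\<And>\<theta> w. \<theta> \<in> B\<^sub>1 \<Longrightarrow> w \<in> B\<^sub>2 \<Longrightarrow> c \<le> likelihood n (mixing k w \<theta>) x"
  shows "c * (measure K {k} * measure (T k) B\<^sub>1 * measure (W k) B\<^sub>2) \<le> (\<integral>\<nu>. likelihood n \<nu> x \<partial>prior L K T W)"
\<comment> \<open>A nonmeasurable set has \<open>measure\<close> 0, so in that case the claim
  reduces to nonnegativity of the evidence.\<close>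
proof (cases "B\<^sub>1 \<in> sets (T k) \<and> B\<^sub>2 \<in> sets (W k)")
  case False
  have "AE \<nu> in prior L K T W. 0 \<le> likelihood n \<nu> x"
  proof (rule AE_I2)
    fix \<nu> assume "\<nu> \<in> space (prior L K T W)"
    moreover have "sets (prior L K T W) = sets (mixing_space L)"
      using prior_in_space[OF spec] by (simp add: space_prob_algebra)
    ultimately have "\<nu> \<in> mixing_dists L"
      using sets_eq_imp_space_eq[of "prior L K T W" "mixing_space L"] by (simp add: space_mixing_space)
    then show "0 \<le> likelihood n \<nu> x" using likelihood_bounds(1) by (simp add: less_imp_le)
  qed
  then have "0 \<le> (\<integral>\<nu>. likelihood n \<nu> x \<partial>prior L K T W)" by (rule integral_nonneg_AE)
  with False show ?thesis by (auto simp: measure_notin_sets)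
next
  case True
  note P = prior_specD[OF spec]
  interpret K: prob_space K by (rule P)
  interpret T: prob_space "T k" by (rule P(6)[OF k])
  interpret W: prob_space "W k" by (rule P(9)[OF k])
  interpret TW: pair_prob_space "T k" "W k" ..
  let ?Q = "prior L K T W"
  have Q: "prob_space ?Q" "sets ?Q = sets (mixing_space L)"
    using prior_in_space[OF spec] by (auto simp: space_prob_algebra)
  interpret Q: prob_space ?Q by (rule Q)
  have spQ: "space ?Q = mixing_dists L"
    using sets_eq_imp_space_eq[OF Q(2)] by (simp add: space_mixing_space)
  have lb: "0 \<le> likelihood n \<nu> x" "likelihood n \<nu> x \<le> 1" if "\<nu> \<in> space ?Q" for \<nu>
    using likelihood_bounds[of \<nu> L n x] that by (simp_all add: spQ)
  have int: "integrable ?Q (\<lambda>\<nu>. likelihood n \<nu> x)"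
  proof (rule Q.integrable_const_bound[where B=1])
    show "AE \<nu> in ?Q. norm (likelihood n \<nu> x) \<le> 1" using lb by (intro AE_I2) simp
    show "(\<lambda>\<nu>. likelihood n \<nu> x) \<in> borel_measurable ?Q"
      using measurable_likelihood_mixing_space by (simp cong: measurable_cong_sets add: Q(2))
  qed
  let ?R = "B\<^sub>1 \<times> B\<^sub>2"
  have R: "?R \<in> sets (T k \<Otimes>\<^sub>M W k)" using True by auto
  have "ennreal (c * (measure K {k} * measure (T k) B\<^sub>1 * measure (W k) B\<^sub>2))
    = ennreal c * emeasure (T k \<Otimes>\<^sub>M W k) ?R * emeasure K {k}"
    using True c by (simp add: W.emeasure_pair_measure_Times T.emeasure_eq_measure W.emeasure_eq_measure
        K.emeasure_eq_measure ennreal_mult mult_ac)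
  also have "\<dots> = (\<integral>\<^sup>+i. (ennreal c * emeasure (T k \<Otimes>\<^sub>M W k) ?R) * indicator {k} i \<partial>K)"
    using k P(1) by (subst nn_integral_cmult_indicator) auto
  also have "\<dots> \<le> (\<integral>\<^sup>+i. \<integral>\<^sup>+z. ennreal (likelihood n (mixing i (snd z) (fst z)) x) \<partial>(T i \<Otimes>\<^sub>M W i) \<partial>K)"
  proof (rule nn_integral_mono)
    fix i
    show "(ennreal c * emeasure (T k \<Otimes>\<^sub>M W k) ?R) * indicator {k} i
      \<le> (\<integral>\<^sup>+z. ennreal (likelihood n (mixing i (snd z) (fst z)) x) \<partial>(T i \<Otimes>\<^sub>M W i))"
    proof (cases "i = k")
      case True
      have "ennreal c * emeasure (T k \<Otimes>\<^sub>M W k) ?R = (\<integral>\<^sup>+z. ennreal c * indicator ?R z \<partial>(T k \<Otimes>\<^sub>M W k))"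
        using R by (rule nn_integral_cmult_indicator[symmetric])
      also have "\<dots> \<le> (\<integral>\<^sup>+z. ennreal (likelihood n (mixing k (snd z) (fst z)) x) \<partial>(T k \<Otimes>\<^sub>M W k))"
        by (intro nn_integral_mono) (auto simp: indicator_def intro!: ennreal_leI lower)
      finally show ?thesis using True by simp
    qed simp
  qed
  also have "\<dots> = (\<integral>\<^sup>+\<nu>. ennreal (likelihood n \<nu> x) \<partial>?Q)"
    using measurable_likelihood_mixing_space by (intro nn_integral_prior[OF spec, symmetric]) simp
  also have "\<dots> = ennreal (\<integral>\<nu>. likelihood n \<nu> x \<partial>?Q)"
    using lb by (intro nn_integral_eq_integral[OF int] AE_I2) auto
  finally show ?thesis
    using lb by (subst (asm) ennreal_le_iff) (auto intro!: integral_nonneg_AE AE_I2)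
qed

section \<open>Gaussian tails and truncation of the sample\<close>

lemma normal_density_tail:
  assumes t: "\<bar>t\<bar> \<le> L"
  shows "(\<integral>\<^sup>+x. ennreal (normal_density t 1 x) * indicator {x. \<bar>x\<bar> > R} x \<partial>lborel) \<le> ennreal (2 * exp (2 * L + 2 - 2 * R))"
proof -
  \<comment> \<open>Exponential tilting by \<open>2 * s * x\<close> shifts the mean by
    \<open>2 * s\<close>. The resulting tail rate exp (- 2 R) leaves a factor 1 / n after a union
    bound over n observations with R = ln n.\<close>
  have tilt: "normal_density t 1 x * exp (2 * s * x) = exp (2 * s * t + 2) * normal_density (t + 2 * s) 1 x"
    if "s = 1 \<or> s = -1" for s x
  proof -
    have "- (x - t)\<^sup>2 / 2 + 2 * s * x = 2 * s * t + 2 + - (x - (t + 2 * s))\<^sup>2 / 2"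
      using that by (auto simp: power2_eq_square field_simps)
    then have "exp (- (x - t)\<^sup>2 / 2) * exp (2 * s * x) = exp (2 * s * t + 2) * exp (- (x - (t + 2 * s))\<^sup>2 / 2)"
      by (simp only: exp_add[symmetric])
    then show ?thesis by (simp add: normal_density_def)
  qed
  have pt: "normal_density t 1 x * indicator {x. \<bar>x\<bar> > R} x \<le>
      exp (2 * L + 2 - 2 * R) * (normal_density (t + 2) 1 x + normal_density (t - 2) 1 x)" for x
  proof (cases "\<bar>x\<bar> > R")
    case True
    have side: "normal_density t 1 x \<le> exp (2 * L + 2 - 2 * R) * normal_density (t + 2 * s) 1 x"
      if s: "s = 1 \<or> s = -1" "s * x > R" for s
    proof -
      have "normal_density t 1 x * 1 \<le> normal_density t 1 x * exp (2 * s * x - 2 * R)"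
        using s by (intro mult_left_mono) auto
      then have "normal_density t 1 x \<le> normal_density t 1 x * exp (2 * s * x - 2 * R)" by simp
      also have "\<dots> = exp (- 2 * R) * (exp (2 * s * t + 2) * normal_density (t + 2 * s) 1 x)"
        unfolding tilt[OF s(1), symmetric] by (simp add: exp_diff exp_minus field_simps)
      also have "\<dots> \<le> exp (- 2 * R) * (exp (2 * L + 2) * normal_density (t + 2 * s) 1 x)"
        using s t by (intro mult_left_mono mult_right_mono) auto
      also have "\<dots> = exp (2 * L + 2 - 2 * R) * normal_density (t + 2 * s) 1 x"
        by (simp add: exp_diff exp_minus field_simps)
      finally show ?thesis .
    qed
    have "x > R \<or> - x > R" using True by linarith
    then show ?thesis
    proof
      assume "x > R"
      with side[of 1] have "normal_density t 1 x \<le> exp (2 * L + 2 - 2 * R) * normal_density (t + 2) 1 x" by simp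
      also have "\<dots> \<le> exp (2 * L + 2 - 2 * R) * (normal_density (t + 2) 1 x + normal_density (t - 2) 1 x)"
        by (intro mult_left_mono) auto
      finally show ?thesis using True by simp
    next
      assume "- x > R"
      with side[of "-1"] have "normal_density t 1 x \<le> exp (2 * L + 2 - 2 * R) * normal_density (t - 2) 1 x" by simp
      also have "\<dots> \<le> exp (2 * L + 2 - 2 * R) * (normal_density (t + 2) 1 x + normal_density (t - 2) 1 x)"
        by (intro mult_left_mono) auto
      finally show ?thesis using True by simp
    qed
  qed simp
  have "(\<integral>\<^sup>+x. ennreal (normal_density t 1 x) * indicator {x. \<bar>x\<bar> > R} x \<partial>lborel) \<le>
     (\<integral>\<^sup>+x. ennreal (exp (2 * L + 2 - 2 * R)) * (ennreal (normal_density (t + 2) 1 x) + ennreal (normal_density (t - 2) 1 x)) \<partial>lborel)"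
  proof (rule nn_integral_mono)
    fix x
    have "ennreal (normal_density t 1 x) * indicator {x. \<bar>x\<bar> > R} x = ennreal (normal_density t 1 x * indicator {x. \<bar>x\<bar> > R} x)"
      by (auto simp: indicator_def)
    also have "\<dots> \<le> ennreal (exp (2 * L + 2 - 2 * R) * (normal_density (t + 2) 1 x + normal_density (t - 2) 1 x))"
      by (rule ennreal_leI[OF pt])
    finally show "ennreal (normal_density t 1 x) * indicator {x. \<bar>x\<bar> > R} x \<le>
      ennreal (exp (2 * L + 2 - 2 * R)) * (ennreal (normal_density (t + 2) 1 x) + ennreal (normal_density (t - 2) 1 x))"
      by (simp add: ennreal_mult ennreal_plus)
  qed
  also have "\<dots> = ennreal (exp (2 * L + 2 - 2 * R)) * 2"
    by (simp add: nn_integral_cmult nn_integral_add nn_integral_normal_density)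
  also have "\<dots> = ennreal (2 * exp (2 * L + 2 - 2 * R))"
    by (subst ennreal_mult) (auto simp: mult.commute)
  finally show ?thesis .
qed

lemma normal_mixture_tail:
  assumes \<nu>: "\<nu> \<in> mixing_dists L"
  shows "measure (convolution \<nu> std_normal) {x. \<bar>x\<bar> > R} \<le> 2 * exp (2 * L + 2 - 2 * R)"
proof -
  obtain k w \<theta> where *: "w \<in> weight_simplex k" "\<theta> \<in> cube L k" "\<nu> = mixing k w \<theta>"
    using \<nu> by (auto elim: mixing_distsE)
  let ?I = "indicator {x::real. \<bar>x\<bar> > R} :: real \<Rightarrow> ennreal"
  interpret C: prob_space "convolution \<nu> std_normal" by (rule prob_space_normal_mixture[OF \<nu>])
  have w0: "w j \<ge> 0" if "j \<in> {1..k}" for j using *(1) that by (auto simp: weight_simplex_def)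
  have [measurable]: "normal_mixture_density \<nu> \<in> borel_measurable borel"
    unfolding *(3) by (rule normal_mixture_density_measurable_mixing[OF *(1)])
  have "ennreal (measure (convolution \<nu> std_normal) {x. \<bar>x\<bar> > R}) = (\<integral>\<^sup>+x. ennreal (normal_mixture_density \<nu> x) * ?I x \<partial>lborel)"
    unfolding C.emeasure_eq_measure[symmetric] unfolding convolution_eq_density[OF \<nu>]
    by (rule emeasure_density) measurable
  also have "\<dots> = (\<integral>\<^sup>+x. (\<Sum>j=1..k. ennreal (w j) * (ennreal (normal_density (\<theta> j) 1 x) * ?I x)) \<partial>lborel)"
  proof (rule nn_integral_cong)
    fix x
    have "ennreal (normal_mixture_density \<nu> x) = (\<Sum>j=1..k. ennreal (w j) * ennreal (normal_density (\<theta> j) 1 x))"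
      unfolding *(3) normal_mixture_density_mixing[OF *(1)]
      by (subst sum_ennreal[symmetric]) (auto simp: ennreal_mult w0 intro!: mult_nonneg_nonneg)
    then show "ennreal (normal_mixture_density \<nu> x) * ?I x = (\<Sum>j=1..k. ennreal (w j) * (ennreal (normal_density (\<theta> j) 1 x) * ?I x))"
      by (simp only: sum_distrib_right mult.assoc)
  qed
  also have "\<dots> = (\<Sum>j=1..k. ennreal (w j) * (\<integral>\<^sup>+x. ennreal (normal_density (\<theta> j) 1 x) * ?I x \<partial>lborel))"
    by (subst nn_integral_sum) (auto simp: nn_integral_cmult)
  also have "\<dots> \<le> (\<Sum>j=1..k. ennreal (w j) * ennreal (2 * exp (2 * L + 2 - 2 * R)))"
  proof (intro sum_mono mult_left_mono normal_density_tail)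
    fix j assume "j \<in> {1..k}"
    then show "\<bar>\<theta> j\<bar> \<le> L" by (rule cube_abs_le[OF *(2)])
  qed simp
  also have "\<dots> = (\<Sum>j=1..k. ennreal (w j)) * ennreal (2 * exp (2 * L + 2 - 2 * R))"
    by (simp only: sum_distrib_right)
  also have "(\<Sum>j=1..k. ennreal (w j)) = 1"
    using *(1) w0 by (subst sum_ennreal) (auto simp: weight_simplex_def)
  finally show ?thesis by simp
qed

lemma iid_sample_union_bound:
  assumes G: "prob_space G" "sets G = sets borel" and B: "B \<in> sets borel"
  shows "measure (iid_sample n G) {x \<in> space (iid_sample n G). \<exists>i\<in>{1..n}. x i \<in> B} \<le> n * measure G B"
proof -
  note [measurable_cong] = G(2)
  note [measurable] = B
  interpret G: prob_space G by fact
  let ?M = "iid_sample n G"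
  interpret product_prob_space "\<lambda>_::nat. G" "{1..n}" by unfold_locales
  interpret M: prob_space ?M unfolding iid_sample_def by unfold_locales
  have comp: "distr ?M G (\<lambda>x. x i) = G" if "i \<in> {1..n}" for i
    unfolding iid_sample_def using that by (intro distr_PiM_component) (auto simp: G.prob_space_axioms)
  have m[measurable]: "(\<lambda>x. x i) \<in> ?M \<rightarrow>\<^sub>M G" if "i \<in> {1..n}" for i
    unfolding iid_sample_def using that by measurable
  have Bi: "{x \<in> space ?M. x i \<in> B} \<in> sets ?M" if "i \<in> {1..n}" for i
    using measurable_sets[OF m[OF that], of B] G(2) B by (simp add: vimage_def Int_def conj_commute)
  have "{x \<in> space ?M. \<exists>i\<in>{1..n}. x i \<in> B} = (\<Union>i\<in>{1..n}. {x \<in> space ?M. x i \<in> B})" by auto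
  also have "measure ?M \<dots> \<le> (\<Sum>i=1..n. measure ?M {x \<in> space ?M. x i \<in> B})"
    using Bi by (intro measure_UNION_le) auto
  also have "\<dots> = (\<Sum>i=1..n. measure G B)"
  proof (rule sum.cong[OF refl])
    fix i assume i: "i \<in> {1..n}"
    have "measure G B = measure (distr ?M G (\<lambda>x. x i)) B" using comp[OF i] by simp
    also have "\<dots> = measure ?M {x \<in> space ?M. x i \<in> B}"
      using m[OF i] B G(2) by (subst measure_distr) (auto simp: vimage_def Int_def conj_commute)
    finally show "measure ?M {x \<in> space ?M. x i \<in> B} = measure G B" by simp
  qed
  finally show ?thesis by simp
qed

section \<open>The bound for a fixed sample size\<close>

text \<open>Deconvolution at frequencies of modulus at most 1, followed by the dual bound on
  \<open>W1\<close> and \<open>lipschitz_difference_bound\<close> for the signed measure \<nu> -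
  \<nu>0.\<close>

lemma W1_le_trig_moments:
  assumes \<nu>: "\<nu> \<in> mixing_dists L" and \<nu>0: "\<nu>0 \<in> mixing_dists L"
    and L: "L > 0" and k: "k \<ge> 2" "real k \<ge> 2 * L"
    and cosb: "\<And>m::int. \<bar>m\<bar> \<le> int k \<Longrightarrow>
      \<bar>(\<integral>x. cos (m / k * x) \<partial>convolution \<nu> std_normal) - (\<integral>x. cos (m / k * x) \<partial>convolution \<nu>0 std_normal)\<bar> \<le> \<delta>"
    and sinb: "\<And>m::int. \<bar>m\<bar> \<le> int k \<Longrightarrow>
      \<bar>(\<integral>x. sin (m / k * x) \<partial>convolution \<nu> std_normal) - (\<integral>x. sin (m / k * x) \<partial>convolution \<nu>0 std_normal)\<bar> \<le> \<delta>"
  shows "W1 \<nu> \<nu>0 \<le> 44 * L / k + 8 * L * k * (2 * real k / L + 1) ^ k * (2 * \<delta>)"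
proof -
  obtain k1 w \<theta> where 1: "w \<in> weight_simplex k1" "\<theta> \<in> cube L k1" and \<nu>eq: "\<nu> = mixing k1 w \<theta>"
    using \<nu> by (auto elim: mixing_distsE)
  obtain k2 w' \<theta>' where 2: "w' \<in> weight_simplex k2" "\<theta>' \<in> cube L k2" and \<nu>0eq: "\<nu>0 = mixing k2 w' \<theta>'"
    using \<nu>0 by (auto elim: mixing_distsE)
  \<comment> \<open>The signed difference of the two mixtures, indexed by a disjoint union so that
    coinciding atoms need no care.\<close>
  define I where "I = {1..k1} <+> {1..k2}"
  define v where "v = case_sum w (\<lambda>h. - w' h)"
  define x where "x = case_sum \<theta> \<theta>'"
  have S: "(\<Sum>i\<in>I. v i * g (x i)) = (\<Sum>j=1..k1. w j * g (\<theta> j)) - (\<Sum>h=1..k2. w' h * g (\<theta>' h))" for g :: "real \<Rightarrow> real"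
    by (simp add: I_def v_def x_def sum.Plus sum_negf)
  have D: "(\<Sum>i\<in>I. v i * g (x i)) = (\<integral>t. g t \<partial>\<nu>) - (\<integral>t. g t \<partial>\<nu>0)" if "g \<in> borel_measurable borel" for g :: "real \<Rightarrow> real"
    unfolding S \<nu>eq \<nu>0eq integral_mixing[OF 1(1) that] integral_mixing[OF 2(1) that] ..
  \<comment> \<open>For \<open>|s| \<le> 1\<close> the Gaussian factor is at least 1 - s^2 / 2 and
    hence at least 1 / 2, so undoing the convolution at most doubles the error.\<close>
  have half: "\<bar>d\<bar> \<le> 2 * \<delta>" if "\<bar>exp (- s\<^sup>2 / 2) * d\<bar> \<le> \<delta>" "\<bar>s\<bar> \<le> 1" for s d :: real
  proof -
    have "s\<^sup>2 \<le> 1" using that(2) by (simp add: abs_square_le_1)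
    then have "1 / 2 \<le> 1 + - s\<^sup>2 / 2" by simp
    also have "\<dots> \<le> exp (- s\<^sup>2 / 2)" by (rule exp_ge_add_one_self)
    finally have "1 / 2 * \<bar>d\<bar> \<le> exp (- s\<^sup>2 / 2) * \<bar>d\<bar>" by (intro mult_right_mono) auto
    with that(1) show ?thesis by (simp add: abs_mult)
  qed
  have s1: "\<bar>real_of_int m / real k\<bar> \<le> 1" if "\<bar>m\<bar> \<le> int k" for m :: int
  proof -
    have "\<bar>real_of_int m\<bar> \<le> real k" using that by linarith
    then show ?thesis using k by simp
  qed
  have c: "\<bar>\<Sum>i\<in>I. v i * cos (m / k * x i)\<bar> \<le> 2 * \<delta>" if "\<bar>m\<bar> \<le> int k" for m :: int
  proof -
    have "(\<Sum>i\<in>I. v i * cos (m / k * x i)) = (\<integral>t. cos (m / k * t) \<partial>\<nu>) - (\<integral>t. cos (m / k * t) \<partial>\<nu>0)"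
      by (rule D) measurable
    moreover have "\<bar>exp (- (m / k)\<^sup>2 / 2) * ((\<integral>t. cos (m / k * t) \<partial>\<nu>) - (\<integral>t. cos (m / k * t) \<partial>\<nu>0))\<bar> \<le> \<delta>"
      using cosb[OF that] unfolding integral_normal_mixture_cos_sin[OF \<nu>] integral_normal_mixture_cos_sin[OF \<nu>0] right_diff_distrib .
    ultimately show ?thesis using half[OF _ s1[OF that]] by simp
  qed
  have s: "\<bar>\<Sum>i\<in>I. v i * sin (m / k * x i)\<bar> \<le> 2 * \<delta>" if "\<bar>m\<bar> \<le> int k" for m :: int
  proof -
    have "(\<Sum>i\<in>I. v i * sin (m / k * x i)) = (\<integral>t. sin (m / k * t) \<partial>\<nu>) - (\<integral>t. sin (m / k * t) \<partial>\<nu>0)"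
      by (rule D) measurable
    moreover have "\<bar>exp (- (m / k)\<^sup>2 / 2) * ((\<integral>t. sin (m / k * t) \<partial>\<nu>) - (\<integral>t. sin (m / k * t) \<partial>\<nu>0))\<bar> \<le> \<delta>"
      using sinb[OF that] unfolding integral_normal_mixture_cos_sin[OF \<nu>] integral_normal_mixture_cos_sin[OF \<nu>0] right_diff_distrib .
    ultimately show ?thesis using half[OF _ s1[OF that]] by simp
  qed
  have sw: "(\<Sum>j=1..k. \<bar>w j\<bar>) = 1" if "w \<in> weight_simplex k" for w k
  proof -
    have "(\<Sum>j=1..k. \<bar>w j\<bar>) = (\<Sum>j=1..k. w j)"
    proof (rule sum.cong[OF refl])
      fix j assume "j \<in> {1..k}"
      then have "w j \<in> {0..1}" using that by (auto simp: weight_simplex_def)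
      then show "\<bar>w j\<bar> = w j" by simp
    qed
    with that show ?thesis by (simp add: weight_simplex_def)
  qed
  have v: "(\<Sum>i\<in>I. \<bar>v i\<bar>) \<le> 2"
    using sw[OF 1(1)] sw[OF 2(1)] by (simp add: I_def v_def sum.Plus)
  have x: "\<bar>x i\<bar> \<le> L" if "i \<in> I" for i
    using that cube_abs_le[OF 1(2)] cube_abs_le[OF 2(2)] by (auto simp: I_def x_def)
  obtain f :: "real \<Rightarrow> real" where f: "\<And>s t. \<bar>f s - f t\<bar> \<le> \<bar>s - t\<bar>" "\<And>s. \<bar>s\<bar> \<le> L \<Longrightarrow> \<bar>f s\<bar> \<le> 2 * L"
    and W: "W1 \<nu> \<nu>0 \<le> (\<Sum>j=1..k1. w j * f (\<theta> j)) - (\<Sum>h=1..k2. w' h * f (\<theta>' h))"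
    using W1_le_lipschitz_difference[OF 1(1) 2(1) 1(2) 2(2)] unfolding \<nu>eq \<nu>0eq by blast
  have "\<bar>\<Sum>i\<in>I. v i * f (x i)\<bar> \<le> 44 * L / k + 8 * L * k * (2 * real k / L + 1) ^ k * (2 * \<delta>)"
    by (rule lipschitz_difference_bound[OF _ L k x v f c s]) (simp_all add: I_def)
  then show ?thesis using W unfolding S by linarith
qed

text \<open>The event \<open>A\<close> below is the acceptance region of a test of \<open>\<nu>0\<close> based on the empirical
  characteristic function.\<close>

lemma trig_moment_test:
  assumes \<nu>0: "\<nu>0 \<in> mixing_dists L" and n: "n \<ge> 1" and \<delta>: "\<delta> \<ge> 0"
  shows "\<exists>A\<in>sets (PiM {1..n} (\<lambda>_. lborel)). \<exists>V\<in>sets (mixing_space L).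
    measure (iid_sample n (convolution \<nu>0 std_normal)) (space (PiM {1..n} (\<lambda>_. lborel)) - A)
      \<le> (2 * real k + 1) * (4 * exp (- real n * \<delta>\<^sup>2 / 2)) \<and>
    (\<forall>\<nu>\<in>V. measure (iid_sample n (convolution \<nu> std_normal)) A \<le> 2 * exp (- real n * \<delta>\<^sup>2 / 2)) \<and>
    (\<forall>\<nu>\<in>mixing_dists L - V. \<forall>m::int. \<bar>m\<bar> \<le> int k \<longrightarrow>
      \<bar>(\<integral>x. cos (m / k * x) \<partial>convolution \<nu> std_normal) - (\<integral>x. cos (m / k * x) \<partial>convolution \<nu>0 std_normal)\<bar> \<le> 2 * \<delta> \<and>
      \<bar>(\<integral>x. sin (m / k * x) \<partial>convolution \<nu> std_normal) - (\<integral>x. sin (m / k * x) \<partial>convolution \<nu>0 std_normal)\<bar> \<le> 2 * \<delta>)"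
proof -
  let ?\<Lambda> = "PiM {1..n} (\<lambda>_. lborel :: real measure)"
  let ?P = "\<lambda>\<nu>. iid_sample n (convolution \<nu> std_normal)"
  define g :: "int \<times> bool \<Rightarrow> real \<Rightarrow> real" where
    "g z y = (if snd z then cos (real_of_int (fst z) / k * y) else sin (real_of_int (fst z) / k * y))" for z y
  \<comment> \<open>The flag chooses between cosine and sine. The union bound over \<open>J\<close>
    with Hoeffding's factor 2 gives \<open>(2 * real k + 1) * 4\<close>.\<close>
  define J where "J = {- int k..int k} \<times> (UNIV :: bool set)"
  have fJ: "finite J" "card J = (2 * k + 1) * 2" by (simp_all add: J_def card_cartesian_product)
  have g1: "\<bar>g z y\<bar> \<le> 1" for z y by (simp add: g_def)
  have gm[measurable]: "g z \<in> borel_measurable borel" for z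
    unfolding g_def[abs_def] by (cases "snd z") simp_all
  define E where "E z \<nu> = (\<integral>y. g z y \<partial>convolution \<nu> std_normal)" for z \<nu>
  define B where "B z = {x \<in> space ?\<Lambda>. \<bar>(\<Sum>i=1..n. g z (x i)) / n - E z \<nu>0\<bar> \<ge> \<delta>}" for z
  define A where "A = space ?\<Lambda> - (\<Union>z\<in>J. B z)"
  define V where "V = {\<nu> \<in> mixing_dists L. \<exists>z\<in>J. \<bar>E z \<nu> - E z \<nu>0\<bar> > 2 * \<delta>}"
  have Bm[measurable]: "B z \<in> sets ?\<Lambda>" for z unfolding B_def by measurable
  have Am: "A \<in> sets ?\<Lambda>" unfolding A_def using fJ(1) by (intro sets.Diff sets.top sets.finite_UN Bm)
  have sp: "space (?P \<nu>) = space ?\<Lambda>" "sets (?P \<nu>) = sets ?\<Lambda>" if "\<nu> \<in> mixing_dists L" for \<nu>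
    using that by (simp_all add: iid_sample_eq_density)
  have probP: "prob_space (?P \<nu>)" if "\<nu> \<in> mixing_dists L" for \<nu>
    unfolding iid_sample_def by (intro prob_space_PiM prob_space_normal_mixture[OF that])
  have H: "measure (?P \<nu>) {x \<in> space ?\<Lambda>. \<bar>(\<Sum>i=1..n. g z (x i)) / n - E z \<nu>\<bar> \<ge> \<delta>} \<le> 2 * exp (- real n * \<delta>\<^sup>2 / 2)"
    if "\<nu> \<in> mixing_dists L" for z \<nu>
    using iid_sample_Hoeffding[OF prob_space_normal_mixture[OF that] _ n \<delta> gm g1, of z]
    unfolding sp[OF that] E_def by simp
  \<comment> \<open>Measurability in \<nu> is available for integrals against \<nu> itself, so the
    integral against the convolution is rewritten before the measurability of \<open>V\<close> is
    shown.\<close>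
  have Eform: "E z \<nu> = exp (- (real_of_int (fst z) / k)\<^sup>2 / 2) * (\<integral>t. g z t \<partial>\<nu>)" if "\<nu> \<in> mixing_dists L" for z \<nu>
    unfolding E_def g_def by (cases "snd z") (simp_all only: if_True if_False integral_normal_mixture_cos_sin[OF that])
  have Em: "E z \<in> borel_measurable (mixing_space L)" for z
  proof -
    have "(\<lambda>\<nu>. exp (- (real_of_int (fst z) / k)\<^sup>2 / 2) * (\<integral>t. g z t \<partial>\<nu>)) \<in> borel_measurable (mixing_space L)"
      by (intro borel_measurable_times borel_measurable_const measurable_integral_mixing_space gm)
    also have "?this \<longleftrightarrow> ?thesis" by (rule measurable_cong) (simp add: space_mixing_space Eform)
    finally show ?thesis .
  qed
  have Vm: "V \<in> sets (mixing_space L)"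
  proof -
    have "V = (\<Union>z\<in>J. {\<nu> \<in> space (mixing_space L). \<bar>E z \<nu> - E z \<nu>0\<bar> > 2 * \<delta>})"
      by (auto simp: V_def space_mixing_space)
    moreover have "{\<nu> \<in> space (mixing_space L). \<bar>E z \<nu> - E z \<nu>0\<bar> > 2 * \<delta>} \<in> sets (mixing_space L)" for z
      using Em[of z] by measurable
    ultimately show ?thesis using fJ by (auto intro!: sets.finite_UN)
  qed
  have e1: "measure (?P \<nu>0) (space ?\<Lambda> - A) \<le> (2 * real k + 1) * (4 * exp (- real n * \<delta>\<^sup>2 / 2))"
  proof -
    interpret P: prob_space "?P \<nu>0" by (rule probP[OF \<nu>0])
    have "space ?\<Lambda> - A = (\<Union>z\<in>J. B z)" by (auto simp: A_def B_def)
    also have "measure (?P \<nu>0) \<dots> \<le> (\<Sum>z\<in>J. measure (?P \<nu>0) (B z))"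
      using fJ Bm sp(2)[OF \<nu>0] by (intro measure_UNION_le) auto
    also have "\<dots> \<le> (\<Sum>z\<in>J. 2 * exp (- real n * \<delta>\<^sup>2 / 2))"
      unfolding B_def by (intro sum_mono H \<nu>0)
    also have "\<dots> = (2 * real k + 1) * (4 * exp (- real n * \<delta>\<^sup>2 / 2))"
      using fJ by simp
    finally show ?thesis .
  qed
  have e2: "measure (?P \<nu>) A \<le> 2 * exp (- real n * \<delta>\<^sup>2 / 2)" if "\<nu> \<in> V" for \<nu>
  proof -
    obtain z where z: "\<nu> \<in> mixing_dists L" "z \<in> J" "\<bar>E z \<nu> - E z \<nu>0\<bar> > 2 * \<delta>" using \<open>\<nu> \<in> V\<close> by (auto simp: V_def)
    interpret P: prob_space "?P \<nu>" by (rule probP[OF z(1)])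
    \<comment> \<open>On \<open>A\<close> every empirical moment is within \<delta> of its value
      under \<nu>0. A moment of \<nu> off by more than \<open>2 * \<delta>\<close> is then missed by
      at least \<delta>; one such moment suffices, without a union bound.\<close>
    have "A \<subseteq> {x \<in> space ?\<Lambda>. \<bar>(\<Sum>i=1..n. g z (x i)) / n - E z \<nu>\<bar> \<ge> \<delta>}"
    proof
      fix x assume "x \<in> A"
      then have "x \<in> space ?\<Lambda>" "\<bar>(\<Sum>i=1..n. g z (x i)) / n - E z \<nu>0\<bar> < \<delta>"
        using z(2) by (auto simp: A_def B_def not_le)
      then show "x \<in> {x \<in> space ?\<Lambda>. \<bar>(\<Sum>i=1..n. g z (x i)) / n - E z \<nu>\<bar> \<ge> \<delta>}" using z(3) by auto
    qed
    then have "measure (?P \<nu>) A \<le> measure (?P \<nu>) {x \<in> space ?\<Lambda>. \<bar>(\<Sum>i=1..n. g z (x i)) / n - E z \<nu>\<bar> \<ge> \<delta>}"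
      using sp(2)[OF z(1)] by (intro P.finite_measure_mono) (auto simp del: One_nat_def)
    also have "\<dots> \<le> 2 * exp (- real n * \<delta>\<^sup>2 / 2)" by (rule H[OF z(1)])
    finally show ?thesis .
  qed
  have e3: "\<bar>(\<integral>x. cos (m / k * x) \<partial>convolution \<nu> std_normal) - (\<integral>x. cos (m / k * x) \<partial>convolution \<nu>0 std_normal)\<bar> \<le> 2 * \<delta> \<and>
      \<bar>(\<integral>x. sin (m / k * x) \<partial>convolution \<nu> std_normal) - (\<integral>x. sin (m / k * x) \<partial>convolution \<nu>0 std_normal)\<bar> \<le> 2 * \<delta>"
    if "\<nu> \<in> mixing_dists L - V" "\<bar>m\<bar> \<le> int k" for \<nu> and m :: int
  proof -
    have "\<bar>E z \<nu> - E z \<nu>0\<bar> \<le> 2 * \<delta>" if "z \<in> J" for z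
      using \<open>\<nu> \<in> mixing_dists L - V\<close> that by (auto simp: V_def not_less)
    moreover have "- int k \<le> m" "m \<le> int k" using that(2) by linarith+
    ultimately have "\<bar>E (m, b) \<nu> - E (m, b) \<nu>0\<bar> \<le> 2 * \<delta>" for b by (simp add: J_def)
    from this[of True] this[of False] show ?thesis by (simp add: E_def g_def)
  qed
  show ?thesis using Am Vm e1 e2 e3 by blast
qed

text \<open>Combines test and evidence, leaving only numerical conditions on the frequency number
  \<open>k\<close>, the test level \<delta>, the truncation \<open>R\<close>, the number
  \<open>m\<close> of matched integrals and the radius \<eta>. The three terms of the bound are the
  rejection of the truth, a large observation, and the accepted alternatives divided by the
  evidence.\<close>

lemma posterior_contraction_bound:
  assumes L: "L > 0" and n: "n \<ge> 1" and \<nu>0: "\<nu>0 \<in> mixing_dists L"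
    and spec: "prior_spec L K T W"
    and k: "k \<ge> 2" "real k \<ge> 2 * L" and \<delta>: "\<delta> \<ge> 0"
    and rate: "44 * L / k + 8 * L * k * (2 * real k / L + 1) ^ k * (4 * \<delta>) < \<epsilon>"
    and err: "2 * (exp (R * L) * (R * L) ^ m / fact m) + \<eta> * (1 + R + L) * exp (R * L) \<le> exp (- (R * L) - L\<^sup>2 / 2) / (2 * n)"
    and pK: "p\<^sub>K \<le> measure K {Suc m}" "p\<^sub>K > 0"
    and pW: "\<And>w0. w0 \<in> weight_simplex (Suc m) \<Longrightarrow>
      p\<^sub>W \<le> measure (W (Suc m)) {w \<in> weight_simplex (Suc m). (\<Sum>j=1..Suc m. \<bar>w j - w0 j\<bar>) \<le> \<eta>}" "p\<^sub>W > 0"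
    and pT: "\<And>\<theta>0. \<theta>0 \<in> cube L (Suc m) \<Longrightarrow>
      p\<^sub>T \<le> measure (T (Suc m)) {\<theta> \<in> cube L (Suc m). (MAX j\<in>{1..Suc m}. \<bar>\<theta> j - \<theta>0 j\<bar>) \<le> \<eta>}" "p\<^sub>T > 0"
  shows "(\<integral>x. measure (posterior n (prior L K T W) x) {\<nu> \<in> mixing_dists L. W1 \<nu> \<nu>0 \<ge> \<epsilon>}
      \<partial>iid_sample n (convolution \<nu>0 std_normal))
    \<le> (2 * real k + 1) * (4 * exp (- real n * \<delta>\<^sup>2 / 2)) + n * (2 * exp (2 * L + 2 - 2 * R))
      + 2 * exp (- real n * \<delta>\<^sup>2 / 2) / (p\<^sub>K * p\<^sub>T * p\<^sub>W / 2)"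
proof -
  let ?\<Lambda> = "PiM {1..n} (\<lambda>_. lborel :: real measure)"
  let ?P = "iid_sample n (convolution \<nu>0 std_normal)"
  let ?Q = "prior L K T W"
  obtain A V where A: "A \<in> sets ?\<Lambda>" and V: "V \<in> sets (mixing_space L)"
    and e1: "measure ?P (space ?\<Lambda> - A) \<le> (2 * real k + 1) * (4 * exp (- real n * \<delta>\<^sup>2 / 2))"
    and e2: "\<And>\<nu>. \<nu> \<in> V \<Longrightarrow> measure (iid_sample n (convolution \<nu> std_normal)) A \<le> 2 * exp (- real n * \<delta>\<^sup>2 / 2)"
    and e3: "\<And>\<nu> m::int. \<nu> \<in> mixing_dists L - V \<Longrightarrow> \<bar>m\<bar> \<le> int k \<Longrightarrow>
      \<bar>(\<integral>x. cos (m / k * x) \<partial>convolution \<nu> std_normal) - (\<integral>x. cos (m / k * x) \<partial>convolution \<nu>0 std_normal)\<bar> \<le> 2 * \<delta> \<and>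
      \<bar>(\<integral>x. sin (m / k * x) \<partial>convolution \<nu> std_normal) - (\<integral>x. sin (m / k * x) \<partial>convolution \<nu>0 std_normal)\<bar> \<le> 2 * \<delta>"
    using trig_moment_test[OF \<nu>0 n \<delta>, of k] by blast
  have VV: "{\<nu> \<in> mixing_dists L. W1 \<nu> \<nu>0 \<ge> \<epsilon>} \<subseteq> V"
  proof
    fix \<nu> assume "\<nu> \<in> {\<nu> \<in> mixing_dists L. W1 \<nu> \<nu>0 \<ge> \<epsilon>}"
    then have \<nu>: "\<nu> \<in> mixing_dists L" "W1 \<nu> \<nu>0 \<ge> \<epsilon>" by auto
    show "\<nu> \<in> V"
    proof (rule ccontr)
      assume "\<nu> \<notin> V"
      with \<nu> have d: "\<nu> \<in> mixing_dists L - V" by simp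
      have "W1 \<nu> \<nu>0 \<le> 44 * L / k + 8 * L * k * (2 * real k / L + 1) ^ k * (2 * (2 * \<delta>))"
        \<comment> \<open>Unrejected mixtures have moments within \<open>2 * \<delta>\<close>, and
          deconvolution doubles this; hence \<open>4 * \<delta>\<close> in
          \<open>rate\<close>.\<close>
        by (rule W1_le_trig_moments[OF \<nu>(1) \<nu>0 L k]) (use e3[OF d] in blast)+
      with rate \<nu>(2) show False by simp
    qed
  qed
  obtain k0 w0 \<theta>0 where 0: "k0 \<ge> 1" "w0 \<in> weight_simplex k0" "\<theta>0 \<in> cube L k0" and \<nu>0eq: "\<nu>0 = mixing k0 w0 \<theta>0"
    using \<nu>0 by (auto elim: mixing_distsE)
  obtain w' \<theta>' where w': "w' \<in> weight_simplex (Suc m)" and \<theta>': "\<theta>' \<in> cube L (Suc m)"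
    and match: "\<And>l. l < m \<Longrightarrow> (\<Sum>j=1..Suc m. w' j * (\<theta>' j ^ l * exp (- (\<theta>' j)\<^sup>2 / 2)))
      = (\<Sum>j=1..k0. w0 j * (\<theta>0 j ^ l * exp (- (\<theta>0 j)\<^sup>2 / 2)))"
    using moment_matching[OF 0(2,3), of m "\<lambda>l t. t ^ l * exp (- t\<^sup>2 / 2)"] L by (auto simp del: sum.cl_ivl_Suc)
  define B\<^sub>1 where "B\<^sub>1 = {\<theta> \<in> cube L (Suc m). (MAX j\<in>{1..Suc m}. \<bar>\<theta> j - \<theta>' j\<bar>) \<le> \<eta>}"
  define B\<^sub>2 where "B\<^sub>2 = {w \<in> weight_simplex (Suc m). (\<Sum>j=1..Suc m. \<bar>w j - w' j\<bar>) \<le> \<eta>}"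
  define G where "G = {x \<in> space ?\<Lambda>. \<forall>i\<in>{1..n}. \<bar>x i\<bar> \<le> R}"
  have Gm: "G \<in> sets ?\<Lambda>" unfolding G_def by measurable
  \<comment> \<open>Prior mass of the neighbourhood of the matched mixture, times the likelihood
    ratio 1 / 2 on it.\<close>
  define c where "c = p\<^sub>K * p\<^sub>T * p\<^sub>W / 2"
  have c: "c > 0" using pK pT pW by (simp add: c_def)
  have evid: "c * likelihood n \<nu>0 x \<le> (\<integral>\<nu>. likelihood n \<nu> x \<partial>?Q)" if x: "x \<in> G" for x
  proof -
    have l0: "likelihood n \<nu>0 x > 0" by (rule likelihood_bounds[OF \<nu>0])
    have "p\<^sub>K * p\<^sub>T * p\<^sub>W \<le> measure K {Suc m} * measure (T (Suc m)) B\<^sub>1 * measure (W (Suc m)) B\<^sub>2"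
      using pK pT(2) pT(1)[OF \<theta>'] pW(2) pW(1)[OF w'] unfolding B\<^sub>1_def[symmetric] B\<^sub>2_def[symmetric]
      by (intro mult_mono) auto
    then have "c * likelihood n \<nu>0 x \<le> likelihood n \<nu>0 x / 2 *
        (measure K {Suc m} * measure (T (Suc m)) B\<^sub>1 * measure (W (Suc m)) B\<^sub>2)"
      unfolding c_def using mult_right_mono[of _ _ "likelihood n \<nu>0 x / 2"] l0 by (simp add: mult.commute)
    also have "\<dots> \<le> (\<integral>\<nu>. likelihood n \<nu> x \<partial>?Q)"
    proof (rule evidence_lower_bound[OF spec])
      fix \<theta> w assume \<theta>w: "\<theta> \<in> B\<^sub>1" "w \<in> B\<^sub>2"
      then have \<theta>: "\<theta> \<in> cube L (Suc m)" and w: "w \<in> weight_simplex (Suc m)"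
        and dw: "(\<Sum>j=1..Suc m. \<bar>w j - w' j\<bar>) \<le> \<eta>" by (auto simp: B\<^sub>1_def B\<^sub>2_def)
      have d\<theta>: "\<bar>\<theta> j - \<theta>' j\<bar> \<le> \<eta>" if "j \<in> {1..Suc m}" for j
      proof -
        have "\<bar>\<theta> j - \<theta>' j\<bar> \<le> (MAX j\<in>{1..Suc m}. \<bar>\<theta> j - \<theta>' j\<bar>)" using that by (intro Max_ge) auto
        also have "\<dots> \<le> \<eta>" using \<theta>w(1) by (simp add: B\<^sub>1_def)
        finally show ?thesis .
      qed
      show "likelihood n \<nu>0 x / 2 \<le> likelihood n (mixing (Suc m) w \<theta>) x"
        unfolding \<nu>0eq
      proof (rule likelihood_lower_bound[OF 0(2,3,1) w \<theta> _ n])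
        show "\<bar>x i\<bar> \<le> R" if "i \<in> {1..n}" for i using x that by (auto simp: G_def)
        show "2 * (exp (R * L) * (R * L) ^ m / fact m) + \<eta> * (1 + R + L) * exp (R * L) \<le> exp (- (R * L) - L\<^sup>2 / 2) / (2 * n)"
          by (rule err)
        fix y assume y: "\<bar>y\<bar> \<le> R"
        show "\<bar>(\<Sum>j=1..Suc m. w j * exp (y * \<theta> j - (\<theta> j)\<^sup>2 / 2)) - (\<Sum>j=1..k0. w0 j * exp (y * \<theta>0 j - (\<theta>0 j)\<^sup>2 / 2))\<bar>
           \<le> 2 * (exp (R * L) * (R * L) ^ m / fact m) + \<eta> * (1 + R + L) * exp (R * L)"
        proof -
          have "\<bar>(\<Sum>j=1..Suc m. w' j * exp (y * \<theta>' j - (\<theta>' j)\<^sup>2 / 2)) - (\<Sum>j=1..k0. w0 j * exp (y * \<theta>0 j - (\<theta>0 j)\<^sup>2 / 2))\<bar>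
              \<le> 2 * (exp (R * L) * (R * L) ^ m / fact m)"
            by (rule matched_mixture_error[OF 0(2,3) w' \<theta>' y]) (rule match)
          moreover have "\<bar>(\<Sum>j=1..Suc m. w j * exp (y * \<theta> j - (\<theta> j)\<^sup>2 / 2)) - (\<Sum>j=1..Suc m. w' j * exp (y * \<theta>' j - (\<theta>' j)\<^sup>2 / 2))\<bar>
              \<le> \<eta> * (1 + R + L) * exp (R * L)"
            by (rule perturbed_mixture_error[OF w \<theta> w' \<theta>' y dw]) (rule d\<theta>)
          ultimately show ?thesis by linarith
        qed
      qed simp
    qed (use l0 in auto)
    finally show ?thesis .
  qed
  have g: "measure ?P (space ?\<Lambda> - G) \<le> n * (2 * exp (2 * L + 2 - 2 * R))"
  proof -
    have sp: "space ?P = space ?\<Lambda>" using \<nu>0 by (simp add: iid_sample_eq_density)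
    have "space ?\<Lambda> - G = {x \<in> space ?P. \<exists>i\<in>{1..n}. x i \<in> {y. \<bar>y\<bar> > R}}"
      unfolding sp G_def by (force simp: not_le)
    also have "measure ?P \<dots> \<le> n * measure (convolution \<nu>0 std_normal) {y. \<bar>y\<bar> > R}"
      by (intro iid_sample_union_bound prob_space_normal_mixture[OF \<nu>0]) auto
    also have "\<dots> \<le> n * (2 * exp (2 * L + 2 - 2 * R))"
      by (intro mult_left_mono normal_mixture_tail[OF \<nu>0]) simp
    finally show ?thesis .
  qed
  have Q: "prob_space ?Q" "sets ?Q = sets (mixing_space L)"
    using prior_in_space[OF spec] by (auto simp: space_prob_algebra)
  have "(\<integral>x. measure (posterior n ?Q x) {\<nu> \<in> mixing_dists L. W1 \<nu> \<nu>0 \<ge> \<epsilon>} \<partial>?P)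
    \<le> measure ?P (space ?\<Lambda> - A) + measure ?P (space ?\<Lambda> - G) + 2 * exp (- real n * \<delta>\<^sup>2 / 2) / c"
    by (rule posterior_bound[OF \<nu>0 Q A Gm c evid V e2 VV]) auto
  with e1 g show ?thesis unfolding c_def by linarith
qed

section \<open>Asymptotics\<close>

text \<open>The inequality m^m / m! \<le> e^m holds because the left side is one term of the
  exponential series; the factor e^(-2) in the hypothesis then leaves e^(-m).\<close>

lemma power_div_fact_le:
  fixes x :: real
  assumes "0 \<le> x" "x \<le> exp (-2) * real m" "m \<ge> 1"
  shows "x ^ m / fact m \<le> exp (- real m)"
proof -
  have "real m ^ m / fact m \<le> exp (real m)"
  proof -
    have "(\<lambda>i. real m ^ i /\<^sub>R fact i) sums exp (real m)" by (rule exp_converges)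
    then have s: "summable (\<lambda>i. real m ^ i /\<^sub>R fact i)" "exp (real m) = (\<Sum>i. real m ^ i /\<^sub>R fact i)"
      by (simp_all add: sums_iff)
    have "(\<Sum>i\<in>{m}. real m ^ i /\<^sub>R fact i) \<le> (\<Sum>i. real m ^ i /\<^sub>R fact i)"
      by (rule sum_le_suminf[OF s(1)]) auto
    then show ?thesis using s(2) by (simp add: divide_inverse mult.commute)
  qed
  have "x ^ m / fact m \<le> (exp (-2) * real m) ^ m / fact m"
    using assms by (intro divide_right_mono power_mono) auto
  also have "\<dots> = exp (-2) ^ m * (real m ^ m / fact m)" by (simp add: power_mult_distrib)
  also have "\<dots> \<le> exp (-2) ^ m * exp (real m)"
    using \<open>real m ^ m / fact m \<le> exp (real m)\<close> by (intro mult_left_mono) auto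
  also have "\<dots> = exp (- real m)" by (simp add: exp_of_nat_mult[symmetric] exp_add[symmetric])
  finally show ?thesis .
qed

text \<open>The choice R = l, \<eta> = exp (- l^2) and n = exp l. The conditions on \<open>l\<close>
  and \<open>m\<close> give \<open>l * L \<le> exp (-2) * m\<close>, so the series remainder and the
  perturbation are both of order exp (- l^2), up to factors that \<open>big\<close> absorbs.\<close>

lemma approximation_error_bound:
  assumes L: "L > 0" and l: "l \<ge> exp 2 * L" "l > 0" and m: "real m \<ge> l\<^sup>2"
    and big: "2 * (3 + l + L) \<le> exp (l\<^sup>2 - 2 * l * L - L\<^sup>2 / 2 - l)"
  shows "2 * (exp (l * L) * (l * L) ^ m / fact m) + exp (- l\<^sup>2) * (1 + l + L) * exp (l * L)
    \<le> exp (- (l * L) - L\<^sup>2 / 2) / (2 * exp l)"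
proof -
  have m1: "m \<ge> 1" using m l(2) by (cases m) auto
  have "L \<le> exp (-2) * l" using l(1) by (simp add: exp_minus field_simps)
  then have "l * L \<le> l * (exp (-2) * l)" using l(2) by (intro mult_left_mono) auto
  also have "\<dots> = exp (-2) * l\<^sup>2" by (simp add: power2_eq_square)
  also have "\<dots> \<le> exp (-2) * real m" using m by (intro mult_left_mono) auto
  finally have "(l * L) ^ m / fact m \<le> exp (- real m)"
    using l L m1 by (intro power_div_fact_le) auto
  also have "\<dots> \<le> exp (- l\<^sup>2)" using m by simp
  finally have f: "(l * L) ^ m / fact m \<le> exp (- l\<^sup>2)" .
  have "2 * (exp (l * L) * (l * L) ^ m / fact m) = 2 * exp (l * L) * ((l * L) ^ m / fact m)" by simp
  also have "\<dots> \<le> 2 * exp (l * L) * exp (- l\<^sup>2)" using f by (intro mult_left_mono) auto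
  finally have "2 * (exp (l * L) * (l * L) ^ m / fact m) + exp (- l\<^sup>2) * (1 + l + L) * exp (l * L)
    \<le> 2 * exp (l * L) * exp (- l\<^sup>2) + exp (- l\<^sup>2) * (1 + l + L) * exp (l * L)" by (rule add_right_mono)
  also have "\<dots> = exp (l * L) * exp (- l\<^sup>2) * (2 * (3 + l + L)) / 2" by (simp add: algebra_simps)
  also have "\<dots> \<le> exp (l * L) * exp (- l\<^sup>2) * exp (l\<^sup>2 - 2 * l * L - L\<^sup>2 / 2 - l) / 2"
    using big by (intro divide_right_mono mult_left_mono) auto
  also have "\<dots> = exp (- (l * L) - L\<^sup>2 / 2) / (2 * exp l)"
    by (simp add: exp_add[symmetric] exp_diff[symmetric] field_simps)
  finally show ?thesis .
qed

text \<open>The divisor 8 gives \<open>k * ll \<le> l / 8\<close>, so the power is at most exp (l /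
  8) and the test level exp (- l / 4) leaves exp (- l / 8). Rounding costs a factor at most 2, so
  \<open>44 * L / k\<close> is at most 44 * 16 = 704 times \<open>L * (ll / l)\<close>; the summand
  1 in the constant absorbs the exponentially small term.\<close>

lemma rate_bound:
  assumes L: "L > 0" and l: "l > 0" and ll: "ll = ln l" "ll > 0" and k: "k = nat \<lfloor>l / (8 * ll)\<rfloor>"
    and big: "l / (8 * ll) \<ge> 2" "2 * (l / (8 * ll)) / L + 1 \<le> l" "8 * ll \<ge> 1"
    and small: "32 * L * l * exp (- l / 8) < ll / l"
  shows "44 * L / k + 8 * L * k * (2 * real k / L + 1) ^ k * (4 * exp (- l / 4)) < (704 * L + 1) * (ll / l)"
proof -
  define y where "y = l / (8 * ll)"
  have y: "real k \<le> y" "real k \<ge> y - 1" "y \<ge> 2"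
    using big(1) unfolding k y_def[symmetric] by linarith+
  have "real k \<ge> y / 2" using y by simp
  then have "44 * L / k \<le> 44 * L / (y / 2)"
    using L y by (intro divide_left_mono) auto
  also have "\<dots> = 704 * L * (ll / l)" using l ll by (simp add: y_def)
  finally have 1: "44 * L / k \<le> 704 * L * (ll / l)" .
  have kl: "real k \<le> l"
  proof -
    have "y \<le> l / 1" unfolding y_def using l big(3) by (intro divide_left_mono) auto
    then show ?thesis using y by simp
  qed
  have "2 * real k / L + 1 \<le> 2 * y / L + 1"
    using y L by (intro add_mono divide_right_mono) auto
  also have "\<dots> \<le> l" using big(2) by (simp add: y_def)
  finally have "(2 * real k / L + 1) ^ k \<le> l ^ k" using L by (intro power_mono) auto
  also have "\<dots> = exp (real k * ll)" using l ll by (simp add: exp_of_nat_mult)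
  also have "\<dots> \<le> exp (l / 8)"
  proof -
    have "real k * ll \<le> y * ll" using y ll by (intro mult_right_mono) auto
    then show ?thesis using ll by (simp add: y_def)
  qed
  finally have "8 * L * k * (2 * real k / L + 1) ^ k * (4 * exp (- l / 4)) \<le> 8 * L * l * exp (l / 8) * (4 * exp (- l / 4))"
    using L l kl by (intro mult_mono mult_nonneg_nonneg) auto
  also have "\<dots> = 32 * L * l * (exp (l / 8) * exp (- l / 4))" by simp
  also have "exp (l / 8) * exp (- l / 4) = exp (- l / 8)" by (simp add: exp_add[symmetric])
  also note small
  finally show ?thesis unfolding distrib_right mult_1_left by (rule add_le_less_mono[OF 1])
qed

lemma posterior_contraction_explicit:
  fixes L c\<^sub>1 c\<^sub>2 b\<^sub>0 c\<^sub>4 c\<^sub>5 c\<^sub>6 c\<^sub>7 :: real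
  assumes L: "L > 0" and n: "n \<ge> (2::nat)"
    and c: "c\<^sub>1 > 0" "c\<^sub>2 > 0" "c\<^sub>4 > 0" "c\<^sub>5 > 0" "c\<^sub>6 > 0" "c\<^sub>7 > 0"
    and spec: "prior_spec L K T W"
    and P1: "\<And>k. k \<ge> 1 \<Longrightarrow> measure K {k} \<ge> c\<^sub>1 * exp (- (c\<^sub>2 * ln (real n) powr b\<^sub>0) * real k)"
    and P2: "\<And>k w0 \<eta>. k \<ge> 1 \<Longrightarrow> w0 \<in> weight_simplex k \<Longrightarrow> \<eta> \<in> {0<..<1 / real k} \<Longrightarrow>
      measure (W k) {w \<in> weight_simplex k. (\<Sum>j=1..k. \<bar>w j - w0 j\<bar>) \<le> \<eta>} \<ge> c\<^sub>4 * \<eta> powr (c\<^sub>5 * real k)"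
    and P3: "\<And>k \<theta>0 \<eta>. k \<ge> 1 \<Longrightarrow> \<theta>0 \<in> cube L k \<Longrightarrow> \<eta> \<in> {0<..<1 / real k} \<Longrightarrow>
      measure (T k) {\<theta> \<in> cube L k. (MAX j\<in>{1..k}. \<bar>\<theta> j - \<theta>0 j\<bar>) \<le> \<eta>} \<ge> c\<^sub>6 * \<eta> powr (c\<^sub>7 * real k)"
    and \<nu>0: "\<nu>0 \<in> mixing_dists L"
    and l: "l = ln (real n)" and ll: "ll = ln l"
    and big: "ll > 0" "l / (8 * ll) \<ge> 2" "l / (8 * ll) \<ge> 2 * L + 1" "2 * (l / (8 * ll)) / L + 1 \<le> l" "8 * ll \<ge> 1"
      "32 * L * l * exp (- l / 8) < ll / l" "l \<ge> exp 2 * L" "l \<ge> 2"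
      "2 * (3 + l + L) \<le> exp (l\<^sup>2 - 2 * l * L - L\<^sup>2 / 2 - l)" "l\<^sup>2 + 2 < exp (l\<^sup>2)"
  shows "(\<integral>x. measure (posterior n (prior L K T W) x) {\<nu> \<in> mixing_dists L. W1 \<nu> \<nu>0 \<ge> (704 * L + 1) * (ll / l)}
      \<partial>iid_sample n (convolution \<nu>0 std_normal))
    \<le> (2 * l + 1) * (4 * exp (- sqrt n / 2)) + 2 * exp (2 * L + 2) / n
      + 4 / (c\<^sub>1 * c\<^sub>6 * c\<^sub>4) * exp (2 * c\<^sub>2 * l powr b\<^sub>0 * l\<^sup>2 + 2 * (c\<^sub>5 + c\<^sub>7) * l ^ 4 - sqrt n / 2)"
proof -
  have n0: "real n > 0" using n by simp
  have l0: "l > 0" using big by simp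
  have nl: "exp l = n" using n0 by (simp add: l)
  define k where "k = nat \<lfloor>l / (8 * ll)\<rfloor>"
  \<comment> \<open>Of order l^2 rather than l, so that the series error beats exp (- C l) for every
    constant \<open>C\<close>; the price is only polylogarithmic in the evidence.\<close>
  define m where "m = nat \<lceil>l\<^sup>2\<rceil>"
  define \<eta> where "\<eta> = exp (- l\<^sup>2)"
  define \<delta> where "\<delta> = exp (- l / 4)"
  have k: "k \<ge> 2" "real k \<ge> 2 * L" "real k \<le> l"
  proof -
    have y: "real k \<le> l / (8 * ll)" "real k \<ge> l / (8 * ll) - 1"
      using big(2) unfolding k_def by linarith+
    show "real k \<ge> 2 * L" using y(2) big(3) by linarith
    show "k \<ge> 2" using big(2) unfolding k_def by linarith
    have "l / (8 * ll) \<le> l / 1" using l0 big(5) by (intro divide_left_mono) auto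
    with y show "real k \<le> l" by simp
  qed
  have l2: "l\<^sup>2 \<ge> 4" using power_mono[of 2 l 2] big(8) by simp
  have m: "real m \<ge> l\<^sup>2" "real (Suc m) \<le> l\<^sup>2 + 2"
    using l2 unfolding m_def by linarith+
  then have m2: "real (Suc m) \<le> 2 * l\<^sup>2" using l2 by linarith
  \<comment> \<open>The radius must lie in the range in which the small-ball conditions on weights
    and atoms are assumed.\<close>
  have \<eta>: "\<eta> \<in> {0<..<1 / real (Suc m)}"
  proof -
    have "real (Suc m) < exp (l\<^sup>2)" using m big(10) by linarith
    then have "1 / exp (l\<^sup>2) < 1 / real (Suc m)" by (intro divide_strict_left_mono) auto
    then show ?thesis by (simp add: \<eta>_def exp_minus divide_inverse)
  qed
  \<comment> \<open>With \<delta> = n^(-1/4) the Hoeffding exponent is a power of n, larger than any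
    power of \<open>l\<close>.\<close>
  have nd: "real n * \<delta>\<^sup>2 = sqrt n"
  proof -
    have "(exp (l / 2))\<^sup>2 = real n" by (simp add: exp_double[symmetric] nl)
    then have "sqrt n = exp (l / 2)" by (metis exp_ge_zero real_sqrt_abs abs_of_nonneg)
    moreover have "real n * \<delta>\<^sup>2 = exp (l + (- l / 4 + - l / 4))"
      unfolding exp_add nl by (simp add: \<delta>_def power2_eq_square)
    ultimately show ?thesis by (simp add: field_simps)
  qed
  define p\<^sub>K where "p\<^sub>K = c\<^sub>1 * exp (- (c\<^sub>2 * l powr b\<^sub>0) * real (Suc m))"
  define p\<^sub>W where "p\<^sub>W = c\<^sub>4 * \<eta> powr (c\<^sub>5 * real (Suc m))"
  define p\<^sub>T where "p\<^sub>T = c\<^sub>6 * \<eta> powr (c\<^sub>7 * real (Suc m))"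
  have p0: "p\<^sub>K > 0" "p\<^sub>W > 0" "p\<^sub>T > 0" using c by (simp_all add: p\<^sub>K_def p\<^sub>W_def p\<^sub>T_def \<eta>_def)
  have "(\<integral>x. measure (posterior n (prior L K T W) x) {\<nu> \<in> mixing_dists L. W1 \<nu> \<nu>0 \<ge> (704 * L + 1) * (ll / l)}
      \<partial>iid_sample n (convolution \<nu>0 std_normal))
    \<le> (2 * real k + 1) * (4 * exp (- real n * \<delta>\<^sup>2 / 2)) + n * (2 * exp (2 * L + 2 - 2 * l))
      + 2 * exp (- real n * \<delta>\<^sup>2 / 2) / (p\<^sub>K * p\<^sub>T * p\<^sub>W / 2)"
  proof (rule posterior_contraction_bound[OF L _ \<nu>0 spec k(1,2)])
    show "44 * L / k + 8 * L * k * (2 * real k / L + 1) ^ k * (4 * \<delta>) < (704 * L + 1) * (ll / l)"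
      unfolding \<delta>_def using rate_bound[OF L l0 ll big(1) k_def big(2,4,5,6)] .
    show "2 * (exp (l * L) * (l * L) ^ m / fact m) + \<eta> * (1 + l + L) * exp (l * L) \<le> exp (- (l * L) - L\<^sup>2 / 2) / (2 * n)"
      using approximation_error_bound[OF L big(7) l0 m(1) big(9)] unfolding nl \<eta>_def by simp
    show "p\<^sub>K \<le> measure K {Suc m}" using P1[of "Suc m"] by (simp add: p\<^sub>K_def l)
    show "p\<^sub>W \<le> measure (W (Suc m)) {w \<in> weight_simplex (Suc m). (\<Sum>j=1..Suc m. \<bar>w j - w0 j\<bar>) \<le> \<eta>}"
      if "w0 \<in> weight_simplex (Suc m)" for w0
      unfolding p\<^sub>W_def by (rule P2[OF _ that \<eta>]) simp
    show "p\<^sub>T \<le> measure (T (Suc m)) {\<theta> \<in> cube L (Suc m). (MAX j\<in>{1..Suc m}. \<bar>\<theta> j - \<theta>0 j\<bar>) \<le> \<eta>}"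
      if "\<theta>0 \<in> cube L (Suc m)" for \<theta>0
      unfolding p\<^sub>T_def by (rule P3[OF _ that \<eta>]) simp
  qed (use p0 n in \<open>auto simp: \<delta>_def\<close>)
  also have "(2 * real k + 1) * (4 * exp (- real n * \<delta>\<^sup>2 / 2)) \<le> (2 * l + 1) * (4 * exp (- sqrt n / 2))"
    using k nd by (intro mult_mono) auto
  also have "n * (2 * exp (2 * L + 2 - 2 * l)) = 2 * exp (2 * L + 2) / n"
  proof -
    have "exp (2 * L + 2 - 2 * l) = exp (2 * L + 2) / (real n)\<^sup>2"
      unfolding exp_diff nl[symmetric] by (simp add: exp_double)
    then show ?thesis using n0 by (simp add: power2_eq_square)
  qed
  also have "2 * exp (- real n * \<delta>\<^sup>2 / 2) / (p\<^sub>K * p\<^sub>T * p\<^sub>W / 2)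
    \<le> 4 / (c\<^sub>1 * c\<^sub>6 * c\<^sub>4) * exp (2 * c\<^sub>2 * l powr b\<^sub>0 * l\<^sup>2 + 2 * (c\<^sub>5 + c\<^sub>7) * l ^ 4 - sqrt n / 2)"
  proof -
    \<comment> \<open>The exponential cost of the evidence per component:
      \<open>c\<^sub>2 * l powr b\<^sub>0\<close> for the number of components, and
      \<open>l\<^sup>2\<close>, the negative logarithm of the radius, for weights and atoms.
      Multiplied by \<open>Suc m \<le> 2 * l\<^sup>2\<close> it stays polylogarithmic in n.\<close>
    define a where "a = c\<^sub>2 * l powr b\<^sub>0 + (c\<^sub>5 + c\<^sub>7) * l\<^sup>2"
    have a0: "a \<ge> 0" using c by (simp add: a_def)
    have "p\<^sub>K * p\<^sub>T * p\<^sub>W = (c\<^sub>1 * c\<^sub>6 * c\<^sub>4) * (exp (- (c\<^sub>2 * l powr b\<^sub>0) * real (Suc m))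
        * (exp (- l\<^sup>2 * (c\<^sub>7 * real (Suc m))) * exp (- l\<^sup>2 * (c\<^sub>5 * real (Suc m)))))"
      unfolding p\<^sub>K_def p\<^sub>T_def p\<^sub>W_def \<eta>_def exp_powr_real by (simp only: mult_ac)
    also have "\<dots> = (c\<^sub>1 * c\<^sub>6 * c\<^sub>4) * exp (- a * real (Suc m))"
      unfolding exp_add[symmetric] a_def by (intro arg_cong2[where f = "(*)"] arg_cong[where f = exp] refl) algebra
    finally have p: "p\<^sub>K * p\<^sub>T * p\<^sub>W = (c\<^sub>1 * c\<^sub>6 * c\<^sub>4) * exp (- a * real (Suc m))" .
    have "2 * exp (- real n * \<delta>\<^sup>2 / 2) / (p\<^sub>K * p\<^sub>T * p\<^sub>W / 2) = 4 / (c\<^sub>1 * c\<^sub>6 * c\<^sub>4) * (exp (a * real (Suc m)) * exp (- sqrt n / 2))"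
      unfolding p mult_minus_left exp_minus[of "a * _"] using nd c by (simp add: field_simps)
    also have "\<dots> = 4 / (c\<^sub>1 * c\<^sub>6 * c\<^sub>4) * exp (a * real (Suc m) - sqrt n / 2)"
      by (simp add: exp_add[symmetric])
    also have "\<dots> \<le> 4 / (c\<^sub>1 * c\<^sub>6 * c\<^sub>4) * exp (a * (2 * l\<^sup>2) - sqrt n / 2)"
      using c mult_left_mono[OF m2 a0] by (intro mult_left_mono) auto
    also have "a * (2 * l\<^sup>2) = 2 * c\<^sub>2 * l powr b\<^sub>0 * l\<^sup>2 + 2 * (c\<^sub>5 + c\<^sub>7) * l ^ 4"
      by (simp add: a_def algebra_simps power2_eq_square power4_eq_xxxx)
    finally show ?thesis .
  qed
  finally show ?thesis by simp
qed

lemma mixing_dists_nonempty: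
  assumes "L > 0"
  shows "mixing_dists L \<noteq> {}"
proof -
  have "restrict (\<lambda>_. 1) {1} \<in> weight_simplex 1" "restrict (\<lambda>_. 0) {1} \<in> cube L 1"
    using assms by (auto simp: weight_simplex_def cube_def)
  then have "mixing 1 (restrict (\<lambda>_. 1) {1}) (restrict (\<lambda>_. 0) {1}) \<in> mixing_dists L"
    by (auto simp: mixing_dists_def mixing_dists_k_def)
  then show ?thesis by blast
qed

theorem theorem2p7:
  fixes L :: real
  assumes "L > 0"
  shows "\<exists>M>0. \<forall>K T W.
    (\<forall>n\<ge>1. prior_spec L (K n) (T n) (W n)) \<and> prior_P1 K \<and> prior_P2 W \<and> prior_P3 L T \<longrightarrow>
    ((\<lambda>n. SUP \<nu>0\<in>mixing_dists L.
        \<integral>x. measure (posterior n (prior L (K n) (T n) (W n)) x)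
               {\<nu> \<in> mixing_dists L. W1 \<nu> \<nu>0 \<ge> M * (ln (ln (real n)) / ln (real n))}
          \<partial>iid_sample n (convolution \<nu>0 std_normal)) \<longlongrightarrow> (0::real)) sequentially"
\<comment> \<open>The constant depends on \<open>L\<close> alone and is fixed before the prior is
  introduced.\<close>
proof (intro exI[of _ "704 * L + 1"] conjI allI impI; (elim conjE)?)
  show "704 * L + 1 > 0" using assms by simp
next
  fix K :: "nat \<Rightarrow> nat measure" and T W :: "nat \<Rightarrow> nat \<Rightarrow> (nat \<Rightarrow> real) measure"
  assume spec: "\<forall>n\<ge>1. prior_spec L (K n) (T n) (W n)" and P1: "prior_P1 K" and P2: "prior_P2 W" and P3: "prior_P3 L T"
  let ?I = "\<lambda>n \<nu>0. \<integral>x. measure (posterior n (prior L (K n) (T n) (W n)) x)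
               {\<nu> \<in> mixing_dists L. W1 \<nu> \<nu>0 \<ge> (704 * L + 1) * (ln (ln (real n)) / ln (real n))}
          \<partial>iid_sample n (convolution \<nu>0 std_normal)"
  obtain c\<^sub>1 c\<^sub>2 b\<^sub>0 where c1: "c\<^sub>1 > 0" "c\<^sub>2 > 0" "b\<^sub>0 > 0"
    and P1': "\<And>n k. n \<ge> 2 \<Longrightarrow> k \<ge> 1 \<Longrightarrow> measure (K n) {k} \<ge> c\<^sub>1 * exp (- (c\<^sub>2 * ln (real n) powr b\<^sub>0) * real k)"
    using P1 unfolding prior_P1_def by blast
  obtain c\<^sub>4 c\<^sub>5 where c4: "c\<^sub>4 > 0" "c\<^sub>5 > 0"
    and P2': "\<And>n k w0 \<eta>. n \<ge> 1 \<Longrightarrow> k \<ge> 1 \<Longrightarrow> w0 \<in> weight_simplex k \<Longrightarrow> \<eta> \<in> {0<..<1 / real k} \<Longrightarrow>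
      measure (W n k) {w \<in> weight_simplex k. (\<Sum>j=1..k. \<bar>w j - w0 j\<bar>) \<le> \<eta>} \<ge> c\<^sub>4 * \<eta> powr (c\<^sub>5 * real k)"
    using P2 unfolding prior_P2_def by blast
  obtain c\<^sub>6 c\<^sub>7 where c6: "c\<^sub>6 > 0" "c\<^sub>7 > 0"
    and P3': "\<And>n k \<theta>0 \<eta>. n \<ge> 1 \<Longrightarrow> k \<ge> 1 \<Longrightarrow> \<theta>0 \<in> cube L k \<Longrightarrow> \<eta> \<in> {0<..<1 / real k} \<Longrightarrow>
      measure (T n k) {\<theta> \<in> cube L k. (MAX j\<in>{1..k}. \<bar>\<theta> j - \<theta>0 j\<bar>) \<le> \<eta>} \<ge> c\<^sub>6 * \<eta> powr (c\<^sub>7 * real k)"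
    using P3 unfolding prior_P3_def by blast
  define b where "b n = (2 * ln (real n) + 1) * (4 * exp (- sqrt n / 2)) + 2 * exp (2 * L + 2) / n
      + 4 / (c\<^sub>1 * c\<^sub>6 * c\<^sub>4) * exp (2 * c\<^sub>2 * ln (real n) powr b\<^sub>0 * (ln (real n))\<^sup>2
          + 2 * (c\<^sub>5 + c\<^sub>7) * ln (real n) ^ 4 - sqrt n / 2)" for n :: nat
  \<comment> \<open>The size conditions of \<open>posterior_contraction_explicit\<close>. They
    involve only \<open>n\<close> and \<open>L\<close>, so one threshold serves all \<nu>0.\<close>
  have ev: "\<forall>\<^sub>F n::nat in sequentially. n \<ge> 2"
    "\<forall>\<^sub>F n::nat in sequentially. ln (ln (real n)) > 0"
    "\<forall>\<^sub>F n::nat in sequentially. ln (real n) / (8 * ln (ln (real n))) \<ge> 2"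
    "\<forall>\<^sub>F n::nat in sequentially. ln (real n) / (8 * ln (ln (real n))) \<ge> 2 * L + 1"
    "\<forall>\<^sub>F n::nat in sequentially. 2 * (ln (real n) / (8 * ln (ln (real n)))) / L + 1 \<le> ln (real n)"
    "\<forall>\<^sub>F n::nat in sequentially. 8 * ln (ln (real n)) \<ge> 1"
    "\<forall>\<^sub>F n::nat in sequentially. 32 * L * ln (real n) * exp (- ln (real n) / 8) < ln (ln (real n)) / ln (real n)"
    "\<forall>\<^sub>F n::nat in sequentially. ln (real n) \<ge> exp 2 * L"
    "\<forall>\<^sub>F n::nat in sequentially. ln (real n) \<ge> 2"
    "\<forall>\<^sub>F n::nat in sequentially. 2 * (3 + ln (real n) + L) \<le> exp ((ln (real n))\<^sup>2 - 2 * ln (real n) * L - L\<^sup>2 / 2 - ln (real n))"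
    "\<forall>\<^sub>F n::nat in sequentially. (ln (real n))\<^sup>2 + 2 < exp ((ln (real n))\<^sup>2)"
    using \<open>L > 0\<close> by real_asymp+
  have bound: "\<forall>\<^sub>F n in sequentially. \<forall>\<nu>0\<in>mixing_dists L. ?I n \<nu>0 \<le> b n"
    using ev
  proof eventually_elim
    case (elim n)
    show ?case
    proof
      fix \<nu>0 assume \<nu>0: "\<nu>0 \<in> mixing_dists L"
      have n1: "n \<ge> 1" using elim(1) by simp
      show "?I n \<nu>0 \<le> b n"
        unfolding b_def
        by (rule posterior_contraction_explicit[OF \<open>L > 0\<close> elim(1) c1(1,2) c4 c6 spec[rule_format, OF n1]
              P1'[OF elim(1)] P2'[OF n1] P3'[OF n1] \<nu>0 refl refl elim(2-)])
    qed
  qed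
  have lim: "(\<lambda>n. exp (2 * c\<^sub>2 * ln (real n) powr b\<^sub>0 * (ln (real n))\<^sup>2 + 2 * (c\<^sub>5 + c\<^sub>7) * ln (real n) ^ 4 - sqrt n / 2)) \<longlonglongrightarrow> 0"
    using c1 c4 c6 by real_asymp
  have lim2: "(\<lambda>n. (2 * ln (real n) + 1) * (4 * exp (- sqrt n / 2))) \<longlonglongrightarrow> 0" by real_asymp
  have lim3: "(\<lambda>n. 2 * exp (2 * L + 2) / real n) \<longlonglongrightarrow> 0" by real_asymp
  have b0: "b \<longlonglongrightarrow> 0"
    unfolding b_def[abs_def]
    by (rule tendsto_add_zero[OF tendsto_add_zero[OF lim2 lim3] tendsto_mult_right_zero[OF lim]])
  have ne: "mixing_dists L \<noteq> {}" by (rule mixing_dists_nonempty[OF \<open>L > 0\<close>])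
  show "(\<lambda>n. SUP \<nu>0\<in>mixing_dists L. ?I n \<nu>0) \<longlonglongrightarrow> 0"
  proof (rule tendsto_sandwich[OF _ _ tendsto_const b0])
    show "\<forall>\<^sub>F n in sequentially. (SUP \<nu>0\<in>mixing_dists L. ?I n \<nu>0) \<le> b n"
      using bound by eventually_elim (rule cSUP_least[OF ne], blast)
    \<comment> \<open>The lower estimate also uses \<open>b n\<close>: a supremum of reals dominates
      its members only if the set is bounded above.\<close>
    show "\<forall>\<^sub>F n in sequentially. 0 \<le> (SUP \<nu>0\<in>mixing_dists L. ?I n \<nu>0)"
      using bound
    proof eventually_elim
      case (elim n)
      obtain \<nu>1 where \<nu>1: "\<nu>1 \<in> mixing_dists L" using ne by blast
      have "0 \<le> ?I n \<nu>1" by (rule Bochner_Integration.integral_nonneg) simp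
      also have "\<dots> \<le> (SUP \<nu>0\<in>mixing_dists L. ?I n \<nu>0)"
        using elim by (intro cSUP_upper \<nu>1 bdd_aboveI2[of _ _ "b n"]) blast
      finally show ?case .
    qed
  qed
qed

end
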